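(* Let $p$ be a prime number such that the genus of $\Gamma_0(p)$ is zero, and let $n$ be a positive integer relatively prime to $p$. All sums over $r$ are over integers $r$, and all sums over $d\mid n$ are over positive divisors. Then: (1) $$\sum_{|r|<2\sqrt n} H(r^2-4n,\,p) \;=\; 2\sigma(n)\;-\;2\sum_{d\mid n}\min\{d,\,n/d\}\;+\;\begin{cases}\sum_{|r|<2} H(r^2-4,\,p) & \text{if } n \text{ is a perfect square},\\ 0 & \text{otherwise.}\end{cases}$$ (2) $$\sum_{|r|<2\sqrt n} t(r^2-4n,\,p) \;=\; -\,j_p(0)\sum_{d\mid n}\min\{d,\,n/d\}\;+\;\begin{cases} j_p(0)+\sum_{|r|<2} t(r^2-4,\,p) & \text{if } n \text{ is a perfect square},\\ 2 & \text{if } 4n+1 \text{ is a perfect square},\\ 0 & \text{otherwise.}\end{cases}$$ Here $j_p(0)$ is the value of the Hauptmodul $j_p$ at the cusp $0$ of $\Gamma_0(p)$.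
   Context: Let $N\ge 1$ be such that the modular curve $X_0(N)=\Gamma_0(N)\backslash\mathbb H^*$ has genus zero (here $\mathbb H$ is the upper half plane and $\mathbb H^*=\mathbb H\cup\mathbb Q\cup\{\infty\}$). $j_N(\tau)$ denotes the Hauptmodul for $\Gamma_0(N)$, i.e. the generator over $\mathbb C$ of the function field of $X_0(N)$, whose only pole on $X_0(N)$ is a simple pole at the cusp $\infty$, normalized so that $j_N(\tau)=q^{-1}+\sum_{m\ge1}c_mq^m$ with $c_m\in\mathbb Z$ and $q=e^{2\pi i\tau}$ (no constant term). For a cusp $s\not\sim\infty$, $j_N(s)$ is the value of $j_N$ at the corresponding point of $X_0(N)$. For a negative integer $D$, $\mathrm Q_{D,N}$ is the set of positive definite integral binary quadratic forms $ax^2+bxy+cy^2$ (so $a>0$; primitivity is not required) with $b^2-4ac=D$ and $a\equiv0\pmod N$. $\Gamma_0(N)$ acts on $\mathrm Q_{D,N}$ by $(Q\cdot\gamma)(x,y)=Q(\alpha x+\beta y,\gamma' x+\delta y)$ for $\gamma=\begin{pmatrix}\alpha&\beta\\ \gamma'&\delta\end{pmatrix}\in\Gamma_0(N)$. For $Q\in \mathrm Q_{D,N}$, $\tau_Q$ is the unique root in $\mathbb H$ of $Q(x,1)=0$, and $\omega_{Q,N}=|\overline\Gamma_0(N)_Q|$ is the order of the stabilizer of $Q$ in $\overline\Gamma_0(N)=\Gamma_0(N)/\{\pm1\}$. Define $$H(D,N)=\sum_{[Q]\in \mathrm Q_{D,N}/\Gamma_0(N)}\frac1{\omega_{Q,N}},\qquad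 t(D,N)=\sum_{[Q]\in \mathrm Q_{D,N}/\Gamma_0(N)}\frac1{\omega_{Q,N}}\,j_N(\tau_Q).$$ $\sigma(n)$ is the sum of the positive divisors of $n$. *)

theory Defs
  imports
    "HOL-Complex_Analysis.Complex_Analysis"
    "HOL-Homology.Homology"
    "HOL-Algebra.Free_Abelian_Groups"
    "HOL-Computational_Algebra.Nth_Powers"
begin

(* otherwise indexing of vectors is ambiguous with that of formal power series *)
no_notation fps_nth (infixl \<open>$\<close> 75)

definition SL2Z :: "(int^2^2) set" where
  "SL2Z = {A. det A = 1}"

definition Gamma0 :: "nat \<Rightarrow> (int^2^2) set" where
  "Gamma0 N = {A \<in> SL2Z. int N dvd A $ 2 $ 1}"

definition upper_half_plane :: "complex set" where
  "upper_half_plane = {z. Im z > 0}"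

definition moebius :: "int^2^2 \<Rightarrow> complex \<Rightarrow> complex" where
  "moebius A z = (of_int (A $ 1 $ 1) * z + of_int (A $ 1 $ 2)) /
                 (of_int (A $ 2 $ 1) * z + of_int (A $ 2 $ 2))"

text \<open>
  The one-point compactification of the plane is modelled by \<^typ>\<open>complex option\<close>,
  with \<^term>\<open>None\<close> as the point at infinity.
\<close>

definition moebius_ext :: "int^2^2 \<Rightarrow> complex option \<Rightarrow> complex option" where
  "moebius_ext A w =
     (case w of
        None \<Rightarrow> if A $ 2 $ 1 = 0 then None
                else Some (of_int (A $ 1 $ 1) / of_int (A $ 2 $ 1))
      | Some z \<Rightarrow> if of_int (A $ 2 $ 1) * z + of_int (A $ 2 $ 2) = 0 then None
                  else Some (moebius A z))"

definition cusps :: "complex option set" where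
  "cusps = insert None (Some ` \<rat>)"

definition H_star :: "complex option set" where
  "H_star = Some ` upper_half_plane \<union> cusps"

text \<open>
  Neighbourhoods of a cusp inside the upper half plane. At infinity they are the half planes
  \<open>Im z > t\<close>; at a rational \<open>s\<close> they are the open discs tangent to the real axis at \<open>s\<close>,
  since \<open>Im z / |z - s|\<^sup>2 > t\<close> describes (for \<open>t > 0\<close>) the disc of radius \<open>1 / (2t)\<close>
  centred at \<open>s + \<i> / (2t)\<close>.
\<close>

definition at_cusp :: "complex option \<Rightarrow> complex filter" where
  "at_cusp s =
     (case s of
        None \<Rightarrow> filtercomap Im at_top
      | Some x \<Rightarrow> filtercomap (\<lambda>z. Im z / (cmod (z - x))\<^sup>2) at_top)"

definition H_star_topology :: "complex option topology" where
  "H_star_topology = topology (\<lambda>U.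
     U \<subseteq> H_star \<and> open {z \<in> upper_half_plane. Some z \<in> U} \<and>
     (\<forall>s\<in>U \<inter> cusps. eventually (\<lambda>z. Some z \<in> U) (at_cusp s)))"

lemma openin_H_star_topology:
  "openin H_star_topology U \<longleftrightarrow>
     U \<subseteq> H_star \<and> open {z \<in> upper_half_plane. Some z \<in> U} \<and>
     (\<forall>s\<in>U \<inter> cusps. eventually (\<lambda>z. Some z \<in> U) (at_cusp s))"
proof -
  let ?P = "\<lambda>U. U \<subseteq> H_star \<and> open {z \<in> upper_half_plane. Some z \<in> U} \<and>
     (\<forall>s\<in>U \<inter> cusps. eventually (\<lambda>z. Some z \<in> U) (at_cusp s))"
  have "istopology ?P"
    unfolding istopology_def
  proof (intro conjI allI impI)
    fix S T assume S: "?P S" and T: "?P T"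
    have eq: "{z \<in> upper_half_plane. Some z \<in> S \<inter> T} =
          {z \<in> upper_half_plane. Some z \<in> S} \<inter> {z \<in> upper_half_plane. Some z \<in> T}" by auto
    show "S \<inter> T \<subseteq> H_star" using S by auto
    show "open {z \<in> upper_half_plane. Some z \<in> S \<inter> T}" unfolding eq using S T by auto
    show "\<forall>s\<in>S \<inter> T \<inter> cusps. eventually (\<lambda>z. Some z \<in> S \<inter> T) (at_cusp s)"
      using S T by (auto intro: eventually_conj)
  next
    fix K assume K: "\<forall>U\<in>K. ?P U"
    have eq: "{z \<in> upper_half_plane. Some z \<in> \<Union>K} =
          (\<Union>U\<in>K. {z \<in> upper_half_plane. Some z \<in> U})" by auto
    show "\<Union>K \<subseteq> H_star" using K by auto
    show "open {z \<in> upper_half_plane. Some z \<in> \<Union>K}" unfolding eq using K by auto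
    show "\<forall>s\<in>\<Union>K \<inter> cusps. eventually (\<lambda>z. Some z \<in> \<Union>K) (at_cusp s)"
    proof
      fix s assume "s \<in> \<Union>K \<inter> cusps"
      then obtain U where U: "U \<in> K" "s \<in> U \<inter> cusps" by auto
      with K have "eventually (\<lambda>z. Some z \<in> U) (at_cusp s)" by blast
      then show "eventually (\<lambda>z. Some z \<in> \<Union>K) (at_cusp s)"
        by (rule eventually_mono) (use U in auto)
    qed
  qed
  then show ?thesis
    unfolding H_star_topology_def by (simp add: topology_inverse')
qed

definition Gamma0_orbits :: "nat \<Rightarrow> complex option set set" where
  "Gamma0_orbits N = (\<lambda>w. (\<lambda>A. moebius_ext A w) ` Gamma0 N) ` H_star"

text \<open>The quotient topology: a set of orbits is open iff the union of these orbits is open.\<close>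

definition X0 :: "nat \<Rightarrow> complex option set topology" where
  "X0 N = topology (\<lambda>V. V \<subseteq> Gamma0_orbits N \<and>
     openin H_star_topology {w \<in> H_star. (\<lambda>A. moebius_ext A w) ` Gamma0 N \<in> V})"

lemma openin_X0:
  "openin (X0 N) V \<longleftrightarrow> V \<subseteq> Gamma0_orbits N \<and>
     openin H_star_topology {w \<in> H_star. (\<lambda>A. moebius_ext A w) ` Gamma0 N \<in> V}"
proof -
  let ?O = "\<lambda>w. (\<lambda>A. moebius_ext A w) ` Gamma0 N"
  let ?P = "\<lambda>V. V \<subseteq> Gamma0_orbits N \<and> openin H_star_topology {w \<in> H_star. ?O w \<in> V}"
  have "istopology ?P"
    unfolding istopology_def
  proof (intro conjI allI impI)
    fix S T assume S: "?P S" and T: "?P T"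
    have eq: "{w \<in> H_star. ?O w \<in> S \<inter> T} = {w \<in> H_star. ?O w \<in> S} \<inter> {w \<in> H_star. ?O w \<in> T}"
      by auto
    show "S \<inter> T \<subseteq> Gamma0_orbits N" using S by auto
    show "openin H_star_topology {w \<in> H_star. ?O w \<in> S \<inter> T}"
      unfolding eq using S T by (intro openin_Int) auto
  next
    fix K assume K: "\<forall>V\<in>K. ?P V"
    have eq: "{w \<in> H_star. ?O w \<in> \<Union>K} = (\<Union>V\<in>K. {w \<in> H_star. ?O w \<in> V})" by auto
    show "\<Union>K \<subseteq> Gamma0_orbits N" using K by auto
    show "openin H_star_topology {w \<in> H_star. ?O w \<in> \<Union>K}"
      unfolding eq using K by (intro openin_Union) auto
  qed
  then show ?thesis
    unfolding X0_def by (simp add: topology_inverse')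
qed

text \<open>A compact Riemann surface has genus \<open>g\<close> iff its first integral homology group is
  free abelian of rank \<open>2g\<close>.\<close>

definition has_genus :: "'a topology \<Rightarrow> nat \<Rightarrow> bool" where
  "has_genus X g \<longleftrightarrow> homology_group 1 X \<cong> free_Abelian_group {..<2 * g}"

text \<open>
  Elements of the function field of \<open>X\<^sub>0(N)\<close>, as functions on the upper half plane. Since
  \<open>\<Gamma>(N) \<subseteq> \<Gamma>\<^sub>0(N)\<close> is normal in \<open>SL\<^sub>2(\<int>)\<close>, every cusp width divides \<open>N\<close>, so that
  \<open>exp (2 \<pi> \<i> \<tau> / N)\<close> can be used to express meromorphy at all cusps. As usual for
  nicely meromorphic functions, the value at a pole is set to 0.
\<close>

definition modular_function :: "nat \<Rightarrow> (complex \<Rightarrow> complex) \<Rightarrow> bool" where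
  "modular_function N f \<longleftrightarrow>
     f nicely_meromorphic_on upper_half_plane \<and>
     (\<forall>A\<in>Gamma0 N. \<forall>\<tau>\<in>upper_half_plane. f (moebius A \<tau>) = f \<tau>) \<and>
     (\<forall>A\<in>SL2Z. \<exists>F. F meromorphic_on {0} \<and>
        eventually (\<lambda>\<tau>. f (moebius A \<tau>) = F (exp (2 * of_real pi * \<i> * \<tau> / of_nat N)))
          (at_cusp None))"

definition nome :: "complex \<Rightarrow> complex" where
  "nome \<tau> = exp (2 * of_real pi * \<i> * \<tau>)"

text \<open>
  The third and fourth conditions state that there is no pole on \<open>X\<^sub>0(N)\<close> outside the
  cusp \<open>\<infinity>\<close>; the \<open>q\<close>-expansion in the last one includes that the pole at \<open>\<infinity>\<close> is simple.
\<close>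

definition hauptmodul :: "nat \<Rightarrow> (complex \<Rightarrow> complex) \<Rightarrow> bool" where
  "hauptmodul N j \<longleftrightarrow>
     modular_function N j \<and>
     (\<forall>f. modular_function N f \<longrightarrow>
        (\<exists>P Q :: complex poly. Q \<noteq> 0 \<and>
           (\<forall>\<tau>\<in>upper_half_plane. poly Q (j \<tau>) \<noteq> 0 \<longrightarrow> f \<tau> = poly P (j \<tau>) / poly Q (j \<tau>)))) \<and>
     j holomorphic_on upper_half_plane \<and>
     (\<forall>s\<in>cusps. (\<forall>A\<in>Gamma0 N. moebius_ext A None \<noteq> s) \<longrightarrow> (\<exists>c. (j \<longlongrightarrow> c) (at_cusp s))) \<and>
     (\<exists>c :: nat \<Rightarrow> int. \<forall>\<tau>\<in>upper_half_plane.
        (\<lambda>m. of_int (c (Suc m)) * nome \<tau> ^ Suc m) sums (j \<tau> - inverse (nome \<tau>)))"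

definition cusp_value :: "(complex \<Rightarrow> complex) \<Rightarrow> complex option \<Rightarrow> complex" where
  "cusp_value j s = Lim (at_cusp s) j"

text \<open>The triple \<open>(a, b, c)\<close> represents \<open>a x\<^sup>2 + b x y + c y\<^sup>2\<close>.\<close>

type_synonym bqf = "int \<times> int \<times> int"

fun bqf_eval :: "bqf \<Rightarrow> 'a::comm_ring_1 \<Rightarrow> 'a \<Rightarrow> 'a" where
  "bqf_eval (a, b, c) x y = of_int a * x\<^sup>2 + of_int b * x * y + of_int c * y\<^sup>2"

fun bqf_act :: "bqf \<Rightarrow> int^2^2 \<Rightarrow> bqf" where
  "bqf_act (a, b, c) A =
     (bqf_eval (a, b, c) (A $ 1 $ 1) (A $ 2 $ 1),
      2 * a * A $ 1 $ 1 * A $ 1 $ 2 + b * (A $ 1 $ 1 * A $ 2 $ 2 + A $ 1 $ 2 * A $ 2 $ 1)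
        + 2 * c * A $ 2 $ 1 * A $ 2 $ 2,
      bqf_eval (a, b, c) (A $ 1 $ 2) (A $ 2 $ 2))"

lemma bqf_eval_act:
  "bqf_eval (bqf_act Q A) x y =
     bqf_eval Q (of_int (A $ 1 $ 1) * x + of_int (A $ 1 $ 2) * y)
                (of_int (A $ 2 $ 1) * x + of_int (A $ 2 $ 2) * y)"
  by (cases Q) (simp add: algebra_simps power2_eq_square)

definition bqf_set :: "int \<Rightarrow> nat \<Rightarrow> bqf set" where
  "bqf_set D N = {(a, b, c). a > 0 \<and> b\<^sup>2 - 4 * a * c = D \<and> int N dvd a}"

definition bqf_equiv :: "int \<Rightarrow> nat \<Rightarrow> (bqf \<times> bqf) set" where
  "bqf_equiv D N = {(Q, Q'). Q \<in> bqf_set D N \<and> (\<exists>A\<in>Gamma0 N. Q' = bqf_act Q A)}"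

definition bqf_classes :: "int \<Rightarrow> nat \<Rightarrow> bqf set set" where
  "bqf_classes D N = bqf_set D N // bqf_equiv D N"

text \<open>The elements of \<open>\<Gamma>\<^sub>0(N) / {\<plusminus>1}\<close> are the cosets \<open>{A, -A}\<close>.\<close>

definition omega :: "bqf \<Rightarrow> nat \<Rightarrow> nat" where
  "omega Q N = card ((\<lambda>A. {A, - A}) ` {A \<in> Gamma0 N. bqf_act Q A = Q})"

definition tau :: "bqf \<Rightarrow> complex" where
  "tau Q = (THE z. z \<in> upper_half_plane \<and> bqf_eval Q z 1 = 0)"

text \<open>The terms of the sums below do not depend on the chosen representative of a class.\<close>

definition class_rep :: "bqf set \<Rightarrow> bqf" where
  "class_rep C = (SOME Q. Q \<in> C)"

definition class_number :: "int \<Rightarrow> nat \<Rightarrow> real" where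
  "class_number D N = (\<Sum>C\<in>bqf_classes D N. 1 / real (omega (class_rep C) N))"

definition trace_sm :: "(complex \<Rightarrow> complex) \<Rightarrow> int \<Rightarrow> nat \<Rightarrow> complex" where
  "trace_sm j D N =
     (\<Sum>C\<in>bqf_classes D N. 1 / of_nat (omega (class_rep C) N) * j (tau (class_rep C)))"

definition divisor_sum :: "nat \<Rightarrow> nat" where
  "divisor_sum n = (\<Sum>d | d dvd n. d)"

end

theory Submission
  imports Defs "HOL-Real_Asymp.Real_Asymp" "HOL-Computational_Algebra.Fundamental_Theorem_Algebra"
begin

text \<open>
  Both identities say that two functions on the modular curve \<open>X\<^sub>0(p)\<close> have the same divisor. Let \<open>M\<close>
  run through representatives, modulo \<open>\<Gamma>\<^sub>0(p)\<close> from the left, of the integral matrices of determinant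
  \<open>n\<close> with lower left entry divisible by \<open>p\<close>; if \<open>n = k\<^sup>2\<close>, leave out the class of the scalar matrix \<open>k\<close>.
  The function \<open>F(\<tau>) = \<Prod>\<^sub>M (j(\<tau>) - j(M\<tau>))\<close> is holomorphic and \<open>\<Gamma>\<^sub>0(p)\<close>-invariant, because right
  multiplication by \<open>\<Gamma>\<^sub>0(p)\<close> permutes the classes of the \<open>M\<close>.

  Zeros in the upper half plane. The Hauptmodul separates orbits (\<open>j_injective\<close>), so a factor
  vanishes at \<open>\<tau>\<close> iff its class contains a matrix that fixes \<open>\<tau>\<close>. It then vanishes exactly as fast as
  \<open>j - j(\<tau>)\<close>: the ratio of \<open>j(M w) - j(\<tau>)\<close> and \<open>j(w) - j(\<tau>)\<close> tends to a limit different from \<open>1\<close>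
  (\<open>local_ratio\<close>). A matrix of determinant \<open>n\<close> and trace \<open>r\<close> with positive lower left entry which fixes
  \<open>\<tau>\<close> is the same thing as a form of discriminant \<open>r\<^sup>2 - 4n\<close> with root \<open>\<tau>\<close>, and each class that contains
  matrices fixing \<open>\<tau>\<close> contains, up to the sign, as many of them as the stabiliser of \<open>\<tau>\<close> in \<open>\<Gamma>\<^sub>0(p)/{\<plusminus>1}\<close>
  has elements. Hence the number \<open>k(v)\<close> of factors that vanish at the points with \<open>j = v\<close> is the sum
  of the \<open>1 / \<omega>\<^sub>Q\<close> over all classes of forms with discriminant \<open>r\<^sup>2 - 4n\<close> and \<open>j(\<tau>\<^sub>Q) = v\<close>, less, if \<open>n\<close> is a
  square, the same sum for \<open>r\<^sup>2 - 4\<close>, which belongs to the omitted class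
  (\<open>coincidences_eq_class_weights\<close>).

  Behaviour at the cusps. With the representatives \<open>\<tau> \<mapsto> (a\<tau> + b)/d\<close>, \<open>a d = n\<close> and \<open>0 \<le> b < d\<close>, the
  product over \<open>b\<close> can be computed from \<open>\<Prod>\<^sub>b (1 - \<zeta>\<^sup>b x) = 1 - x\<^sup>d\<close>. At the cusp \<open>0\<close> this gives a zero of
  order \<open>m = \<Sum> min(d, n/d)\<close> in the local parameter, at \<open>\<infinity>\<close> a pole of order \<open>D = \<Sum> max(d, n/d)\<close>, both
  less \<open>1\<close> if \<open>n\<close> is a square; moreover \<open>F\<close> is a constant times \<open>q\<^sup>-\<^sup>D (1 - s q + o(q))\<close>, where \<open>s\<close> is the
  number of \<open>d\<close> with \<open>\<bar>d - n/d\<bar> = 1\<close> (\<open>hecke_prod_at_infinity\<close>, \<open>hecke_prod_at_zero\<close>).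

  Conclusion. Let \<open>R = (j - j(0))\<^sup>m \<Prod>\<^sub>v (j - v)\<^bsup>k(v)\<^esup>\<close>. Then \<open>F / R\<close> extends to an invariant holomorphic
  function without zeros which has a nonzero limit at the cusp \<open>0\<close>. This function or its inverse
  also has a limit at \<open>\<infinity>\<close>, and so is constant by the maximum principle (\<open>invariant_constant\<close>). So \<open>F\<close>
  and \<open>R\<close> have the same pole order at \<open>\<infinity>\<close>, that is \<open>\<Sum>\<^sub>v k(v) + m = D\<close>, which is the class number
  relation; and the same second coefficient, that is \<open>\<Sum>\<^sub>v k(v) v + m j(0) = s\<close>, which is the relation
  for the traces.

  The Hauptmodul separates orbits because its only pole is a simple one: the set of values taken
  on two different orbits is open, it is bounded since \<open>j\<close> is injective on orbits near the pole, and
  it is relatively closed in the connected complement of a countable set.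
\<close>

section \<open>Integral matrices acting on the upper half plane\<close>

lemma in_uhp [simp]: "z \<in> upper_half_plane \<longleftrightarrow> Im z > 0"
  by (simp add: upper_half_plane_def)

lemma open_uhp: "open upper_half_plane"
  unfolding upper_half_plane_def by (rule open_halfspace_Im_gt)

lemma connected_uhp: "connected upper_half_plane"
  unfolding upper_half_plane_def by (intro convex_connected convex_halfspace_Im_gt)

definition mat2 :: "int \<Rightarrow> int \<Rightarrow> int \<Rightarrow> int \<Rightarrow> int^2^2" where
  "mat2 a b c d = vector [vector [a, b], vector [c, d]]"

lemma mat2_nth [simp]:
  "mat2 a b c d $ 1 $ 1 = a" "mat2 a b c d $ 1 $ 2 = b"
  "mat2 a b c d $ 2 $ 1 = c" "mat2 a b c d $ 2 $ 2 = d"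
  by (simp_all add: mat2_def)

lemma mat2_expand: "A = mat2 (A $ 1 $ 1) (A $ 1 $ 2) (A $ 2 $ 1) (A $ 2 $ 2)"
  by (simp add: vec_eq_iff forall_2)

lemma mat2_cases: obtains a b c d where "A = mat2 a b c d"
  using mat2_expand by blast

lemma mat2_eq_iff [simp]: "mat2 a b c d = mat2 a' b' c' d' \<longleftrightarrow> a = a' \<and> b = b' \<and> c = c' \<and> d = d'"
  by (auto simp: vec_eq_iff forall_2)

lemma mat2_mult [simp]:
  "mat2 a b c d ** mat2 a' b' c' d' = mat2 (a * a' + b * c') (a * b' + b * d') (c * a' + d * c')
      (c * b' + d * d')"
  by (simp add: vec_eq_iff forall_2 matrix_matrix_mult_def sum_2)

lemma det_mat2 [simp]: "det (mat2 a b c d) = a * d - b * c"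
  by (simp add: det_2)

lemma mat_1_eq_mat2: "mat 1 = mat2 1 0 0 1"
  by (simp add: vec_eq_iff forall_2 mat_def)

lemma uminus_mat2 [simp]: "- mat2 a b c d = mat2 (-a) (-b) (-c) (-d)"
  by (simp add: vec_eq_iff forall_2)

text \<open>
  For \<open>n = 1\<close> this is \<open>\<Gamma>\<^sub>0(p)\<close> itself; in general, its decomposition into cosets \<open>\<Gamma>\<^sub>0(p) M\<close> defines the
  \<open>n\<close>-th Hecke correspondence.
\<close>

definition hecke :: "nat \<Rightarrow> int \<Rightarrow> (int^2^2) set" where
  "hecke p n = {A. det A = n \<and> int p dvd A $ 2 $ 1}"

lemma Gamma0_eq_hecke: "Gamma0 p = hecke p 1"
  by (auto simp: Gamma0_def SL2Z_def hecke_def)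

lemma mat2_in_hecke [simp]: "mat2 a b c d \<in> hecke p n \<longleftrightarrow> a * d - b * c = n \<and> int p dvd c"
  by (simp add: hecke_def)

lemma mat2_in_Gamma0 [simp]: "mat2 a b c d \<in> Gamma0 p \<longleftrightarrow> a * d - b * c = 1 \<and> int p dvd c"
  by (simp add: Gamma0_eq_hecke)

lemma hecke_mult: "A \<in> hecke p m \<Longrightarrow> B \<in> hecke p n \<Longrightarrow> A ** B \<in> hecke p (m * n)"
proof -
  assume *: "A \<in> hecke p m" "B \<in> hecke p n"
  hence "det (A ** B) = m * n" by (simp add: hecke_def det_mul)
  moreover have "(A ** B) $ 2 $ 1 = A $ 2 $ 1 * B $ 1 $ 1 + A $ 2 $ 2 * B $ 2 $ 1"
    by (simp add: matrix_matrix_mult_def sum_2)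
  ultimately show ?thesis using * by (simp add: hecke_def)
qed

lemma Gamma0_mult_hecke: "A \<in> Gamma0 p \<Longrightarrow> B \<in> hecke p n \<Longrightarrow> A ** B \<in> hecke p n"
  using hecke_mult[of A p 1 B n] by (simp add: Gamma0_eq_hecke)

lemma hecke_mult_Gamma0: "A \<in> hecke p n \<Longrightarrow> B \<in> Gamma0 p \<Longrightarrow> A ** B \<in> hecke p n"
  using hecke_mult[of A p n B 1] by (simp add: Gamma0_eq_hecke)

lemma Gamma0_mult: "A \<in> Gamma0 p \<Longrightarrow> B \<in> Gamma0 p \<Longrightarrow> A ** B \<in> Gamma0 p"
  using Gamma0_mult_hecke[of A p B 1] by (simp add: Gamma0_eq_hecke)

text \<open>
  The adjugate matrix, which keeps the entries integral and is the inverse if the determinant is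
  \<open>1\<close>.
\<close>

definition adj2 :: "int^2^2 \<Rightarrow> int^2^2" where
  "adj2 A = mat2 (A $ 2 $ 2) (- (A $ 1 $ 2)) (- (A $ 2 $ 1)) (A $ 1 $ 1)"

lemma adj2_mat2 [simp]: "adj2 (mat2 a b c d) = mat2 d (-b) (-c) a"
  by (simp add: adj2_def)

lemma adj2_in_hecke: "A \<in> hecke p n \<Longrightarrow> adj2 A \<in> hecke p n"
  by (cases A rule: mat2_cases) (auto simp: algebra_simps)

lemma adj2_in_Gamma0: "A \<in> Gamma0 p \<Longrightarrow> adj2 A \<in> Gamma0 p"
  by (simp add: Gamma0_eq_hecke adj2_in_hecke)

lemma adj2_mult: "det A = 1 \<Longrightarrow> adj2 A ** A = mat 1" "det A = 1 \<Longrightarrow> A ** adj2 A = mat 1"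
  by (cases A rule: mat2_cases; simp add: mat_1_eq_mat2 algebra_simps)+

lemma det_Gamma0: "A \<in> Gamma0 p \<Longrightarrow> det A = 1"
  by (simp add: Gamma0_def SL2Z_def)

lemma mat_1_in_Gamma0: "mat 1 \<in> Gamma0 p"
  by (simp add: mat_1_eq_mat2)

lemma moebius_mat2:
  "moebius (mat2 a b c d) z = (of_int a * z + of_int b) / (of_int c * z + of_int d)"
  by (simp add: moebius_def)

lemma moebius_1 [simp]: "moebius (mat 1) z = z"
  by (simp add: mat_1_eq_mat2 moebius_mat2)

lemma linear_form_nonzero:
  fixes c d :: int
  assumes "Im z > 0" "c \<noteq> 0 \<or> d \<noteq> 0"
  shows "of_int c * z + of_int d \<noteq> 0"
proof
  assume eq: "of_int c * z + of_int d = 0"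
  hence "Im (of_int c * z + of_int d) = 0" by simp
  hence "c = 0" using assms by simp
  thus False using eq assms by simp
qed

lemma moebius_denom_nonzero:
  fixes A :: "int^2^2"
  assumes "det A \<noteq> 0" "Im z > 0"
  shows "of_int (A $ 2 $ 1) * z + of_int (A $ 2 $ 2) \<noteq> 0"
  by (rule linear_form_nonzero) (use assms in \<open>auto simp: det_2\<close>)

lemma Im_moebius:
  "Im (moebius A z) = of_int (det A) * Im z / (cmod (of_int (A $ 2 $ 1) * z + of_int (A $ 2 $ 2)))\<^sup>2"
proof -
  obtain a b c d where A: "A = mat2 a b c d" by (rule mat2_cases)
  have "Im (moebius A z) = (of_int a * Im z * (of_int c * Re z + of_int d) -
      (of_int a * Re z + of_int b) * (of_int c * Im z)) /
        (cmod (of_int c * z + of_int d))\<^sup>2"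
    by (simp add: A moebius_mat2 Im_divide cmod_power2)
  also have "of_int a * Im z * (of_int c * Re z + of_int d) -
      (of_int a * Re z + of_int b) * (of_int c * Im z) = of_int (det A) * Im z"
    by (simp add: A algebra_simps)
  finally show ?thesis by (simp add: A)
qed

lemma moebius_in_uhp: "det A > 0 \<Longrightarrow> Im z > 0 \<Longrightarrow> Im (moebius A z) > 0"
  using moebius_denom_nonzero[of A z] by (auto simp: Im_moebius)

lemma moebius_mult:
  assumes "det B \<noteq> 0" "Im z > 0"
  shows "moebius (A ** B) z = moebius A (moebius B z)"
proof -
  obtain a b c d a' b' c' d' where AB: "A = mat2 a b c d" "B = mat2 a' b' c' d'"
    by (metis mat2_cases)
  define N D where "N = of_int a' * z + of_int b'" and "D = of_int c' * z + of_int d'"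
  have D: "D \<noteq> 0" using moebius_denom_nonzero[OF assms] by (simp add: AB D_def)
  have "moebius A (moebius B z) = (of_int a * (N / D) + of_int b) / (of_int c * (N / D) + of_int d)"
    by (simp add: AB moebius_mat2 N_def D_def)
  also have "of_int a * (N / D) + of_int b = (of_int a * N + of_int b * D) / D"
    using D by (simp add: field_simps)
  also have "of_int c * (N / D) + of_int d = (of_int c * N + of_int d * D) / D"
    using D by (simp add: field_simps)
  also have "(of_int a * N + of_int b * D) / D / ((of_int c * N + of_int d * D) / D) =
      (of_int a * N + of_int b * D) / (of_int c * N + of_int d * D)"
    using D by simp
  also have "\<dots> = moebius (A ** B) z"
    by (simp add: AB moebius_mat2 N_def D_def algebra_simps)
  finally show ?thesis ..
qed

lemma moebius_adj2:
  assumes "det A = 1" "Im z > 0"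
  shows "moebius (adj2 A) (moebius A z) = z" "moebius A (moebius (adj2 A) z) = z"
proof -
  have "det (adj2 A) = 1" using assms by (cases A rule: mat2_cases) (auto simp: algebra_simps)
  thus "moebius (adj2 A) (moebius A z) = z" "moebius A (moebius (adj2 A) z) = z"
    using assms by (simp_all add: moebius_mult[symmetric] adj2_mult)
qed

lemma moebius_has_field_derivative:
  assumes "det A \<noteq> 0" "Im z > 0"
  shows "(moebius A has_field_derivative
           of_int (det A) / (of_int (A $ 2 $ 1) * z + of_int (A $ 2 $ 2))\<^sup>2) (at z within S)"
proof -
  obtain a b c d where A: "A = mat2 a b c d" by (rule mat2_cases)
  have D: "of_int c * z + of_int d \<noteq> 0" using moebius_denom_nonzero[OF assms] by (simp add: A)
  have "((\<lambda>z. (of_int a * z + of_int b) / (of_int c * z + of_int d)) has_field_derivative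
     (of_int a * (of_int c * z + of_int d) - (of_int a * z + of_int b) * of_int c) /
       ((of_int c * z + of_int d) * (of_int c * z + of_int d))) (at z within S)"
    using D by (auto intro!: derivative_eq_intros)
  also have "of_int a * (of_int c * z + of_int d) - (of_int a * z + of_int b) * of_int c
     = of_int (det A)" by (simp add: A algebra_simps)
  finally show ?thesis
    by (simp add: A moebius_mat2[abs_def] power2_eq_square)
qed

lemma holomorphic_moebius: "det A \<noteq> 0 \<Longrightarrow> moebius A holomorphic_on upper_half_plane"
  unfolding holomorphic_on_def field_differentiable_def
  by (metis in_uhp moebius_has_field_derivative)

lemma continuous_moebius: "det A \<noteq> 0 \<Longrightarrow> Im z > 0 \<Longrightarrow> isCont (moebius A) z"
  using moebius_has_field_derivative[of A z UNIV] by (rule DERIV_isCont)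

definition Gamma0_rel :: "nat \<Rightarrow> complex \<Rightarrow> complex \<Rightarrow> bool" where
  "Gamma0_rel p z w \<longleftrightarrow> (\<exists>A\<in>Gamma0 p. moebius A z = w)"

lemma Gamma0_relI: "A \<in> Gamma0 p \<Longrightarrow> moebius A z = w \<Longrightarrow> Gamma0_rel p z w"
  by (auto simp: Gamma0_rel_def)

lemma Gamma0_rel_sym: "Im z > 0 \<Longrightarrow> Gamma0_rel p z w \<Longrightarrow> Gamma0_rel p w z"
  unfolding Gamma0_rel_def by (metis adj2_in_Gamma0 moebius_adj2(1) det_Gamma0)

lemma Gamma0_rel_trans: "Im z > 0 \<Longrightarrow> Gamma0_rel p z w \<Longrightarrow> Gamma0_rel p w v \<Longrightarrow> Gamma0_rel p z v"
  unfolding Gamma0_rel_def by (metis Gamma0_mult moebius_mult det_Gamma0 zero_neq_one)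

lemma moebius_Gamma0_in_uhp: "A \<in> Gamma0 p \<Longrightarrow> Im z > 0 \<Longrightarrow> Im (moebius A z) > 0"
  by (simp add: moebius_in_uhp det_Gamma0)

lemma Gamma0_rel_in_uhp: "Im z > 0 \<Longrightarrow> Gamma0_rel p z w \<Longrightarrow> Im w > 0"
  by (auto simp: Gamma0_rel_def moebius_Gamma0_in_uhp)

text \<open>
  The Fricke involution \<open>\<tau> \<mapsto> -1/(p\<tau>)\<close> exchanges the cusps \<open>0\<close> and \<open>\<infinity>\<close>. It normalises \<open>\<Gamma>\<^sub>0(p)\<close>, and thus
  makes it possible to treat the cusp \<open>0\<close> by means of expansions at \<open>\<infinity>\<close>. The conjugate of a matrix is
  written down entrywise, because the inverse of the Fricke matrix is not integral.
\<close>

definition fricke :: "nat \<Rightarrow> int^2^2" where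
  "fricke p = mat2 0 (-1) (int p) 0"

definition fricke_conj :: "nat \<Rightarrow> int^2^2 \<Rightarrow> int^2^2" where
  "fricke_conj p A = mat2 (A $ 2 $ 2) (- (A $ 2 $ 1 div int p)) (- int p * A $ 1 $ 2) (A $ 1 $ 1)"

lemma det_fricke [simp]: "det (fricke p) = int p"
  by (simp add: fricke_def)

lemma fricke_conj_in_hecke: "A \<in> hecke p n \<Longrightarrow> fricke_conj p A \<in> hecke p n"
  by (cases A rule: mat2_cases) (auto simp: fricke_conj_def algebra_simps)

lemma fricke_conj_in_Gamma0: "A \<in> Gamma0 p \<Longrightarrow> fricke_conj p A \<in> Gamma0 p"
  by (simp add: Gamma0_eq_hecke fricke_conj_in_hecke)

lemma fricke_conj_mult:
  assumes "A \<in> hecke p n"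
  shows "A ** fricke p = fricke p ** fricke_conj p A"
proof -
  obtain a b c d where A: "A = mat2 a b c d" by (rule mat2_cases)
  then obtain k where "c = int p * k" using assms by auto
  thus ?thesis by (cases "p = 0") (auto simp: A fricke_def fricke_conj_def)
qed

lemma moebius_fricke: "moebius (fricke p) z = - 1 / (of_nat p * z)"
  by (simp add: fricke_def moebius_mat2)

lemma moebius_fricke_fricke: "p > 0 \<Longrightarrow> moebius (fricke p) (moebius (fricke p) z) = z"
  by (simp add: moebius_fricke)

lemma fricke_in_uhp: "p > 0 \<Longrightarrow> Im z > 0 \<Longrightarrow> Im (moebius (fricke p) z) > 0"
  by (simp add: moebius_in_uhp)

lemma moebius_fricke_conj:
  assumes "A \<in> hecke p n" "n \<noteq> 0" "p > 0" "Im z > 0"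
  shows "moebius A (moebius (fricke p) z) = moebius (fricke p) (moebius (fricke_conj p A) z)"
proof -
  have "det (fricke_conj p A) \<noteq> 0"
    using fricke_conj_in_hecke[OF assms(1)] assms(2) by (simp add: hecke_def)
  thus ?thesis
    using assms fricke_conj_mult[OF assms(1)]
    by (simp add: moebius_mult[symmetric])
qed

section \<open>Reduction theory\<close>

lemma linear_form_bound:
  fixes c d :: int
  assumes "m > 0" "Im z \<ge> m" "cmod z \<le> B" "cmod (of_int c * z + of_int d) \<le> R"
  shows "\<bar>real_of_int c\<bar> \<le> R / m" "\<bar>real_of_int d\<bar> \<le> R + R / m * B"
proof -
  have "\<bar>of_int c\<bar> * m \<le> \<bar>of_int c\<bar> * Im z" using assms by (intro mult_left_mono) auto
  also have "\<dots> = \<bar>Im (of_int c * z + of_int d)\<bar>" using assms by (simp add: abs_mult)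
  also have "\<dots> \<le> R" using abs_Im_le_cmod[of "of_int c * z + of_int d"] assms by linarith
  finally show c: "\<bar>of_int c\<bar> \<le> R / m" using assms by (simp add: field_simps)
  have "cmod (of_int d) \<le> cmod (of_int c * z + of_int d) + cmod (of_int c * z)"
    by (metis add_diff_cancel_left' norm_triangle_ineq4)
  also have "\<dots> \<le> R + \<bar>of_int c\<bar> * cmod z" using assms by (simp add: norm_mult)
  also have "\<bar>of_int c\<bar> * cmod z \<le> R / m * B"
    using c assms by (intro mult_mono) (auto intro: order.trans[OF norm_ge_zero])
  finally show "\<bar>of_int d\<bar> \<le> R + R / m * B" by simp
qed

lemma finite_int_abs_le: "finite {k::int. \<bar>of_int k\<bar> \<le> (B::real)}"
proof (rule finite_subset)
  show "{k::int. \<bar>of_int k\<bar> \<le> B} \<subseteq> {- \<lfloor>B\<rfloor>..\<lfloor>B\<rfloor>}" by (auto simp: le_floor_iff abs_le_iff) linarith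
qed auto

text \<open>
  Proper discontinuity of the action: \<open>Im (A z) = n Im z / \<bar>cz + d\<bar>\<^sup>2\<close> bounds the denominator \<open>cz + d\<close>
  if \<open>z\<close> and \<open>A z\<close> stay in a compact set, and hence bounds the numerator as well; and a bound for a
  linear form in \<open>z\<close> bounds its coefficients.
\<close>

lemma finite_moebius_compact:
  assumes K: "compact K" "K \<subseteq> upper_half_plane" and n: "n > 0"
  shows "finite {A. det A = n \<and> (\<exists>z\<in>K. moebius A z \<in> K)}"
proof (cases "K = {}")
  case False
  obtain m where m: "m > 0" "\<And>z. z \<in> K \<Longrightarrow> m \<le> Im z"
  proof -
    have "continuous_on K Im" by (intro continuous_intros)
    from continuous_attains_inf[OF K(1) False this] obtain w where "w \<in> K" "\<forall>z\<in>K. Im w \<le> Im z"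
      by auto
    thus ?thesis using K that[of "Im w"] by auto
  qed
  obtain B where B: "cmod z \<le> B" if "z \<in> K" for z
    using compact_imp_bounded[OF K(1)] by (auto simp: bounded_iff)
  have B0: "B > 0"
  proof -
    from False obtain w where "w \<in> K" by auto
    thus ?thesis using m(1) m(2)[of w] B[of w] abs_Im_le_cmod[of w] by linarith
  qed
  define R where "R = sqrt (of_int n * B / m)"
  define R' where "R' = max R (B * R)"
  define X where "X = {k::int. \<bar>of_int k\<bar> \<le> max (R' / m) (R' + R' / m * B)}"
  have X: "finite X" unfolding X_def by (rule finite_int_abs_le)
  have "{A. det A = n \<and> (\<exists>z\<in>K. moebius A z \<in> K)} \<subseteq>
          (\<lambda>(a,b,c,d). mat2 a b c d) ` (X \<times> X \<times> X \<times> X)"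
  proof safe
    fix A z assume A: "n = det A" "z \<in> K" "moebius A z \<in> K"
    obtain a b c d where abcd: "A = mat2 a b c d" by (rule mat2_cases)
    let ?D = "of_int c * z + of_int d" and ?N = "of_int a * z + of_int b"
    have D: "?D \<noteq> 0" using moebius_denom_nonzero[of A z] A n K by (auto simp: abcd)
    have "m * (cmod ?D)\<^sup>2 \<le> Im (moebius A z) * (cmod ?D)\<^sup>2"
      using m A by (intro mult_right_mono) auto
    also have "\<dots> = of_int n * Im z" using D by (simp add: Im_moebius A(1) abcd)
    also have "\<dots> \<le> of_int n * B" using n B[OF A(2)] abs_Im_le_cmod[of z] by simp
    finally have "(cmod ?D)\<^sup>2 \<le> of_int n * B / m" using m by (simp add: field_simps)
    hence D_le: "cmod ?D \<le> R" unfolding R_def by (rule real_le_rsqrt)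
    have D_le': "cmod ?D \<le> R'" using D_le by (simp add: R'_def)
    have "?N = moebius A z * ?D" using D by (simp add: abcd moebius_mat2)
    hence "cmod ?N = cmod (moebius A z) * cmod ?D" by (metis norm_mult)
    also have "\<dots> \<le> B * R" using B[OF A(3)] D_le B0 by (intro mult_mono) auto
    finally have N_le: "cmod ?N \<le> R'" by (simp add: R'_def)
    have "a \<in> X" "b \<in> X" using linear_form_bound[OF m(1) m(2)[OF A(2)] B[OF A(2)] N_le]
      by (simp_all add: X_def le_max_iff_disj)
    moreover have "c \<in> X" "d \<in> X"
      using linear_form_bound[OF m(1) m(2)[OF A(2)] B[OF A(2)] D_le']
      by (simp_all add: X_def le_max_iff_disj)
    ultimately show "A \<in> (\<lambda>(a,b,c,d). mat2 a b c d) ` (X \<times> X \<times> X \<times> X)"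
      by (force simp: abcd image_iff)
  qed
  thus ?thesis by (rule finite_subset) (use X in auto)
qed auto

text \<open>
  The lattice \<open>\<int>z + \<int>\<close> has a shortest nonzero vector, and the coefficients of such a vector are
  coprime since otherwise a proper fraction of it would also belong to the lattice.
\<close>

lemma linear_form_minimum:
  assumes z: "Im z > 0"
  obtains c d :: int where "coprime c d" "\<And>c' d' :: int. c' \<noteq> 0 \<or> d' \<noteq> 0 \<Longrightarrow>
     cmod (of_int c * z + of_int d) \<le> cmod (of_int c' * z + of_int d')"
proof -
  define f where "f = (\<lambda>(c::int,d::int). cmod (of_int c * z + of_int d))"
  define S where "S = {x. f x \<le> 1 \<and> x \<noteq> (0,0)}"
  have "S \<subseteq> {k. \<bar>of_int k\<bar> \<le> 1 / Im z} \<times> {k. \<bar>of_int k\<bar> \<le> 1 + 1 / Im z * cmod z}"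
    using linear_form_bound[OF z order.refl order.refl, where R = 1] by (auto simp: S_def f_def)
  hence fin: "finite S" by (rule finite_subset) (intro finite_cartesian_product finite_int_abs_le)
  \<comment> \<open>This vector has length 1, so a minimum over the finite set \<open>S\<close> is one over
    the whole lattice.\<close>
  have ne: "(0,1) \<in> S" by (simp add: S_def f_def)
  obtain x where x: "x \<in> S" "\<And>y. y \<in> S \<Longrightarrow> f x \<le> f y"
    using arg_min_if_finite[of S f] fin ne by (metis empty_iff linorder_not_less)
  obtain c d where cd: "x = (c, d)" by (cases x)
  have min: "cmod (of_int c * z + of_int d) \<le> cmod (of_int c' * z + of_int d')"
    if "c' \<noteq> 0 \<or> d' \<noteq> 0" for c' d' :: int
  proof (cases "f (c', d') \<le> 1")
    case True
    thus ?thesis using x(2)[of "(c', d')"] that by (auto simp: S_def cd f_def)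
  next
    case False
    thus ?thesis using x(1) by (auto simp: S_def cd f_def)
  qed
  have cd0: "c \<noteq> 0 \<or> d \<noteq> 0" using x(1) by (auto simp: S_def cd)
  have "coprime c d"
  proof -
    define g where "g = gcd c d"
    have g: "g > 0" using cd0 by (auto simp: g_def)
    define c' d' where "c' = c div g" and "d' = d div g"
    have eq: "c = g * c'" "d = g * d'" by (auto simp: c'_def d'_def g_def)
    have "c' \<noteq> 0 \<or> d' \<noteq> 0" using eq cd0 by auto
    hence pos: "cmod (of_int c' * z + of_int d') > 0"
      and le: "cmod (of_int c * z + of_int d) \<le> cmod (of_int c' * z + of_int d')"
      using linear_form_nonzero[OF z] min by auto
    have "of_int c * z + of_int d = of_int g * (of_int c' * z + of_int d')"
      by (simp add: eq algebra_simps)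
    hence "cmod (of_int c * z + of_int d) = of_int g * cmod (of_int c' * z + of_int d')"
      using g by (simp add: norm_mult)
    with le pos have "of_int g \<le> (1::real)" by (simp add: mult_le_cancel_right1)
    with g have "g = 1" by simp
    thus ?thesis by (simp add: g_def coprime_iff_gcd_eq_1)
  qed
  thus ?thesis using that min by blast
qed

text \<open>
  Complete the coefficients of a shortest vector \<open>cz + d\<close> to a matrix \<open>A\<close> and translate \<open>A z\<close> to \<open>\<bar>Re (A
  z)\<bar> \<le> 1/2\<close>. The numerator of \<open>A z\<close> is a vector of the same lattice, so \<open>\<bar>A z\<bar> \<ge> 1\<close>, and therefore \<open>(Im
  (A z))\<^sup>2 \<ge> 3/4\<close>, which is more than enough.
\<close>

lemma SL2Z_reduction:
  assumes z: "Im z > 0"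
  obtains A where "det A = 1" "Im (moebius A z) \<ge> 1 / 2"
proof -
  obtain c d :: int where cd: "coprime c d" and min: "\<And>c' d' :: int. c' \<noteq> 0 \<or> d' \<noteq> 0 \<Longrightarrow>
     cmod (of_int c * z + of_int d) \<le> cmod (of_int c' * z + of_int d')"
    using linear_form_minimum[OF z] by blast
  obtain u v where "u * c + v * d = 1"
    using cd bezout_int[of c d] by (auto simp: coprime_iff_gcd_eq_1)
  hence det: "v * d - (-u) * c = 1" by simp
  define w where "w = moebius (mat2 v (-u) c d) z"
  define k where "k = - round (Re w)"
  define A where "A = mat2 (v + k * c) (-u + k * d) c d"
  have detA: "det A = 1" using det by (simp add: A_def algebra_simps)
  have D: "of_int c * z + of_int d \<noteq> 0"
    using moebius_denom_nonzero[OF _ z, of A] detA by (auto simp: A_def)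
  have Aw: "moebius A z = w + of_int k"
    using D by (simp add: A_def w_def moebius_mat2 field_simps)
  have Re: "\<bar>Re (moebius A z)\<bar> \<le> 1 / 2"
    using of_int_round_abs_le[of "Re w"] unfolding Aw k_def
    by (simp add: abs_minus_commute)
  have "v + k * c \<noteq> 0 \<or> -u + k * d \<noteq> 0" using detA by (auto simp: A_def)
  from min[OF this] have "cmod (moebius A z) \<ge> 1"
    using D by (simp add: A_def moebius_mat2 norm_divide)
  hence "1 \<le> (cmod (moebius A z))\<^sup>2" by simp
  also have "\<dots> = (Re (moebius A z))\<^sup>2 + (Im (moebius A z))\<^sup>2" by (rule cmod_power2)
  also have "(Re (moebius A z))\<^sup>2 \<le> (1/2)\<^sup>2" using Re by (subst abs_le_square_iff[symmetric]) simp
  finally have "(1/2)\<^sup>2 \<le> (Im (moebius A z))\<^sup>2" by (simp add: power2_eq_square)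
  moreover have "Im (moebius A z) > 0" using detA z by (simp add: moebius_in_uhp)
  ultimately have "Im (moebius A z) \<ge> 1 / 2" by (meson less_imp_le power2_le_imp_le)
  with detA show ?thesis by (rule that)
qed

definition strip :: "real \<Rightarrow> complex set" where
  "strip h = {z. Im z \<ge> h \<and> \<bar>Re z\<bar> \<le> 1 / 2}"

text \<open>
  Modulo \<open>\<Gamma>\<^sub>0(p)\<close>, every point lies in a vertical strip or in the image of that strip under the
  Fricke involution: if the lower left entry of the reducing matrix is prime to \<open>p\<close>, then
  multiplying by a translation and \<open>\<tau> \<mapsto> -1/\<tau>\<close> leads back to \<open>\<Gamma>\<^sub>0(p)\<close>, and \<open>-1/\<tau>\<close> is the image of \<open>\<tau>/p\<close>
  under the Fricke involution.
\<close>

lemma Gamma0_reduction: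
  assumes p: "prime p" and z: "Im z > 0"
  obtains s where "s \<in> strip (1 / (2 * real p))"
    "Gamma0_rel p z s \<or> Gamma0_rel p z (moebius (fricke p) s)"
proof -
  have p1: "p > 1" using p by (rule prime_gt_1_nat)
  obtain A where detA: "det A = 1" and Im: "Im (moebius A z) \<ge> 1 / 2" using SL2Z_reduction[OF z] .
  obtain a b c d where abcd: "A = mat2 a b c d" by (rule mat2_cases)
  define w where "w = moebius A z"
  have D: "of_int c * z + of_int d \<noteq> 0"
    using moebius_denom_nonzero[OF _ z, of A] detA by (auto simp: abcd)
  show ?thesis
  proof (cases "int p dvd c")
    case True
    define k where "k = - round (Re w)"
    define B where "B = mat2 (a + k * c) (b + k * d) c d"
    have "B \<in> Gamma0 p" using detA True by (simp add: B_def abcd algebra_simps)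
    moreover have "moebius B z = w + of_int k"
      using D by (simp add: B_def w_def abcd moebius_mat2 field_simps)
    ultimately have "Gamma0_rel p z (w + of_int k)" by (rule Gamma0_relI)
    moreover have "\<bar>Re (w + of_int k)\<bar> \<le> 1 / 2"
      using of_int_round_abs_le[of "Re w"] unfolding k_def by (simp add: abs_minus_commute)
    moreover have "1 / (2 * real p) \<le> 1 / 2" using p1 by (intro divide_left_mono) auto
    ultimately show ?thesis using Im
      by (intro that[of "w + of_int k"]) (auto simp: strip_def w_def)
  next
    case False
    have "coprime (int p) c" using p False by (simp add: prime_imp_coprime_int)
    then obtain u v where uv: "u * int p + v * c = 1"
      using bezout_int[of "int p" c] by (auto simp: coprime_iff_gcd_eq_1)
    \<comment> \<open>The translation by \<open>k\<close> makes the new lower left entry \<open>a + k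
      c\<close> divisible by \<open>p\<close>; this fixes \<open>k\<close> modulo
      \<open>p\<close> only, and \<open>m\<close> uses this freedom to move \<open>(w +
      k)/p\<close> into the strip.\<close>
    define k0 where "k0 = - a * v"
    have "a + k0 * c = a * (u * int p + v * c) + k0 * c" by (simp add: uv)
    also have "\<dots> = int p * (a * u)" by (simp add: k0_def algebra_simps)
    finally have k0: "int p dvd a + k0 * c" by simp
    define m where "m = - round (Re (w + of_int k0) / real p)"
    define k where "k = k0 + m * int p"
    have k: "int p dvd a + k * c"
    proof -
      have "a + k * c = (a + k0 * c) + int p * (m * c)" by (simp add: k_def algebra_simps)
      thus ?thesis using k0 by (metis dvd_add dvd_triv_left)
    qed
    define B where "B = mat2 (- c) (- d) (a + k * c) (b + k * d)"
    define s where "s = (w + of_int k) / of_nat p"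
    have B: "B \<in> Gamma0 p" using detA k by (simp add: B_def abcd algebra_simps)
    have detB: "det B \<noteq> 0" using B det_Gamma0 by fastforce
    have D2: "of_int (a + k * c) * z + of_int (b + k * d) \<noteq> 0"
      using moebius_denom_nonzero[OF detB z] unfolding B_def mat2_nth .
    have "w + of_int k = (of_int (a + k * c) * z + of_int (b + k * d)) / (of_int c * z + of_int d)"
      using D by (simp add: w_def abcd moebius_mat2 field_simps)
    hence "moebius (fricke p) s = moebius B z"
      using D D2 p1 by (simp add: moebius_fricke s_def B_def moebius_mat2 minus_divide_left)
    hence rel: "Gamma0_rel p z (moebius (fricke p) s)"
      using B by (auto simp: Gamma0_rel_def)
    have "s = (w + of_int k0) / of_nat p + of_int m"
      using p1 by (simp add: s_def k_def field_simps)
    hence "Re s = Re (w + of_int k0) / real p + of_int m" by simp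
    hence "\<bar>Re s\<bar> \<le> 1 / 2"
      using of_int_round_abs_le[of "Re (w + of_int k0) / real p"] unfolding m_def
      by (simp add: abs_minus_commute)
    moreover have "Im s \<ge> 1 / (2 * real p)"
      using Im p1 by (simp add: s_def w_def field_simps)
    ultimately show ?thesis using rel by (intro that[of s]) (auto simp: strip_def)
  qed
qed

section \<open>Invariant functions with limits at the cusps\<close>

text \<open>
  All limits are taken at the cusp \<open>\<infinity>\<close>; those at the cusp \<open>0\<close> are pulled back by the Fricke
  involution.
\<close>

abbreviation at_ioo :: "complex filter" where "at_ioo \<equiv> at_cusp None"

lemma at_ioo_def: "at_ioo = filtercomap Im at_top"
  by (simp add: at_cusp_def)

lemma eventually_at_ioo: "eventually P at_ioo \<longleftrightarrow> (\<exists>y. \<forall>z. Im z > y \<longrightarrow> P z)"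
  unfolding at_ioo_def eventually_filtercomap eventually_at_top_dense by blast

lemma eventually_at_ioo_pos: "eventually P at_ioo \<Longrightarrow> \<exists>y>0. \<forall>z. Im z > y \<longrightarrow> P z"
  unfolding eventually_at_ioo by (metis less_trans linorder_less_linear zero_less_one)

lemma at_ioo_neq_bot [simp]: "at_ioo \<noteq> bot"
  unfolding trivial_limit_def eventually_at_ioo
  by (metis complex.sel(2) gt_ex)

definition cstrip :: "real \<Rightarrow> real \<Rightarrow> complex set" where
  "cstrip h y = {z. Im z \<ge> h \<and> Im z \<le> y \<and> \<bar>Re z\<bar> \<le> 1 / 2}"

lemma compact_cstrip: "compact (cstrip h y)"
proof -
  have "cstrip h y = cbox (Complex (-1/2) h) (Complex (1/2) y)"
    by (auto simp: cstrip_def in_cbox_complex_iff abs_le_iff)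
  thus ?thesis by simp
qed

text \<open>
  Together with neighbourhoods of the two cusps, these compact sets meet every orbit.
\<close>

definition fundamental_compact :: "nat \<Rightarrow> real \<Rightarrow> complex set" where
  "fundamental_compact p y = cstrip (1 / (2 * real p)) y \<union> moebius (fricke p) ` cstrip
      (1 / (2 * real p)) y"

lemma fundamental_compact:
  assumes "p > 0"
  shows "compact (fundamental_compact p y)" "fundamental_compact p y \<subseteq> upper_half_plane"
proof -
  have \<delta>: "1 / (2 * real p) > 0" using assms by simp
  have strip_uhp: "cstrip (1 / (2 * real p)) y \<subseteq> upper_half_plane"
    using less_le_trans[OF \<delta>] unfolding cstrip_def upper_half_plane_def by blast
  have "continuous_on (cstrip (1 / (2 * real p)) y) (moebius (fricke p))"
    using strip_uhp assms
    by (intro holomorphic_on_imp_continuous_on[OF holomorphic_on_subset[OF holomorphic_moebius]])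
      auto
  thus "compact (fundamental_compact p y)"
    unfolding fundamental_compact_def by (intro compact_Un compact_cstrip compact_continuous_image)
  show "fundamental_compact p y \<subseteq> upper_half_plane"
    using strip_uhp fricke_in_uhp[OF assms] by (force simp: fundamental_compact_def)
qed

lemma Gamma0_reduction_compact:
  assumes "prime p" "Im z > 0"
  obtains s where "s \<in> fundamental_compact p y" "Gamma0_rel p z s"
  | s where "Im s > y" "Im s > 0" "Gamma0_rel p z s"
  | s where "Im s > y" "Im s > 0" "Gamma0_rel p z (moebius (fricke p) s)"
proof -
  have "1 / (2 * real p) > 0" using prime_gt_0_nat[OF assms(1)] by simp
  moreover obtain s where s: "s \<in> strip (1 / (2 * real p))"
    "Gamma0_rel p z s \<or> Gamma0_rel p z (moebius (fricke p) s)"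
    using Gamma0_reduction[OF assms] .
  ultimately have "Im s > 0" unfolding strip_def using less_le_trans by blast
  show ?thesis
  proof (cases "Im s > y")
    case True
    thus ?thesis using s(2) that(2,3) \<open>Im s > 0\<close> by blast
  next
    case False
    hence "s \<in> cstrip (1 / (2 * real p)) y" using s(1) by (auto simp: strip_def cstrip_def)
    thus ?thesis using s(2) that(1)[of s] that(1)[of "moebius (fricke p) s"]
      unfolding fundamental_compact_def by blast
  qed
qed

lemma eventually_at_ioo_uhp: "eventually (\<lambda>z. Im z > y) at_ioo"
  by (auto simp: eventually_at_ioo)

text \<open>
  By reduction theory and the decay at both cusps, an invariant function attains its maximal
  absolute value on a compact set. It is then constant by the maximum principle, and the constant
  can only be \<open>0\<close>.
\<close>

theorem bounded_invariant_eq_0: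
  assumes p: "prime p"
    and hol: "h holomorphic_on upper_half_plane"
    and inv: "\<And>A z. A \<in> Gamma0 p \<Longrightarrow> Im z > 0 \<Longrightarrow> h (moebius A z) = h z"
    and lim1: "(h \<longlongrightarrow> 0) at_ioo"
    and lim2: "((\<lambda>z. h (moebius (fricke p) z)) \<longlongrightarrow> 0) at_ioo"
    and z: "Im z > 0"
  shows "h z = 0"
proof (rule ccontr)
  assume nz: "h z \<noteq> 0"
  note C = fundamental_compact[OF prime_gt_0_nat[OF p]]
  define e where "e = cmod (h z)"
  have e: "e > 0" using nz by (simp add: e_def)
  have "eventually (\<lambda>z. cmod (h z) < e \<and> cmod (h (moebius (fricke p) z)) < e) at_ioo"
    using tendstoD[OF lim1 e] tendstoD[OF lim2 e] by (auto simp: dist_norm intro: eventually_conj)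
  then obtain y where y: "\<And>z. Im z > y \<Longrightarrow> cmod (h z) < e \<and> cmod (h (moebius (fricke p) z)) < e"
    unfolding eventually_at_ioo by blast
  let ?C = "fundamental_compact p y"
  have inv': "h v = h w" if "Im w > 0" "Gamma0_rel p w v" for w v
    using that inv by (auto simp: Gamma0_rel_def)
  have red: "\<exists>c\<in>?C. cmod (h w) = cmod (h c)" if w: "Im w > 0" "cmod (h w) \<ge> e" for w
    using p w(1)
  proof (cases rule: Gamma0_reduction_compact[where y = y])
    case (1 s)
    thus ?thesis using inv'[OF w(1) 1(2)] by (intro bexI[of _ s]) auto
  next
    case (2 s)
    thus ?thesis using inv'[OF w(1) 2(3)] y[OF 2(1)] w(2) by simp
  next
    case (3 s)
    thus ?thesis using inv'[OF w(1) 3(3)] y[OF 3(1)] w(2) by simp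
  qed
  have "continuous_on ?C (\<lambda>z. cmod (h z))"
    using holomorphic_on_imp_continuous_on[OF holomorphic_on_subset[OF hol C(2)]]
    by (intro continuous_intros)
  moreover have "?C \<noteq> {}" using red[of z] z by (auto simp: e_def)
  ultimately obtain c where c: "c \<in> ?C" "\<And>w. w \<in> ?C \<Longrightarrow> cmod (h w) \<le> cmod (h c)"
    using continuous_attains_sup[OF C(1), of y "\<lambda>z. cmod (h z)"] by auto
  have "e \<le> cmod (h c)" using red[of z] z c(2) by (force simp: e_def)
  have max: "cmod (h w) \<le> cmod (h c)" if "w \<in> upper_half_plane" for w
  proof (cases "cmod (h w) \<ge> e")
    case True
    thus ?thesis using red[of w] that c(2) by force
  next
    case False
    thus ?thesis using \<open>e \<le> cmod (h c)\<close> by linarith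
  qed
  have "h constant_on upper_half_plane"
    using maximum_modulus_principle[OF hol open_uhp connected_uhp open_uhp order.refl, of c]
      c C(2) max by blast
  then obtain k where k: "\<And>w. Im w > 0 \<Longrightarrow> h w = k" by (auto simp: constant_on_def)
  have "cmod (h (Complex 0 (max 1 (y + 1)))) < e" using y by force
  moreover have "h (Complex 0 (max 1 (y + 1))) = h z" using k z by simp
  ultimately show False by (simp add: e_def)
qed

text \<open>
  If \<open>a\<close> and \<open>b\<close> are the limits at the two cusps, then \<open>(h - a)(h - b)\<close> tends to \<open>0\<close> at both of them and
  vanishes identically. So \<open>h\<close> has at most two values, and is constant by continuity.
\<close>

theorem invariant_constant:
  assumes p: "prime p"
    and hol: "h holomorphic_on upper_half_plane"
    and inv: "\<And>A z. A \<in> Gamma0 p \<Longrightarrow> Im z > 0 \<Longrightarrow> h (moebius A z) = h z"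
    and lim1: "(h \<longlongrightarrow> a) at_ioo"
    and lim2: "((\<lambda>z. h (moebius (fricke p) z)) \<longlongrightarrow> b) at_ioo"
  shows "a = b" "Im z > 0 \<Longrightarrow> h z = a"
proof -
  have ab: "h z = a \<or> h z = b" if "Im z > 0" for z
  proof -
    have "(h z - a) * (h z - b) = 0"
    proof (rule bounded_invariant_eq_0[OF p _ _ _ _ that])
      show "(\<lambda>z. (h z - a) * (h z - b)) holomorphic_on upper_half_plane"
        by (intro holomorphic_intros hol)
      have "((\<lambda>z. (h z - a) * (h z - b)) \<longlongrightarrow> (a - a) * (a - b)) at_ioo" by (intro tendsto_intros lim1)
      thus "((\<lambda>z. (h z - a) * (h z - b)) \<longlongrightarrow> 0) at_ioo" by simp
      have "((\<lambda>z. (h (moebius (fricke p) z) - a) * (h (moebius (fricke p) z) - b)) \<longlongrightarrow>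
          (b - a) * (b - b)) at_ioo"
        by (intro tendsto_intros lim2)
      thus "((\<lambda>z. (h (moebius (fricke p) z) - a) * (h (moebius (fricke p) z) - b)) \<longlongrightarrow> 0) at_ioo"
        by simp
    qed (use inv in auto)
    thus ?thesis by auto
  qed
  have "h constant_on upper_half_plane"
  proof (rule continuous_finite_range_constant[OF connected_uhp])
    show "continuous_on upper_half_plane h" by (rule holomorphic_on_imp_continuous_on[OF hol])
    show "finite (h ` upper_half_plane)"
    proof (rule finite_subset)
      show "h ` upper_half_plane \<subseteq> {a, b}" using ab in_uhp by blast
    qed simp
  qed
  then obtain c where c: "\<And>z. Im z > 0 \<Longrightarrow> h z = c" by (auto simp: constant_on_def)
  have "eventually (\<lambda>z. c = h z) at_ioo"
    using eventually_at_ioo_uhp[of 0] by eventually_elim (simp add: c)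
  hence "(h \<longlongrightarrow> c) at_ioo" by (rule Lim_transform_eventually[OF tendsto_const])
  hence ca: "c = a" using lim1 tendsto_unique[OF at_ioo_neq_bot] by blast
  have "eventually (\<lambda>z. c = h (moebius (fricke p) z)) at_ioo"
    using eventually_at_ioo_uhp[of 0]
    by eventually_elim (simp add: c fricke_in_uhp prime_gt_0_nat[OF p])
  hence "((\<lambda>z. h (moebius (fricke p) z)) \<longlongrightarrow> c) at_ioo"
    by (rule Lim_transform_eventually[OF tendsto_const])
  hence "c = b" using lim2 tendsto_unique[OF at_ioo_neq_bot] by blast
  with ca show "a = b" by simp
  show "Im z > 0 \<Longrightarrow> h z = a" using c ca by simp
qed

section \<open>Expansions at a cusp\<close>

lemma nome_nonzero [simp]: "nome z \<noteq> 0"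
  by (simp add: nome_def)

lemma norm_nome: "cmod (nome z) = exp (- 2 * pi * Im z)"
  by (simp add: nome_def)

lemma norm_nome_less_1 [simp]: "cmod (nome z) < 1 \<longleftrightarrow> Im z > 0"
  by (simp add: norm_nome zero_less_mult_iff)

lemma nome_eq_iff: "nome z = nome w \<longleftrightarrow> (\<exists>k::int. z = w + of_int k)"
proof -
  have eq: "2 * of_real pi * \<i> * z = 2 * of_real pi * \<i> * w + (of_int (2 * k) * pi) * \<i> \<longleftrightarrow> z =
      w + of_int k"
    for k :: int
  proof -
    have "2 * of_real pi * \<i> * w + (of_int (2 * k) * pi) * \<i> = 2 * of_real pi * \<i> * (w + of_int k)"
      by (simp add: algebra_simps)
    thus ?thesis by (simp only: mult_cancel_left) simp
  qed
  show ?thesis unfolding nome_def exp_eq eq ..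
qed

lemma nome_add_int [simp]: "nome (z + of_int k) = nome z"
  using nome_eq_iff by blast

text \<open>
  A right inverse of the nome on the punctured disc. It jumps along the negative axis, where
  nothing better can be expected, but the jumps are integers.
\<close>

definition log_nome :: "complex \<Rightarrow> complex" where
  "log_nome q = Ln q / (2 * of_real pi * \<i>)"

lemma nome_log_nome: "q \<noteq> 0 \<Longrightarrow> nome (log_nome q) = q"
  by (simp add: nome_def log_nome_def)

lemma Im_log_nome: "q \<noteq> 0 \<Longrightarrow> Im (log_nome q) = - ln (cmod q) / (2 * pi)"
  by (simp add: log_nome_def Im_divide power2_eq_square)

lemma Im_log_nome_pos: "q \<noteq> 0 \<Longrightarrow> cmod q < 1 \<Longrightarrow> Im (log_nome q) > 0"
  by (simp add: Im_log_nome divide_neg_pos ln_less_zero)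

lemma filterlim_nome: "filterlim nome (at 0) at_ioo"
proof -
  have "filterlim (\<lambda>z. cmod (nome z)) (nhds 0) at_ioo"
    unfolding norm_nome at_ioo_def
    by (rule filterlim_compose[OF _ filterlim_filtercomap]) real_asymp
  hence "filterlim nome (nhds 0) at_ioo" by (simp add: tendsto_norm_zero_iff)
  thus ?thesis by (simp add: filterlim_at)
qed

lemma filterlim_log_nome: "filterlim log_nome at_ioo (at 0)"
proof -
  have "filterlim (\<lambda>q. Im (log_nome q)) at_top (at 0)"
  proof -
    have "filterlim (\<lambda>x. - ln x / (2 * pi)) at_top (at_right 0)" by real_asymp
    moreover have "filterlim cmod (at_right 0) (at 0)"
      by (auto simp: filterlim_at eventually_at_filter intro!: tendsto_eq_intros)
    ultimately have "filterlim (\<lambda>q. - ln (cmod q) / (2 * pi)) at_top (at 0)"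
      by (rule filterlim_compose)
    thus ?thesis
      by (rule filterlim_mono_eventually[OF _ order.refl order.refl])
         (auto simp: eventually_at_filter Im_log_nome)
  qed
  thus ?thesis unfolding at_ioo_def by (simp add: filterlim_filtercomap_iff o_def)
qed

lemma periodic_of_int:
  assumes "\<And>z. Im z > 0 \<Longrightarrow> f (z + 1) = f z" "Im z > 0"
  shows "f (z + of_int k) = f z"
proof -
  have nat: "f (z + of_nat n) = f z" if "Im z > 0" for n z
    using that
  proof (induction n)
    case (Suc n)
    have "f (z + of_nat (Suc n)) = f ((z + of_nat n) + 1)" by (simp add: add_ac)
    also have "\<dots> = f z" using Suc assms(1)[of "z + of_nat n"] by simp
    finally show ?case .
  qed simp
  show ?thesis
  proof (cases "k \<ge> 0")
    case True
    thus ?thesis using nat[of z "nat k"] assms by simp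
  next
    case False
    thus ?thesis using nat[of "z + of_int k" "nat (-k)"] assms by simp
  qed
qed

text \<open>
  A periodic function factors through the nome. The factor is holomorphic on the punctured disc
  since locally the logarithm has a holomorphic branch, and its singularity at \<open>0\<close> is removable
  because of the limit at \<open>\<infinity>\<close>.
\<close>

lemma periodic_nome_expansion:
  assumes hol: "f holomorphic_on upper_half_plane"
    and per: "\<And>z. Im z > 0 \<Longrightarrow> f (z + 1) = f z"
    and lim: "(f \<longlongrightarrow> l) at_ioo"
  obtains G where "G holomorphic_on ball 0 1" "G 0 = l" "\<And>z. Im z > 0 \<Longrightarrow> f z = G (nome z)"
proof -
  have nome_eq: "f z = f w" if "nome z = nome w" "Im z > 0" for z w
    using that periodic_of_int[of f, OF per] by (auto simp: nome_eq_iff)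
  define G where "G = (\<lambda>q. if q = 0 then l else f (log_nome q))"
  have fG: "f z = G (nome z)" if "Im z > 0" for z
    using that by (auto simp: G_def nome_log_nome intro!: nome_eq)
  have "G holomorphic_on ball 0 1"
  proof (rule no_isolated_singularity'[where K = "{0}"])
    have "((\<lambda>q. f (log_nome q)) \<longlongrightarrow> l) (at 0)"
      by (rule filterlim_compose[OF lim filterlim_log_nome])
    hence "(G \<longlongrightarrow> l) (at 0)"
      by (rule Lim_transform_eventually) (auto simp: G_def eventually_at_filter)
    thus "(G \<longlongrightarrow> G z) (at z within ball 0 1)" if "z \<in> {0}" for z
      using that tendsto_within_subset by (fastforce simp: G_def)
    have "G field_differentiable (at q0)" if q0: "q0 \<noteq> 0" "cmod q0 < 1" for q0
    proof -
      \<comment> \<open>A branch of the inverse of the nome near \<open>q0\<close>.\<close>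
      define L where "L = (\<lambda>q. (Ln (q / q0) + Ln q0) / (2 * of_real pi * \<i>))"
      have nomeL: "nome (L q) = q" if "q \<noteq> 0" for q
        using that q0 by (simp add: L_def nome_def exp_add)
      have ImL: "Im (L q) > 0" if "q \<noteq> 0" "cmod q < 1" for q
        using nomeL[OF that(1)] that(2) norm_nome_less_1 by metis
      have "L field_differentiable (at q0)"
      proof -
        have "((\<lambda>q. Ln (q / q0)) has_field_derivative 1 / q0) (at q0)"
          using q0 by (auto intro!: derivative_eq_intros)
        hence "(\<lambda>q. Ln (q / q0)) field_differentiable (at q0)"
          by (auto simp: field_differentiable_def)
        thus ?thesis unfolding L_def by (intro derivative_intros) auto
      qed
      moreover have "f field_differentiable (at (L q0))"
        using hol holomorphic_on_imp_differentiable_at[OF _ open_uhp] ImL q0 by simp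
      ultimately have "(f \<circ> L) field_differentiable (at q0)"
        by (rule field_differentiable_compose)
      moreover have "eventually (\<lambda>q. q \<in> ball 0 1 - {0}) (nhds q0)"
        using q0 by (intro eventually_nhds_in_open open_delete) auto
      hence ev: "eventually (\<lambda>q. (f \<circ> L) q = G q) (nhds q0)"
        by eventually_elim (auto simp: fG ImL nomeL)
      ultimately show ?thesis
        unfolding field_differentiable_def using DERIV_cong_ev[OF refl ev refl] by blast
    qed
    thus "G holomorphic_on ball 0 1 - {0}"
      by (auto simp: holomorphic_on_def intro: field_differentiable_at_within)
  qed auto
  moreover have "G 0 = l" by (simp add: G_def)
  ultimately show ?thesis using fG by (rule that)
qed

text \<open>
  A bound for how far a point can be moved towards the cusp \<open>\<infinity>\<close>: either \<open>c = 0\<close> and \<open>\<bar>cz + d\<bar> \<ge> 1\<close>, or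
  \<open>\<bar>cz + d\<bar> \<ge> Im z\<close>.
\<close>

lemma Im_moebius_le:
  assumes n: "det A = n" "n > 0" and z: "Im z > 0"
  shows "Im (moebius A z) \<le> of_int n * (Im z + 1 / Im z)"
    and "A $ 2 $ 1 \<noteq> 0 \<Longrightarrow> Im (moebius A z) \<le> of_int n / Im z"
proof -
  let ?D = "of_int (A $ 2 $ 1) * z + of_int (A $ 2 $ 2)"
  have D: "?D \<noteq> 0" using moebius_denom_nonzero[of A z] assms by simp
  have eq: "Im (moebius A z) = of_int n * Im z / (cmod ?D)\<^sup>2" using n by (simp add: Im_moebius)
  show c: "Im (moebius A z) \<le> of_int n / Im z" if "A $ 2 $ 1 \<noteq> 0"
  proof -
    have "Im z \<le> \<bar>of_int (A $ 2 $ 1)\<bar> * Im z" using that z by (simp add: mult_le_cancel_right1)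
    also have "\<dots> = \<bar>Im ?D\<bar>" using z by (simp add: abs_mult)
    also have "\<dots> \<le> cmod ?D" by (rule abs_Im_le_cmod)
    finally have "(Im z)\<^sup>2 \<le> (cmod ?D)\<^sup>2" using z by (intro power_mono) auto
    hence "of_int n * Im z / (cmod ?D)\<^sup>2 \<le> of_int n * Im z / (Im z)\<^sup>2"
      using z n D by (intro divide_left_mono) auto
    thus ?thesis using z by (simp add: eq power2_eq_square)
  qed
  show "Im (moebius A z) \<le> of_int n * (Im z + 1 / Im z)"
  proof (cases "A $ 2 $ 1 = 0")
    case True
    with D have "A $ 2 $ 2 \<noteq> 0" by auto
    hence "1 \<le> \<bar>A $ 2 $ 2\<bar>" by simp
    hence "1 \<le> (A $ 2 $ 2)\<^sup>2" by (metis abs_le_square_iff abs_one one_power2)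
    hence "1 \<le> (cmod ?D)\<^sup>2" using True by (simp flip: of_int_power)
    hence "of_int n * Im z / (cmod ?D)\<^sup>2 \<le> of_int n * Im z / 1"
      using z n by (intro divide_left_mono) auto
    also have "\<dots> \<le> of_int n * (Im z + 1 / Im z)" using z n by simp
    finally show ?thesis by (simp add: eq)
  next
    case False
    from c[OF this] show ?thesis
      using z n by (auto intro: order.trans simp: field_simps)
  qed
qed

lemma nome_moebius_translation:
  assumes "det A = 1" "A $ 2 $ 1 = 0"
  shows "nome (moebius A z) = nome z"
proof -
  obtain a b c d where A: "A = mat2 a b c d" by (rule mat2_cases)
  have ad: "a * d = 1" using assms by (simp add: A)
  hence "(a = 1 \<and> d = 1) \<or> (a = -1 \<and> d = -1)" using zmult_eq_1_iff by blast
  hence "moebius A z = z + of_int b \<or> moebius A z = z + of_int (-b)"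
    using assms by (auto simp: A moebius_mat2 minus_divide_left)
  thus ?thesis by (metis nome_add_int)
qed

lemma Gamma0_rel_translation: "Gamma0_rel p z (z + of_int k)"
  by (rule Gamma0_relI[of "mat2 1 k 0 1"]) (auto simp: moebius_mat2)

text \<open>
  Inequivalence is an open condition, since only finitely many matrices can move a point near \<open>z\<close> to
  a point near \<open>z'\<close>.
\<close>

lemma Gamma0_separation:
  assumes "Im z > 0" "Im z' > 0" "\<not> Gamma0_rel p z z'"
  obtains U U' where "open U" "z \<in> U" "U \<subseteq> upper_half_plane" "open U'" "z' \<in> U'"
    "U' \<subseteq> upper_half_plane"
    "\<And>u u'. u \<in> U \<Longrightarrow> u' \<in> U' \<Longrightarrow> \<not> Gamma0_rel p u u'"
proof -
  obtain r where r: "r > 0" "cball z r \<subseteq> upper_half_plane"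
    using open_contains_cball[of upper_half_plane] open_uhp assms(1)
    by (auto simp del: in_uhp simp: in_uhp[symmetric])
  obtain r' where r': "r' > 0" "cball z' r' \<subseteq> upper_half_plane"
    using open_contains_cball[of upper_half_plane] open_uhp assms(2)
    by (auto simp del: in_uhp simp: in_uhp[symmetric])
  define K where "K = cball z r \<union> cball z' r'"
  define S where "S = {A. det A = 1 \<and> (\<exists>z\<in>K. moebius A z \<in> K)} \<inter> Gamma0 p"
  have "finite {A. det A = 1 \<and> (\<exists>z\<in>K. moebius A z \<in> K)}"
    using r r' by (intro finite_moebius_compact) (auto simp: K_def)
  hence fin: "finite S" by (simp add: S_def)
  have "eventually (\<lambda>x. moebius A (fst x) \<noteq> snd x) (nhds z \<times>\<^sub>F nhds z')" if A: "A \<in> S" for A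
  proof -
    have "isCont (moebius A) z" using A assms by (intro continuous_moebius) (auto simp: S_def)
    hence "filterlim (moebius A) (nhds (moebius A z)) (nhds z)"
      by (simp add: continuous_at tendsto_nhds_iff)
    hence "((\<lambda>x. moebius A (fst x) - snd x) \<longlongrightarrow> moebius A z - z') (nhds z \<times>\<^sub>F nhds z')"
      by (intro tendsto_diff filterlim_compose[OF _ filterlim_fst] filterlim_snd)
    moreover have "moebius A z - z' \<noteq> 0" using A assms by (auto simp: S_def Gamma0_rel_def)
    ultimately have "eventually (\<lambda>x. moebius A (fst x) - snd x \<noteq> 0) (nhds z \<times>\<^sub>F nhds z')"
      by (rule tendsto_imp_eventually_ne)
    thus ?thesis by simp
  qed
  hence "eventually (\<lambda>x. \<forall>A\<in>S. moebius A (fst x) \<noteq> snd x) (nhds z \<times>\<^sub>F nhds z')"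
    using fin by (simp add: eventually_ball_finite)
  then obtain P P' where P: "eventually P (nhds z)" "eventually P' (nhds z')"
    "\<And>u u'. P u \<Longrightarrow> P' u' \<Longrightarrow> \<forall>A\<in>S. moebius A u \<noteq> u'"
    unfolding eventually_prod_filter by auto
  obtain U U' where U: "open U" "z \<in> U" "\<And>u. u \<in> U \<Longrightarrow> P u" "open U'" "z' \<in> U'" "\<And>u. u \<in> U' \<Longrightarrow> P' u"
    using P(1,2) unfolding eventually_nhds by metis
  show ?thesis
  proof (rule that[of "U \<inter> ball z r" "U' \<inter> ball z' r'"])
    show "\<not> Gamma0_rel p u u'" if "u \<in> U \<inter> ball z r" "u' \<in> U' \<inter> ball z' r'" for u u'
    proof
      assume "Gamma0_rel p u u'"
      then obtain A where A: "A \<in> Gamma0 p" "moebius A u = u'" by (auto simp: Gamma0_rel_def)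
      have "A \<in> S" using A that by (auto simp: S_def K_def det_Gamma0 intro!: bexI[of _ u])
      thus False using P(3)[of u u'] U that A by auto
    qed
  qed (use U r r' ball_subset_cball in auto)
qed

lemma fsigma_open:
  fixes S :: "complex set"
  assumes "open S" shows "fsigma S"
proof -
  obtain F :: "nat \<Rightarrow> complex set" where "\<And>n. compact (F n)" "(\<Union>n. F n) = S"
    using open_Union_compact_subsets[OF assms] by metis
  thus ?thesis unfolding fsigma_Union_compact by (intro exI[of _ F]) auto
qed

lemma uncountable_open_complex:
  fixes S :: "complex set"
  assumes "open S" "S \<noteq> {}" shows "uncountable S"
proof -
  obtain x r where "r > 0" "ball x r \<subseteq> S" using assms openE by blast
  thus ?thesis using uncountable_ball countable_subset by blast
qed

section \<open>A Hauptmodul separates orbits\<close>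

text \<open>
  What is used about the Hauptmodul: it is holomorphic and invariant, its only pole is the simple
  pole at \<open>\<infinity>\<close>, where the expansion has no constant term, and it has the value \<open>c0\<close> at the cusp \<open>0\<close>.
\<close>

locale cusp_uniformizer =
  fixes p :: nat and j g :: "complex \<Rightarrow> complex" and c0 :: complex
  assumes prime_p: "prime p"
    and hol_j: "j holomorphic_on upper_half_plane"
    and inv_j: "A \<in> Gamma0 p \<Longrightarrow> Im z > 0 \<Longrightarrow> j (moebius A z) = j z"
    and hol_g: "g holomorphic_on ball 0 1"
    and g_0: "g 0 = 0"
    and j_eq: "Im z > 0 \<Longrightarrow> j z = inverse (nome z) + g (nome z)"
    and lim_j0: "((\<lambda>z. j (moebius (fricke p) z)) \<longlongrightarrow> c0) at_ioo"
begin

lemma p_pos: "p > 0"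
  using prime_p by (rule prime_gt_0_nat)

definition j0 :: "complex \<Rightarrow> complex" where
  "j0 z = j (moebius (fricke p) z)"

lemma j_rel: "Im z > 0 \<Longrightarrow> Gamma0_rel p z w \<Longrightarrow> j w = j z"
  using inv_j by (auto simp: Gamma0_rel_def)

lemma tendsto_g_nome: "((\<lambda>z. g (nome z)) \<longlongrightarrow> 0) at_ioo"
proof -
  have "isCont g 0"
    using continuous_on_interior[OF holomorphic_on_imp_continuous_on[OF hol_g], of 0] by simp
  hence "(g \<longlongrightarrow> 0) (at 0)" using g_0 by (simp add: isCont_def)
  thus ?thesis by (rule filterlim_compose[OF _ filterlim_nome])
qed

lemma filterlim_j: "filterlim j at_infinity at_ioo"
proof -
  have "filterlim (\<lambda>z. g (nome z) + inverse (nome z)) at_infinity at_ioo"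
    by (rule tendsto_add_filterlim_at_infinity[OF tendsto_g_nome])
       (rule filterlim_compose[OF filterlim_inverse_at_infinity filterlim_nome])
  thus ?thesis
    by (rule filterlim_mono_eventually[OF _ order.refl order.refl])
       (auto intro: eventually_mono[OF eventually_at_ioo_uhp[of 0]] simp: j_eq)
qed

lemma eventually_norm_j_ge: "eventually (\<lambda>z. cmod (j z) \<ge> r) at_ioo"
proof -
  have "eventually (\<lambda>z. cmod (j z) \<ge> max 1 r) at_ioo"
    using filterlim_j unfolding filterlim_at_infinity[of 0 j, OF order.refl]
    by (rule allE[of _ "max 1 r"]) simp
  thus ?thesis by eventually_elim auto
qed

lemma j_nonconstant: "\<not> j constant_on upper_half_plane"
proof
  assume "j constant_on upper_half_plane"
  then obtain k where k: "\<And>z. Im z > 0 \<Longrightarrow> j z = k" by (auto simp: constant_on_def)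
  have "eventually (\<lambda>z. j z = k) at_ioo"
    using eventually_at_ioo_uhp[of 0] by eventually_elim (auto simp: k)
  moreover have "eventually (\<lambda>z. cmod (j z) \<ge> cmod k + 1) at_ioo"
    by (rule eventually_norm_j_ge)
  ultimately have "eventually (\<lambda>z. False) at_ioo" by eventually_elim auto
  thus False by simp
qed

lemma hol_j0: "j0 holomorphic_on upper_half_plane"
proof -
  have "j \<circ> moebius (fricke p) holomorphic_on upper_half_plane"
    by (rule holomorphic_on_compose_gen[OF holomorphic_moebius hol_j])
       (use p_pos fricke_in_uhp in auto)
  thus ?thesis by (simp add: o_def j0_def[abs_def])
qed

lemma inv_j0:
  assumes "A \<in> Gamma0 p" "Im z > 0"
  shows "j0 (moebius A z) = j0 z"
proof -
  obtain a b c d where A: "A = mat2 a b c d" by (rule mat2_cases)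
  define B where "B = fricke_conj p A"
  have B: "B \<in> Gamma0 p" using assms by (simp add: B_def fricke_conj_in_Gamma0)
  have "fricke_conj p B = A" using assms p_pos
    by (auto simp: B_def A fricke_conj_def simp flip: mult_minus_right)
  hence "moebius B (moebius (fricke p) z) = moebius (fricke p) (moebius A z)"
    using moebius_fricke_conj[of B p 1 z] B assms p_pos by (simp add: Gamma0_eq_hecke)
  thus ?thesis using inv_j[OF B fricke_in_uhp[OF p_pos assms(2)]] by (simp add: j0_def)
qed

lemma lim_j0': "(j0 \<longlongrightarrow> c0) at_ioo"
  using lim_j0 by (simp add: j0_def[abs_def])

text \<open>
  The pole is simple: \<open>1/j\<close> is, as a function of the nome \<open>q\<close>, equal to \<open>q/(1 + q g(q))\<close>, and this has
  derivative \<open>1\<close> at \<open>0\<close>.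
\<close>

lemma nome_injective_at_infinity:
  obtains y where "y > 0" "\<And>z w. Im z > y \<Longrightarrow> Im w > y \<Longrightarrow> j z = j w \<Longrightarrow> nome z = nome w"
proof -
  have "isCont (\<lambda>q. 1 + q * g q) 0"
    using hol_g continuous_on_interior[of "ball 0 1" g 0] holomorphic_on_imp_continuous_on[OF hol_g]
    by (intro continuous_intros) (auto simp: interior_ball)
  hence "eventually (\<lambda>q. 1 + q * g q \<noteq> 0) (nhds 0)"
    by (intro tendsto_imp_eventually_ne[where c = 1]) (auto simp: continuous_at tendsto_nhds_iff)
  then obtain r where r: "r > 0" "\<And>q. q \<in> ball 0 r \<Longrightarrow> 1 + q * g q \<noteq> 0"
    unfolding eventually_nhds_metric by (auto simp: dist_norm)
  define R where "R = min r 1"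
  define \<phi> where "\<phi> = (\<lambda>q. q / (1 + q * g q))"
  have R: "R > 0" using r by (simp add: R_def)
  have hol\<phi>: "\<phi> holomorphic_on ball 0 R"
    unfolding \<phi>_def
    by (intro holomorphic_intros holomorphic_on_subset[OF hol_g]) (use r in \<open>auto simp: R_def\<close>)
  have gd: "(g has_field_derivative deriv g 0) (at 0)"
    using hol_g by (intro holomorphic_derivI[where S = "ball 0 1"]) auto
  have "(\<phi> has_field_derivative 1) (at 0)"
    unfolding \<phi>_def by (rule derivative_eq_intros gd refl | simp add: g_0)+
  hence "deriv \<phi> 0 \<noteq> 0" by (simp add: DERIV_imp_deriv)
  hence "\<exists>s>0. ball (0::complex) s \<subseteq> ball 0 R \<and> inj_on \<phi> (ball 0 s)"
    by (rule has_complex_derivative_locally_injective[OF hol\<phi> centre_in_ball[THEN iffD2, OF R]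
      open_ball])
       blast
  then obtain s where s: "s > 0" "ball (0::complex) s \<subseteq> ball 0 R" "inj_on \<phi> (ball 0 s)" by metis
  have ev: "eventually (\<lambda>z. nome z \<in> ball 0 s) at_ioo"
    using filterlim_nome s(1) by (auto simp: filterlim_at tendsto_iff dist_norm)
  then obtain y where y: "y > 0" "\<And>z. Im z > y \<Longrightarrow> nome z \<in> ball 0 s"
    using eventually_at_ioo_pos by blast
  show ?thesis
  proof (rule that[OF y(1)])
    fix z w assume zw: "Im z > y" "Im w > y" "j z = j w"
    have \<phi>_j: "\<phi> (nome z) = inverse (j z)" if "Im z > y" for z
    proof -
      have "1 + nome z * g (nome z) \<noteq> 0" using subsetD[OF s(2) y(2)[OF that]] r
        by (auto simp: R_def)
      thus ?thesis using that y(1) by (simp add: \<phi>_def j_eq field_simps)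
    qed
    have "\<phi> (nome z) = \<phi> (nome w)" using zw by (simp add: \<phi>_j)
    thus "nome z = nome w" using s(3) y(2) zw by (auto simp: inj_on_def)
  qed
qed

text \<open>
  Properness of \<open>j\<close> away from the values \<open>\<infinity>\<close> and \<open>c0\<close> at the cusps.
\<close>

lemma j_compact_representative:
  assumes "w0 \<noteq> c0"
  obtains C e where "compact C" "C \<subseteq> upper_half_plane" "e > 0"
    "\<And>z. Im z > 0 \<Longrightarrow> cmod (j z - w0) < e \<Longrightarrow> \<exists>y\<in>C. Gamma0_rel p z y"
proof -
  define e where "e = min 1 (cmod (w0 - c0) / 2)"
  have e: "e > 0" using assms by (simp add: e_def)
  have "eventually (\<lambda>z. cmod (j z) \<ge> cmod w0 + 1) at_ioo"
    by (rule eventually_norm_j_ge)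
  moreover have "eventually (\<lambda>z. dist (j0 z) c0 < e) at_ioo"
    using lim_j0' e by (rule tendstoD)
  ultimately have "eventually (\<lambda>z. cmod (j z) \<ge> cmod w0 + 1 \<and> dist (j0 z) c0 < e) at_ioo"
    by (rule eventually_conj)
  then obtain y where y: "\<And>z. Im z > y \<Longrightarrow> cmod (j z) \<ge> cmod w0 + 1 \<and> dist (j0 z) c0 < e"
    unfolding eventually_at_ioo by blast
  show ?thesis
  proof (rule that[OF fundamental_compact[OF p_pos, of y] e])
    fix z assume z: "Im z > 0" "cmod (j z - w0) < e"
    show "\<exists>s\<in>fundamental_compact p y. Gamma0_rel p z s"
      using prime_p z(1)
    proof (cases rule: Gamma0_reduction_compact[where y = y])
      case (2 s)
      have "cmod (j s) \<le> cmod (j z - w0) + cmod w0"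
        using j_rel[OF z(1) 2(3)] norm_triangle_ineq[of "j z - w0" w0] by simp
      thus ?thesis using y[OF 2(1)] z(2) by (auto simp: e_def)
    next
      case (3 s)
      have "cmod (w0 - c0) \<le> cmod (j z - w0) + dist (j0 s) c0"
        using j_rel[OF z(1) 3(3)] norm_triangle_ineq[of "w0 - j z" "j z - c0"]
        by (simp add: j0_def dist_norm norm_minus_commute)
      moreover have "dist (j0 s) c0 < e" using y[OF 3(1)] by simp
      ultimately have "cmod (w0 - c0) < e + e" using z(2) by linarith
      thus ?thesis by (simp add: e_def min_def split: if_splits)
    qed auto
  qed
qed

text \<open>
  The values taken on more than one orbit. There are none, and the following lemmas on this set
  lead to this conclusion.
\<close>

definition double_values :: "complex set" where
  "double_values = {j z |z z'. Im z > 0 \<and> Im z' > 0 \<and> \<not> Gamma0_rel p z z' \<and> j z = j z'}"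

text \<open>
  By the open mapping theorem: neighbourhoods of two inequivalent points have images that overlap
  in an open set, and the neighbourhoods can be chosen such that no point of the one is equivalent
  to a point of the other.
\<close>

lemma open_double_values: "open double_values"
proof (subst open_subopen, safe)
  fix w assume "w \<in> double_values"
  then obtain z z' where z: "w = j z" "Im z > 0" "Im z' > 0" "\<not> Gamma0_rel p z z'" "j z = j z'"
    by (auto simp: double_values_def)
  obtain U U' where U: "open U" "z \<in> U" "U \<subseteq> upper_half_plane" "open U'" "z' \<in> U'"
    "U' \<subseteq> upper_half_plane"
    "\<And>u u'. u \<in> U \<Longrightarrow> u' \<in> U' \<Longrightarrow> \<not> Gamma0_rel p u u'"
    using Gamma0_separation[OF z(2-4)] by blast
  have "open (j ` U)" "open (j ` U')"
    using open_mapping_thm[OF hol_j open_uhp connected_uhp _ _ j_nonconstant] U by blast+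
  hence "open (j ` U \<inter> j ` U')" by blast
  moreover have "j ` U \<inter> j ` U' \<subseteq> double_values"
  proof
    fix v assume "v \<in> j ` U \<inter> j ` U'"
    then obtain u u' where u: "u \<in> U" "u' \<in> U'" "v = j u" "j u = j u'" by auto
    moreover have "Im u > 0" "Im u' > 0" using u U(3,6) by auto
    ultimately show "v \<in> double_values" using U(7) unfolding double_values_def by blast
  qed
  moreover have "w \<in> j ` U" "w \<in> j ` U'" using imageI[OF U(2), of j] imageI[OF U(5), of j] z(1,5)
    by simp_all
  ultimately show "\<exists>T. open T \<and> w \<in> T \<and> T \<subseteq> double_values"
    by (intro exI[of _ "j ` U \<inter> j ` U'"]) simp
qed

text \<open>
  A point with a large value of \<open>j\<close> is equivalent to a point near the cusp \<open>\<infinity>\<close>, where \<open>j\<close> determines the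
  nome and hence the orbit.
\<close>

lemma bounded_double_values: "bounded double_values"
proof -
  obtain y0 where y0: "y0 > 0" "\<And>z w. Im z > y0 \<Longrightarrow> Im w > y0 \<Longrightarrow> j z = j w \<Longrightarrow> nome z = nome w"
    using nome_injective_at_infinity by blast
  have "eventually (\<lambda>z. dist (j0 z) c0 < 1) at_ioo"
    using lim_j0' by (rule tendstoD) auto
  then obtain y1 where y1: "\<And>z. Im z > y1 \<Longrightarrow> dist (j0 z) c0 < 1"
    unfolding eventually_at_ioo by blast
  define y where "y = max y0 y1"
  let ?C = "fundamental_compact p y"
  have "continuous_on ?C j"
    using holomorphic_on_imp_continuous_on[OF hol_j] fundamental_compact[OF p_pos]
      continuous_on_subset by blast
  hence "bounded (j ` ?C)"
    using compact_continuous_image fundamental_compact[OF p_pos] compact_imp_bounded by blast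
  then obtain B where B: "\<And>z. z \<in> ?C \<Longrightarrow> cmod (j z) \<le> B" by (auto simp: bounded_iff)
  define R where "R = max B (cmod c0 + 1)"
  have red: "\<exists>s. Im s > y \<and> Gamma0_rel p z s" if z: "Im z > 0" "cmod (j z) > R" for z
    using prime_p z(1)
  proof (cases rule: Gamma0_reduction_compact[where y = y])
    case (1 s)
    thus ?thesis using B[of s] j_rel[OF z(1) 1(2)] z(2) by (auto simp: R_def)
  next
    case (3 s)
    have "cmod (j0 s) \<le> dist (j0 s) c0 + cmod c0"
      using norm_triangle_ineq[of "j0 s - c0" c0] by (simp add: dist_norm)
    moreover have "j0 s = j z" using j_rel[OF z(1) 3(3)] by (simp add: j0_def)
    moreover have "dist (j0 s) c0 < 1" using y1[of s] 3 by (auto simp: y_def)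
    ultimately show ?thesis using z(2) by (auto simp: R_def)
  qed auto
  have "cmod w \<le> R" if "w \<in> double_values" for w
  proof (rule ccontr)
    assume "\<not> cmod w \<le> R"
    moreover obtain z z' where z: "w = j z" "Im z > 0" "Im z' > 0" "\<not> Gamma0_rel p z z'"
      "j z = j z'"
      using \<open>w \<in> double_values\<close> by (auto simp: double_values_def)
    ultimately obtain s s' where s: "Im s > y" "Im s' > y" "Gamma0_rel p z s" "Gamma0_rel p z' s'"
      using red[of z] red[of z'] by auto
    have "nome s' = nome s"
      using s z j_rel[of z s] j_rel[of z' s'] by (intro y0(2)) (auto simp: y_def)
    then obtain k :: int where "s' = s + of_int k" by (auto simp: nome_eq_iff)
    hence "Gamma0_rel p s s'" using Gamma0_rel_translation by simp
    thus False
      using z s by (meson Gamma0_rel_in_uhp Gamma0_rel_sym Gamma0_rel_trans)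
  qed
  thus ?thesis by (auto simp: bounded_iff)
qed

text \<open>
  The values near which the number of preimages is not obviously locally constant: branch points,
  and the value at the cusp \<open>0\<close>, where preimages can escape from compact sets.
\<close>

definition exceptional_values :: "complex set" where
  "exceptional_values = insert c0 (j ` {z \<in> upper_half_plane. deriv j z = 0})"

lemma countable_exceptional_values: "countable exceptional_values"
proof -
  have "\<not> deriv j constant_on upper_half_plane"
  proof
    \<comment> \<open>Otherwise \<open>j\<close> would be an affine function; as it is periodic, it would be
      constant.\<close>
    assume "deriv j constant_on upper_half_plane"
    then obtain k where k: "\<And>z. Im z > 0 \<Longrightarrow> deriv j z = k" by (auto simp: constant_on_def)
    have dj: "(j has_field_derivative k) (at z)" if "Im z > 0" for z
      using holomorphic_derivI[OF hol_j open_uhp, of z] k that by simp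
    have "((\<lambda>z. j z - k * z) has_field_derivative 0) (at z within upper_half_plane)"
      if "z \<in> upper_half_plane" for z
      using that by (auto intro!: derivative_eq_intros DERIV_subset[OF dj])
    then obtain c where c: "\<And>z. Im z > 0 \<Longrightarrow> j z - k * z = c"
      using has_field_derivative_zero_constant[of upper_half_plane "\<lambda>z. j z - k * z"]
      by (auto simp: upper_half_plane_def convex_halfspace_Im_gt)
    have "j (\<i> + 1) = j \<i>" using inv_j[of "mat2 1 1 0 1" \<i>] by (simp add: moebius_mat2)
    hence "k = 0" using c[of "\<i> + 1"] c[of \<i>] by (simp add: algebra_simps)
    hence "j constant_on upper_half_plane" using c by (auto simp: constant_on_def)
    thus False using j_nonconstant by blast
  qed
  hence "countable {z \<in> upper_half_plane. deriv j z = 0}"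
    by (intro holomorphic_countable_zeros holomorphic_deriv hol_j open_uhp connected_uhp
      fsigma_open)
  thus ?thesis by (simp add: exceptional_values_def)
qed

text \<open>
  Let pairs of inequivalent preimages belong to values that tend to \<open>w\<close>. By compactness, one may
  assume that they converge to points \<open>y\<close> and \<open>y'\<close>. If these were equivalent, then after moving \<open>y'\<close> to
  \<open>y\<close> there would be two different points with the same value arbitrarily close to \<open>y\<close>; but \<open>j\<close> is
  locally injective at \<open>y\<close>, as \<open>w\<close> is not the value at a critical point.
\<close>

lemma double_values_limit:
  assumes lim: "w islimpt (double_values - exceptional_values)" and w: "w \<notin> exceptional_values"
  shows "w \<in> double_values"
proof (rule ccontr)
  assume not: "w \<notin> double_values"
  have "w \<noteq> c0" using w by (auto simp: exceptional_values_def)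
  obtain C e where C: "compact C" "C \<subseteq> upper_half_plane" "e > 0"
    "\<And>z. Im z > 0 \<Longrightarrow> cmod (j z - w) < e \<Longrightarrow> \<exists>y\<in>C. Gamma0_rel p z y"
    using j_compact_representative[OF \<open>w \<noteq> c0\<close>] by metis
  have "\<exists>y\<in>C. \<exists>y'\<in>C. \<not> Gamma0_rel p y y' \<and> j y = j y' \<and> cmod (j y - w) < inverse (real (Suc n))"
    for n
  proof -
    have "min e (inverse (real (Suc n))) > 0" using C(3) by simp
    then obtain v where v: "v \<in> double_values" "dist v w < min e (inverse (real (Suc n)))"
      using lim unfolding islimpt_approachable by blast
    then obtain z z' where z: "v = j z" "Im z > 0" "Im z' > 0" "\<not> Gamma0_rel p z z'" "j z = j z'"
      by (auto simp: double_values_def)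
    obtain y y' where y: "y \<in> C" "Gamma0_rel p z y" "y' \<in> C" "Gamma0_rel p z' y'"
      using C(4)[of z] C(4)[of z'] z v(2) by (auto simp: dist_norm)
    have "\<not> Gamma0_rel p y y'"
      using y z by (meson Gamma0_rel_in_uhp Gamma0_rel_sym Gamma0_rel_trans)
    moreover have "j y = v" "j y' = v" using y z j_rel by auto
    moreover have "cmod (j y - w) < inverse (real (Suc n))" using calculation v(2)
      by (simp add: dist_norm)
    ultimately show ?thesis using y(1,3) by (intro bexI[of _ y] bexI[of _ y']) auto
  qed
  then obtain Y Y' where Y: "\<And>n. Y n \<in> C" "\<And>n. Y' n \<in> C" "\<And>n. \<not> Gamma0_rel p (Y n) (Y' n)"
    "\<And>n. j (Y n) = j (Y' n)" "\<And>n. cmod (j (Y n) - w) < inverse (real (Suc n))"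
    by metis
  have jlim: "(\<lambda>n. j (Y n)) \<longlonglongrightarrow> w"
  proof (rule LIM_zero_cancel, rule Lim_null_comparison)
    show "eventually (\<lambda>n. cmod (j (Y n) - w) \<le> inverse (real (Suc n))) sequentially"
      using Y(5) by (auto intro: always_eventually less_imp_le)
  qed (rule LIMSEQ_inverse_real_of_nat)
  have "compact (C \<times> C)" using C(1) by (intro compact_Times)
  hence "seq_compact (C \<times> C)" by (rule compact_imp_seq_compact)
  then obtain l r where l: "l \<in> C \<times> C" and r: "strict_mono r" "((\<lambda>n. (Y n, Y' n)) \<circ> r) \<longlonglongrightarrow> l"
    using Y(1,2) by (elim seq_compactE[of "C \<times> C" "\<lambda>n. (Y n, Y' n)"]) auto
  obtain y y' where l_eq: "l = (y, y')" by (cases l)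
  have yC: "Im y > 0" "Im y' > 0" using l C(2) by (auto simp: l_eq)
  have lims: "(\<lambda>n. Y (r n)) \<longlonglongrightarrow> y" "(\<lambda>n. Y' (r n)) \<longlonglongrightarrow> y'"
    using tendsto_fst[OF r(2)] tendsto_snd[OF r(2)] by (auto simp: l_eq o_def)
  have cont: "isCont j v" if "Im v > 0" for v
    using that holomorphic_on_imp_continuous_on[OF hol_j] open_uhp
    by (auto simp: continuous_on_eq_continuous_at)
  have jlim': "(\<lambda>n. j (Y (r n))) \<longlonglongrightarrow> w"
    using LIMSEQ_subseq_LIMSEQ[OF jlim r(1)] by (simp add: o_def)
  have "j y = w"
    using isCont_tendsto_compose[OF cont[OF yC(1)] lims(1)] jlim' LIMSEQ_unique by blast
  moreover have "j y' = w"
    using isCont_tendsto_compose[OF cont[OF yC(2)] lims(2)] jlim' LIMSEQ_unique Y(4) by simp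
  ultimately have "Gamma0_rel p y y'" using not yC unfolding double_values_def
    by (metis (mono_tags, lifting) mem_Collect_eq)
  then obtain A where A: "A \<in> Gamma0 p" "moebius A y = y'" by (auto simp: Gamma0_rel_def)
  define B where "B = adj2 A"
  have B: "B \<in> Gamma0 p" "moebius B y' = y"
    using A yC by (auto simp: B_def adj2_in_Gamma0 moebius_adj2 det_Gamma0)
  have "deriv j y \<noteq> 0" using w \<open>j y = w\<close> yC by (auto simp: exceptional_values_def)
  then obtain \<rho> where \<rho>: "\<rho> > 0" "ball y \<rho> \<subseteq> upper_half_plane" "inj_on j (ball y \<rho>)"
    using has_complex_derivative_locally_injective[OF hol_j _ open_uhp] yC by auto
  have "isCont (moebius B) y'" using B yC det_Gamma0 by (intro continuous_moebius) fastforce+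
  from isCont_tendsto_compose[OF this lims(2)] have limB: "(\<lambda>n. moebius B (Y' (r n))) \<longlonglongrightarrow> y"
    using B by simp
  have "eventually (\<lambda>n. dist (Y (r n)) y < \<rho> \<and> dist (moebius B (Y' (r n))) y < \<rho>) sequentially"
    using tendstoD[OF lims(1) \<rho>(1)] tendstoD[OF limB \<rho>(1)] by (rule eventually_conj)
  then obtain n where n: "dist (Y (r n)) y < \<rho>" "dist (moebius B (Y' (r n))) y < \<rho>"
    by (auto simp: eventually_sequentially)
  have imY: "Im (Y (r n)) > 0" "Im (Y' (r n)) > 0" using Y(1,2) C(2) in_uhp by blast+
  have "j (Y (r n)) = j (moebius B (Y' (r n)))" using inv_j[OF B(1)] imY Y(4) by simp
  hence "Y (r n) = moebius B (Y' (r n))"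
    using \<rho>(3) n by (auto simp: inj_on_def dist_commute)
  hence "Gamma0_rel p (Y' (r n)) (Y (r n))" using B(1) by (auto simp: Gamma0_rel_def)
  thus False using Y(3) imY Gamma0_rel_sym by blast
qed

text \<open>
  The set of double values is open and closed in the connected complement of the exceptional
  values. It cannot be everything since it is bounded; and an open set of exceptional values is
  empty, because there are only countably many of them.
\<close>

theorem j_injective:
  assumes "Im z > 0" "Im w > 0" "j z = j w"
  shows "Gamma0_rel p z w"
proof -
  let ?E = "exceptional_values"
  have "connected (- ?E)"
    by (intro path_connected_imp_connected path_connected_complement_countable
      countable_exceptional_values) simp
  moreover have "openin (top_of_set (- ?E)) (double_values - ?E)"
    using open_double_values by (auto simp: openin_open Diff_eq Int_commute)
  moreover have "closedin (top_of_set (- ?E)) (double_values - ?E)"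
    unfolding closedin_limpt using double_values_limit by auto
  ultimately consider "double_values - ?E = {}" | "double_values - ?E = - ?E"
    unfolding connected_clopen by blast
  hence "double_values = {}"
  proof cases
    case 1
    hence "countable double_values"
      using countable_subset[OF _ countable_exceptional_values] by blast
    thus ?thesis using open_double_values uncountable_open_complex by blast
  next
    case 2
    have "countable (- double_values)"
      using 2 by (intro countable_subset[OF _ countable_exceptional_values]) blast
    moreover have "uncountable (- double_values)"
    proof -
      obtain R where R: "\<And>v. v \<in> double_values \<Longrightarrow> cmod v \<le> R"
        using bounded_double_values by (auto simp: bounded_iff)
      have "open {v. cmod v > R}" by (intro open_Collect_less continuous_intros)
      moreover have "complex_of_real (\<bar>R\<bar> + 1) \<in> {v. cmod v > R}" by (simp del: of_real_add)
      ultimately have "uncountable {v. cmod v > R}" by (intro uncountable_open_complex) blast+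
      moreover have "{v. cmod v > R} \<subseteq> - double_values" using R by force
      ultimately show ?thesis using countable_subset by blast
    qed
    ultimately show ?thesis by blast
  qed
  thus ?thesis using assms unfolding double_values_def by blast
qed

text \<open>
  If \<open>j(z) = c0\<close>, then \<open>j\<close> takes near \<open>z\<close> all values close to \<open>c0\<close>, in particular those taken near the
  cusp \<open>0\<close>. As \<open>j\<close> separates orbits, points near the cusp would be equivalent to points near \<open>z\<close>, which
  is impossible by \<open>Im_moebius_le\<close>.
\<close>

theorem j_neq_c0:
  assumes z: "Im z > 0"
  shows "j z \<noteq> c0"
proof
  assume c0: "j z = c0"
  obtain r where r: "r > 0" "cball z r \<subseteq> upper_half_plane"
    using open_contains_cball[of upper_half_plane] open_uhp z
    by (auto simp del: in_uhp simp: in_uhp[symmetric])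
  have "continuous_on (cball z r) (\<lambda>u. of_nat p * (Im u + 1 / Im u))"
    using r(2) by (intro continuous_intros) fastforce+
  hence "bounded ((\<lambda>u. of_nat p * (Im u + 1 / Im u)) ` cball z r)"
    by (intro compact_imp_bounded compact_continuous_image) auto
  then obtain B where "\<forall>x\<in>(\<lambda>u. of_nat p * (Im u + 1 / Im u)) ` cball z r. norm x \<le> B"
    unfolding bounded_iff ..
  hence B: "of_nat p * (Im u + 1 / Im u) \<le> B" if "u \<in> cball z r" for u
    using that abs_le_D1 by fastforce
  have "open (j ` ball z r)"
    using open_mapping_thm[OF hol_j open_uhp connected_uhp _ _ j_nonconstant] r ball_subset_cball
    by blast
  moreover have "c0 \<in> j ` ball z r" using c0 r by auto
  ultimately have "eventually (\<lambda>s. j0 s \<in> j ` ball z r) at_ioo"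
    using lim_j0' unfolding tendsto_def by blast
  hence "eventually (\<lambda>s. j0 s \<in> j ` ball z r \<and> Im s > max 0 B) at_ioo"
    using eventually_at_ioo_uhp by (rule eventually_conj)
  then obtain s where s: "j0 s \<in> j ` ball z r" "Im s > max 0 B"
    using eventually_happens'[OF at_ioo_neq_bot] by blast
  then obtain u where u: "u \<in> ball z r" "j u = j (moebius (fricke p) s)" by (auto simp: j0_def)
  have u': "u \<in> cball z r" "Im u > 0" using u r ball_subset_cball in_uhp by blast+
  have "Gamma0_rel p u (moebius (fricke p) s)"
    using u u' s by (intro j_injective fricke_in_uhp p_pos) auto
  then obtain A where A: "A \<in> Gamma0 p" "moebius A u = moebius (fricke p) s"
    by (auto simp: Gamma0_rel_def)
  have "moebius (fricke p ** A) u = s"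
    using A u' p_pos by (simp add: moebius_mult det_Gamma0 moebius_fricke_fricke)
  moreover have "det (fricke p ** A) = int p" using A by (simp add: det_mul det_Gamma0)
  ultimately have "Im s \<le> of_nat p * (Im u + 1 / Im u)"
    using Im_moebius_le(1)[of "fricke p ** A" "int p" u] u' p_pos by simp
  also have "\<dots> \<le> B" using B u' by blast
  finally show False using s by simp
qed

text \<open>
  Also at the cusp \<open>0\<close>, the function takes its value with multiplicity one. Two points high up in
  the upper half plane which are equivalent differ by a translation, so \<open>G\<close> is injective near \<open>0\<close>, and
  an injective holomorphic function has no critical points.
\<close>

lemma j0_expansion:
  obtains G where "G holomorphic_on ball 0 1" "G 0 = c0" "\<And>z. Im z > 0 \<Longrightarrow> j0 z = G (nome z)"
    "deriv G 0 \<noteq> 0"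
proof -
  have per: "j0 (z + 1) = j0 z" if "Im z > 0" for z
    using inv_j0[of "mat2 1 1 0 1" z] that by (simp add: moebius_mat2)
  obtain G where G: "G holomorphic_on ball 0 1" "G 0 = c0" "\<And>z. Im z > 0 \<Longrightarrow> j0 z = G (nome z)"
    using periodic_nome_expansion[OF hol_j0 per lim_j0'] by blast
  define r where "r = exp (- 2 * pi)"
  have r: "r > 0" "r < 1" by (auto simp: r_def)
  have log: "Im (log_nome q) > 1" if "q \<in> ball 0 r" "q \<noteq> 0" for q
  proof -
    have "exp (- 2 * pi * Im (log_nome q)) < exp (- 2 * pi)"
      using that norm_nome[of "log_nome q"] by (simp add: nome_log_nome r_def)
    thus ?thesis by simp
  qed
  have j0_log: "j0 (log_nome q) = G q" if "q \<in> ball 0 r" "q \<noteq> 0" for q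
    using log[OF that] G(3)[of "log_nome q"] that by (simp add: nome_log_nome)
  have ne: "G q \<noteq> c0" if "q \<in> ball 0 r" "q \<noteq> 0" for q
    using j_neq_c0[of "moebius (fricke p) (log_nome q)"] j0_log[OF that] log[OF that]
      fricke_in_uhp[OF p_pos, of "log_nome q"]
    by (simp add: j0_def)
  have inj: "q = q'"
    if q: "q \<in> ball 0 r" "q \<noteq> 0" and q': "q' \<in> ball 0 r" "q' \<noteq> 0" and eq: "G q = G q'" for q q'
  proof -
    define s s' where "s = log_nome q" and "s' = log_nome q'"
    have s: "Im s > 1" "Im s' > 1" using log q q' by (auto simp: s_def s'_def)
    have "Gamma0_rel p (moebius (fricke p) s) (moebius (fricke p) s')"
      using j0_log[OF q] j0_log[OF q'] eq s
      by (intro j_injective fricke_in_uhp p_pos) (auto simp: j0_def s_def s'_def)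
    then obtain A where A: "A \<in> Gamma0 p" "moebius A (moebius (fricke p) s) = moebius (fricke p) s'"
      by (auto simp: Gamma0_rel_def)
    define B where "B = fricke_conj p A"
    have B: "B \<in> Gamma0 p" using A by (simp add: B_def fricke_conj_in_Gamma0)
    have "moebius (fricke p) (moebius B s) = moebius (fricke p) s'"
      using A(2) moebius_fricke_conj[of A p 1 s] A(1) s p_pos by (simp add: B_def Gamma0_eq_hecke)
    hence Bs: "moebius B s = s'" by (metis moebius_fricke_fricke p_pos)
    have "B $ 2 $ 1 = 0"
    proof (rule ccontr)
      assume "B $ 2 $ 1 \<noteq> 0"
      hence "Im s' \<le> 1 / Im s" using Im_moebius_le(2)[of B 1 s] B Bs s by (auto simp: det_Gamma0)
      also have "\<dots> < 1" using s by simp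
      finally show False using s by simp
    qed
    hence "nome s' = nome s" using nome_moebius_translation[of B s] B Bs det_Gamma0 by simp
    thus ?thesis using q q' by (simp add: s_def s'_def nome_log_nome)
  qed
  have "inj_on G (ball 0 r)"
  proof (rule inj_onI)
    fix q q' assume "q \<in> ball 0 r" "q' \<in> ball 0 r" "G q = G q'"
    thus "q = q'" using inj[of q q'] ne[of q] ne[of q'] G(2) by metis
  qed
  hence "deriv G 0 \<noteq> 0"
    using r by (intro holomorphic_injective_imp_regular[OF holomorphic_on_subset[OF G(1)]]) auto
  with G show ?thesis by (rule that)
qed

end


section \<open>Coincidences of j(\<tau>) and j(M\<tau>) near a fixed point\<close>

text \<open>
  The automorphy factor.
\<close>

definition denom :: "int^2^2 \<Rightarrow> complex \<Rightarrow> complex" where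
  "denom A z = of_int (A $ 2 $ 1) * z + of_int (A $ 2 $ 2)"

lemma denom_mult:
  assumes "det B \<noteq> 0" "Im z > 0"
  shows "denom (A ** B) z = denom A (moebius B z) * denom B z"
proof -
  obtain a b c d a' b' c' d' where AB: "A = mat2 a b c d" "B = mat2 a' b' c' d'"
    by (metis mat2_cases)
  have "of_int c' * z + of_int d' \<noteq> 0" using moebius_denom_nonzero[OF assms] by (simp add: AB)
  thus ?thesis by (simp add: AB denom_def moebius_mat2 field_simps)
qed

lemma mat_eq_mat2: "mat k = mat2 k 0 0 k"
  by (simp add: vec_eq_iff forall_2 mat_def)

lemma scalar_commute: "mat k ** (A :: int^2^2) = A ** mat k"
  by (cases A rule: mat2_cases) (simp add: mat_eq_mat2 mult.commute)

text \<open>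
  At a fixed point, \<open>\<tau> \<mapsto> P\<tau>\<close> has derivative \<open>n / (cz + d)\<^sup>2\<close>, which is here supposed to be \<open>1\<close>. A
  holomorphic automorphism of the upper half plane with such a fixed point is the identity; for
  integral matrices this can be seen directly, as \<open>cz + d\<close> must be real.
\<close>

lemma scalar_if_trivial_rotation:
  assumes n: "det P = n" "n > 0" and z: "Im z > 0" and fixed_point: "moebius P z = z"
    and rot: "(denom P z)\<^sup>2 = of_int n"
  shows "\<exists>k. P = mat k"
proof -
  obtain a b c d where P: "P = mat2 a b c d" by (rule mat2_cases)
  have c0: "c = 0"
  proof (rule ccontr)
    assume c: "c \<noteq> 0"
    have "Im ((denom P z)\<^sup>2) = 2 * of_int c * Im z * (of_int c * Re z + of_int d)"
      by (simp add: P denom_def power2_eq_square algebra_simps)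
    hence "of_int c * Re z + of_int d = 0" using rot c z by simp
    hence "Re ((denom P z)\<^sup>2) = - (of_int c * Im z)\<^sup>2"
      by (simp add: P denom_def power2_eq_square)
    hence "of_int n = - (of_int c * Im z)\<^sup>2" using rot by simp
    moreover have "(of_int c * Im z)\<^sup>2 \<ge> 0" by simp
    ultimately show False using n(2) by linarith
  qed
  have "(of_int (d\<^sup>2) :: complex) = of_int n" using rot by (simp add: P denom_def c0)
  hence dn: "d\<^sup>2 = n" by (simp only: of_int_eq_iff)
  have d0: "d \<noteq> 0" using dn n by auto
  have "a * d = d * d" using n dn by (simp add: P c0 power2_eq_square)
  hence a: "a = d" using d0 by simp
  have "(of_int a * z + of_int b) / of_int d = z" using fixed_point by (simp add: P moebius_mat2 c0)
  hence "b = 0" using d0 by (simp add: a field_simps)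
  thus ?thesis by (auto simp: P c0 a mat_eq_mat2)
qed

text \<open>
  For these matrices, \<open>j(\<tau>) - j(M\<tau>)\<close> vanishes identically, and they have to be left out of the
  product.
\<close>

definition scalar_class :: "nat \<Rightarrow> int^2^2 \<Rightarrow> bool" where
  "scalar_class p M \<longleftrightarrow> (\<exists>A\<in>Gamma0 p. \<exists>k. M = A ** mat k)"

context cusp_uniformizer
begin

lemma j_isCont: "Im z > 0 \<Longrightarrow> isCont j z"
  using holomorphic_on_imp_continuous_on[OF hol_j] open_uhp
  by (auto simp: continuous_on_eq_continuous_at)

text \<open>
  Near every point, \<open>j\<close> is a power of a local coordinate up to an additive constant.
\<close>

lemma j_local_power:
  assumes z: "Im z > 0"
  obtains m r \<phi> where "m > 0" "r > 0" "ball z r \<subseteq> upper_half_plane" "\<phi> holomorphic_on ball z r"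
    "\<phi> z = 0" "inj_on \<phi> (ball z r)" "deriv \<phi> z \<noteq> 0"
    "\<And>w. w \<in> ball z r \<Longrightarrow> j w - j z = \<phi> w ^ m"
proof -
  have "\<exists>m>0. (deriv ^^ m) j z \<noteq> 0"
  proof (rule ccontr)
    assume "\<not> ?thesis"
    hence "\<And>n. 0 < n \<Longrightarrow> (deriv ^^ n) j z = 0" by blast
    hence "j w = j z" if "w \<in> upper_half_plane" for w
      using z that
      by (intro holomorphic_fun_eq_const_on_connected[OF hol_j open_uhp connected_uhp]) simp_all
    thus False using j_nonconstant unfolding constant_on_def by blast
  qed
  then obtain m where m: "m > 0" "(deriv ^^ m) j z \<noteq> 0" "\<And>i. 0 < i \<Longrightarrow> i < m \<Longrightarrow> (deriv ^^ i) j z = 0"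
    using exists_least_iff[of "\<lambda>m. m > 0 \<and> (deriv ^^ m) j z \<noteq> 0"] by blast
  obtain h r where h: "0 < r" "h holomorphic_on ball z r"
    "\<And>w. w \<in> ball z r \<Longrightarrow> j w - j z = ((w - z) * h w) ^ m" "\<And>w. w \<in> ball z r \<Longrightarrow> h w \<noteq> 0"
  proof -
    have "z \<in> upper_half_plane" using z by simp
    from holomorphic_factor_order_of_zero_strong[OF hol_j open_uhp this m(1,2)] m(3) that
    show ?thesis by metis
  qed
  obtain r' where r': "r' > 0" "ball z r' \<subseteq> upper_half_plane"
    using open_uhp z by (meson in_uhp openE)
  define \<phi> where "\<phi> = (\<lambda>w. (w - z) * h w)"
  define s where "s = min r r'"
  have hol: "\<phi> holomorphic_on ball z s"
    unfolding \<phi>_def by (intro holomorphic_intros holomorphic_on_subset[OF h(2)]) (auto simp: s_def)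
  have "(h has_field_derivative deriv h z) (at z)"
    using h by (intro holomorphic_derivI[where S = "ball z r"]) auto
  hence "(\<phi> has_field_derivative h z) (at z)"
    unfolding \<phi>_def by (auto intro!: derivative_eq_intros)
  hence der: "deriv \<phi> z = h z" by (rule DERIV_imp_deriv)
  have nz: "deriv \<phi> z \<noteq> 0" using h(1,4) by (simp add: der)
  have s: "s > 0" using h r' by (simp add: s_def)
  obtain t where t: "t > 0" "ball z t \<subseteq> ball z s" "inj_on \<phi> (ball z t)"
    using has_complex_derivative_locally_injective[OF hol centre_in_ball[THEN iffD2, OF s] open_ball
      nz] by blast
  show ?thesis
  proof (rule that[OF m(1) t(1)])
    have "ball z s \<subseteq> ball z r'" by (simp add: s_def subset_ball)
    thus "ball z t \<subseteq> upper_half_plane" using t(2) r'(2) by (meson order.trans)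
    show "\<phi> holomorphic_on ball z t" using hol t(2) holomorphic_on_subset by blast
    show "j w - j z = \<phi> w ^ m" if "w \<in> ball z t" for w
      using subsetD[OF t(2) that] h(3)[of w] by (simp add: \<phi>_def s_def)
  qed (use t nz in \<open>auto simp: \<phi>_def\<close>)
qed

lemma j_eventually_neq:
  assumes z: "Im z > 0"
  shows "eventually (\<lambda>w. j w \<noteq> j z) (at z)"
proof -
  obtain m r \<phi> where m: "m > 0" "r > 0" "ball z r \<subseteq> upper_half_plane" "\<phi> holomorphic_on ball z r"
    "\<phi> z = 0" "inj_on \<phi> (ball z r)" "deriv \<phi> z \<noteq> 0"
    "\<And>w. w \<in> ball z r \<Longrightarrow> j w - j z = \<phi> w ^ m" using j_local_power[OF z] by blast
  have "eventually (\<lambda>w. w \<in> ball z r - {z}) (at z)"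
    using m(2) by (intro eventually_at_in_open) auto
  thus ?thesis
  proof eventually_elim
    case (elim w)
    hence "\<phi> w \<noteq> \<phi> z" using m(2,6) by (auto simp: inj_on_def)
    thus ?case using m(1,5) m(8)[of w] elim by auto
  qed
qed

text \<open>
  In the coordinate \<open>\<phi>\<close> with \<open>j - j(z) = \<phi>\<^sup>m\<close>, the limit is \<open>\<zeta>\<^sup>m\<close> where \<open>\<zeta>\<close> is the derivative of \<open>N\<close> at its
  fixed point. Assume \<open>\<zeta>\<^sup>m = 1\<close>. Then the points \<open>w\<close> and \<open>\<phi>\<^sup>-\<^sup>1(\<zeta> \<phi>(w))\<close> have the same value under \<open>j\<close>, so
  they are equivalent, and by proper discontinuity one and the same matrix \<open>A\<close> of \<open>\<Gamma>\<^sub>0(p)\<close> does this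
  for points \<open>w\<close> arbitrarily close to \<open>z\<close>. This matrix fixes \<open>z\<close> and has the derivative \<open>\<zeta>\<close> there.
  Therefore \<open>A\<^sup>-\<^sup>1 N\<close> has derivative \<open>1\<close> and is scalar.
\<close>

lemma local_ratio:
  assumes N: "N \<in> hecke p n" "n > 0" and z: "Im z > 0" and fixed_point: "moebius N z = z"
    and ns: "\<not> scalar_class p N"
  shows "\<exists>L. L \<noteq> 1 \<and> ((\<lambda>w. (j (moebius N w) - j z) / (j w - j z)) \<longlongrightarrow> L) (at z)"
proof -
  have detN: "det N = n" using N by (simp add: hecke_def)
  obtain m r \<phi> where m: "m > 0" "r > 0" "ball z r \<subseteq> upper_half_plane" "\<phi> holomorphic_on ball z r"
    "\<phi> z = 0" "inj_on \<phi> (ball z r)" "deriv \<phi> z \<noteq> 0"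
    "\<And>w. w \<in> ball z r \<Longrightarrow> j w - j z = \<phi> w ^ m" using j_local_power[OF z] by blast
  have d\<phi>: "(\<phi> has_field_derivative deriv \<phi> z) (at z)"
    using m by (intro holomorphic_derivI[where S = "ball z r"]) auto
  have lim_ratio: "((\<lambda>w. \<phi> (moebius A w) / \<phi> w) \<longlongrightarrow> of_int (det A) / (denom A z)\<^sup>2) (at z)"
    if "det A > 0" "moebius A z = z" for A
  proof -
    let ?D = "of_int (det A) / (denom A z)\<^sup>2"
    have "(moebius A has_field_derivative ?D) (at z)"
      using moebius_has_field_derivative[of A z] that z by (simp add: denom_def)
    hence "((\<lambda>w. \<phi> (moebius A w)) has_field_derivative deriv \<phi> z * ?D) (at z)"
      using that by (intro DERIV_chain2[where f = \<phi>] ) (use d\<phi> in auto)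
    hence "((\<lambda>w. \<phi> (moebius A w) / (w - z)) \<longlongrightarrow> deriv \<phi> z * ?D) (at z)"
      using that m(5) by (simp add: has_field_derivative_iff)
    moreover have "((\<lambda>w. \<phi> w / (w - z)) \<longlongrightarrow> deriv \<phi> z) (at z)"
      using d\<phi> m(5) by (simp add: has_field_derivative_iff)
    ultimately have "((\<lambda>w. (\<phi> (moebius A w) / (w - z)) / (\<phi> w / (w - z))) \<longlongrightarrow>
        deriv \<phi> z * ?D / deriv \<phi> z) (at z)"
      using m(7) by (intro tendsto_divide)
    also have "deriv \<phi> z * ?D / deriv \<phi> z = ?D" using m(7) by simp
    finally show ?thesis
      by (rule Lim_transform_eventually) (auto simp: eventually_at_filter)
  qed
  have ev_ball: "eventually (\<lambda>w. w \<in> ball z r) (at z)"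
    using m(2) by (intro eventually_at_in_open') auto
  have contM: "filterlim (moebius A) (nhds (moebius A z)) (at z)" if "det A \<noteq> 0" for A
    using continuous_moebius[OF that z] by (simp add: isCont_def)
  have ev_ball': "eventually (\<lambda>w. moebius N w \<in> ball z r) (at z)"
    using contM[of N] detN N(2) fixed_point m(2) topological_tendstoD[of "moebius N" z "at z"
      "ball z r"] by auto
  define \<zeta> where "\<zeta> = of_int n / (denom N z)\<^sup>2"
  have "((\<lambda>w. (\<phi> (moebius N w) / \<phi> w) ^ m) \<longlongrightarrow> \<zeta> ^ m) (at z)"
    using lim_ratio[of N] detN N(2) fixed_point by (intro tendsto_power) (simp add: \<zeta>_def)
  moreover have
    "eventually (\<lambda>w. (\<phi> (moebius N w) / \<phi> w) ^ m = (j (moebius N w) - j z) / (j w - j z)) (at z)"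
    using ev_ball ev_ball' by eventually_elim (simp add: m(8) power_divide)
  ultimately have lim: "((\<lambda>w. (j (moebius N w) - j z) / (j w - j z)) \<longlongrightarrow> \<zeta> ^ m) (at z)"
    by (rule Lim_transform_eventually)
  have "\<zeta> ^ m \<noteq> 1"
  proof
    assume \<zeta>1: "\<zeta> ^ m = 1"
    have open_img: "open (\<phi> ` ball z (r / 2))"
      using m(2,4,6)
      by (intro open_mapping_thm3 holomorphic_on_subset[OF m(4)] inj_on_subset[OF m(6)]) auto
    have zero_img: "0 \<in> \<phi> ` ball z (r / 2)" using m(2,5) by (intro image_eqI[of _ _ z]) auto
    have "isCont \<phi> z" using d\<phi> by (rule DERIV_isCont)
    hence "((\<lambda>w. \<zeta> * \<phi> w) \<longlongrightarrow> \<zeta> * \<phi> z) (at z)" by (intro tendsto_intros) (simp add: isCont_def)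
    hence "((\<lambda>w. \<zeta> * \<phi> w) \<longlongrightarrow> 0) (at z)" using m(5) by simp
    from topological_tendstoD[OF this open_img zero_img]
    have ev: "eventually (\<lambda>w. \<zeta> * \<phi> w \<in> \<phi> ` ball z (r / 2)) (at z)" .
    define K where "K = cball z (r / 2)"
    have K: "compact K" "K \<subseteq> ball z r" using m(2) by (auto simp: K_def)
    define S where "S = {A. det A = 1 \<and> (\<exists>w\<in>K. moebius A w \<in> K)} \<inter> Gamma0 p"
    have "finite {A. det A = 1 \<and> (\<exists>w\<in>K. moebius A w \<in> K)}"
      using K m(3) by (intro finite_moebius_compact) auto
    hence finS: "finite S" by (simp add: S_def)
    have ev_K: "eventually (\<lambda>w. w \<in> ball z (r/2)) (at z)"
      using m(2) by (intro eventually_at_in_open') auto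
    have "eventually (\<lambda>w. \<exists>A\<in>S. \<phi> (moebius A w) = \<zeta> * \<phi> w \<and> moebius A w \<in> K) (at z)"
      using ev ev_K
    proof eventually_elim
      case (elim w)
      then obtain v where v: "v \<in> ball z (r / 2)" "\<phi> v = \<zeta> * \<phi> w" by auto
      have vw: "v \<in> ball z r" "w \<in> ball z r" using v elim m(2) by auto
      hence im: "Im v > 0" "Im w > 0" using m(3) by auto
      have "j v - j z = j w - j z" using vw by (simp add: m(8) v(2) power_mult_distrib \<zeta>1)
      hence "Gamma0_rel p w v" using im by (intro j_injective) auto
      then obtain A where A: "A \<in> Gamma0 p" "moebius A w = v" by (auto simp: Gamma0_rel_def)
      hence "A \<in> S" using v(1) elim(2) by (auto simp: S_def K_def det_Gamma0 intro!: bexI[of _ w])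
      thus ?case using A v by (intro bexI[of _ A]) (auto simp: K_def)
    qed
    \<comment> \<open>Finitely many candidates for \<open>A\<close> are left, so one of them occurs
      arbitrarily close to \<open>z\<close>.\<close>
    from frequently_bex_finite[OF finS eventually_frequently[OF _ this]]
    have "\<exists>A\<in>S. frequently (\<lambda>w. \<phi> (moebius A w) = \<zeta> * \<phi> w \<and> moebius A w \<in> K) (at z)" by simp
    then obtain A where A: "A \<in> S" and freq:
      "frequently (\<lambda>w. \<phi> (moebius A w) = \<zeta> * \<phi> w \<and> moebius A w \<in> K) (at z)"
      by blast
    have AG: "A \<in> Gamma0 p" "det A = 1" using A by (auto simp: S_def)
    have Az_K: "moebius A z \<in> K"
    proof (rule ccontr)
      assume "moebius A z \<notin> K"
      hence "eventually (\<lambda>w. moebius A w \<in> - K) (at z)"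
        using contM[of A] AG K(1) by (intro topological_tendstoD) (auto intro: compact_imp_closed)
      hence "eventually (\<lambda>w. \<not> (\<phi> (moebius A w) = \<zeta> * \<phi> w \<and> moebius A w \<in> K)) (at z)"
        by eventually_elim auto
      thus False using freq by (simp add: frequently_def)
    qed
    have Az: "moebius A z = z"
    proof -
      have "isCont \<phi> (moebius A z)"
        using K(2) Az_K holomorphic_on_imp_continuous_on[OF m(4)]
        by (meson continuous_on_eq_continuous_at open_ball subsetD)
      hence "((\<lambda>w. \<phi> (moebius A w)) \<longlongrightarrow> \<phi> (moebius A z)) (at z)"
        by (rule isCont_tendsto_compose[OF _ contM]) (simp add: AG(2))
      moreover have "((\<lambda>w. \<zeta> * \<phi> w) \<longlongrightarrow> 0) (at z)" by fact
      ultimately have "((\<lambda>w. \<phi> (moebius A w) - \<zeta> * \<phi> w) \<longlongrightarrow> \<phi> (moebius A z) - 0) (at z)"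
        by (rule tendsto_diff)
      have "\<phi> (moebius A z) = 0"
      proof (rule ccontr)
        assume "\<phi> (moebius A z) \<noteq> 0"
        hence "eventually (\<lambda>w. \<phi> (moebius A w) - \<zeta> * \<phi> w \<noteq> 0) (at z)"
          using \<open>((\<lambda>w. \<phi> (moebius A w) - \<zeta> * \<phi> w) \<longlongrightarrow> \<phi> (moebius A z) - 0) (at z)\<close>
          by (intro tendsto_imp_eventually_ne) auto
        hence "eventually (\<lambda>w. \<not> (\<phi> (moebius A w) = \<zeta> * \<phi> w \<and> moebius A w \<in> K)) (at z)"
          by eventually_elim auto
        thus False using freq by (simp add: frequently_def)
      qed
      thus ?thesis using m(2,5,6) K(2) Az_K by (auto simp: inj_on_def)
    qed
    \<comment> \<open>The derivative of \<open>A\<close> can be read off from the points \<open>w\<close> with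
      \<open>\<phi>(A w) = \<zeta> \<phi>(w)\<close>.\<close>
    have rotA: "1 / (denom A z)\<^sup>2 = \<zeta>"
    proof (rule ccontr)
      assume "1 / (denom A z)\<^sup>2 \<noteq> \<zeta>"
      hence "eventually (\<lambda>w. \<phi> (moebius A w) / \<phi> w \<noteq> \<zeta>) (at z)"
        using lim_ratio[of A] AG Az by (intro tendsto_imp_eventually_ne) auto
      moreover have "eventually (\<lambda>w. \<phi> w \<noteq> 0) (at z)"
        using eventually_at_in_open[of "ball z r" z] m(2)
        by (auto elim!: eventually_mono) (metis inj_onD m(2,5,6) centre_in_ball mem_ball)
      ultimately have "eventually (\<lambda>w. \<not> (\<phi> (moebius A w) = \<zeta> * \<phi> w \<and> moebius A w \<in> K)) (at z)"
        by eventually_elim auto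
      thus False using freq by (auto simp: frequently_def)
    qed
    define P where "P = adj2 A ** N"
    have N_eq: "N = A ** P"
      using AG by (simp add: P_def matrix_mul_assoc adj2_mult)
    have detP: "det P = n" using AG N_eq detN by (simp add: det_mul)
    have Pz: "moebius P z = z"
      using detN N(2) z fixed_point moebius_adj2(1)[OF AG(2) z] Az by (simp add: P_def moebius_mult)
    have dA: "denom A z \<noteq> 0" using moebius_denom_nonzero[of A z] AG z by (simp add: denom_def)
    have dP: "denom P z \<noteq> 0" using moebius_denom_nonzero[of P z] detP N(2) z
      by (simp add: denom_def)
    have "denom N z = denom A z * denom P z"
      using denom_mult[of P z A] detP N(2) z Pz by (simp add: N_eq)
    hence "1 / (denom A z)\<^sup>2 = of_int n / ((denom A z)\<^sup>2 * (denom P z)\<^sup>2)"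
      using rotA by (simp add: \<zeta>_def power_mult_distrib)
    hence "(denom P z)\<^sup>2 = of_int n" using dA dP by (simp add: field_simps)
    then obtain k where "P = mat k"
      using scalar_if_trivial_rotation[OF detP N(2) z Pz] by blast
    thus False using ns AG(1) N_eq by (auto simp: scalar_class_def)
  qed
  with lim show ?thesis by blast
qed

text \<open>
  A single factor vanishes to exactly the same order as \<open>j - j(z)\<close>, or not at all. In the first
  case, \<open>M\<close> may be replaced by an equivalent matrix that fixes \<open>z\<close>.
\<close>

lemma factor_local_limit:
  assumes M: "M \<in> hecke p n" "n > 0" "\<not> scalar_class p M" and z: "Im z > 0"
  defines "k \<equiv> (if j (moebius M z) = j z then 1 else 0)"
  shows "\<exists>L. L \<noteq> 0 \<and> ((\<lambda>w. (j w - j (moebius M w)) / (j w - j z) ^ k) \<longlongrightarrow> L) (at z)"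
proof (cases "j (moebius M z) = j z")
  case True
  have detM: "det M = n" using M by (simp add: hecke_def)
  have Mz: "Im (moebius M z) > 0" using detM M(2) z by (simp add: moebius_in_uhp)
  have "Gamma0_rel p (moebius M z) z" using True Mz z by (intro j_injective) auto
  then obtain B where B: "B \<in> Gamma0 p" "moebius B (moebius M z) = z" by (auto simp: Gamma0_rel_def)
  define N where "N = B ** M"
  have N: "N \<in> hecke p n" using B M by (simp add: N_def Gamma0_mult_hecke)
  have "\<not> scalar_class p N"
  proof
    assume "scalar_class p N"
    then obtain A k where A: "A \<in> Gamma0 p" "N = A ** mat k" by (auto simp: scalar_class_def)
    have "M = adj2 B ** N" using B by (simp add: N_def matrix_mul_assoc adj2_mult det_Gamma0)
    hence "M = (adj2 B ** A) ** mat k" by (simp add: A(2) matrix_mul_assoc)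
    thus False using M(3) A(1) B(1) by (auto simp: scalar_class_def Gamma0_mult adj2_in_Gamma0)
  qed
  moreover have NM: "moebius N w = moebius B (moebius M w)" if "Im w > 0" for w
    using that detM M(2) by (simp add: N_def moebius_mult)
  ultimately obtain L where L: "L \<noteq> 1" "((\<lambda>w. (j (moebius N w) - j z) / (j w - j z)) \<longlongrightarrow> L) (at z)"
    using local_ratio[OF N M(2) z] B(2) z by auto
  have "((\<lambda>w. 1 - (j (moebius N w) - j z) / (j w - j z)) \<longlongrightarrow> 1 - L) (at z)"
    by (intro tendsto_intros L)
  moreover have "eventually (\<lambda>w. w \<in> upper_half_plane) (at z)"
    using z by (intro eventually_at_in_open' open_uhp) auto
  hence "eventually (\<lambda>w. 1 - (j (moebius N w) - j z) / (j w - j z) =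
           (j w - j (moebius M w)) / (j w - j z) ^ k) (at z)"
    using j_eventually_neq[OF z]
  proof eventually_elim
    case (elim w)
    have "Im (moebius M w) > 0" using elim detM M(2) by (simp add: moebius_in_uhp)
    hence "j (moebius N w) = j (moebius M w)" using elim B by (simp add: NM inv_j)
    thus ?case using elim True by (simp add: k_def field_simps)
  qed
  ultimately have "((\<lambda>w. (j w - j (moebius M w)) / (j w - j z) ^ k) \<longlongrightarrow> 1 - L) (at z)"
    by (rule Lim_transform_eventually)
  thus ?thesis using L(1) by (intro exI[of _ "1 - L"]) auto
next
  case False
  have detM: "det M = n" using M by (simp add: hecke_def)
  have "isCont (moebius M) z" using detM M(2) z by (intro continuous_moebius) auto
  moreover have "isCont j (moebius M z)" using detM M(2) z by (intro j_isCont moebius_in_uhp) auto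
  ultimately have "isCont (\<lambda>w. j w - j (moebius M w)) z"
    using j_isCont[OF z] by (intro continuous_diff isCont_o2[of z "moebius M" j])
  thus ?thesis using False
    by (intro exI[of _ "j z - j (moebius M z)"]) (auto simp: k_def isCont_def)
qed

end

section \<open>The product over matrices of determinant \<open>n\<close>\<close>

definition hecke_rep :: "nat \<Rightarrow> nat \<Rightarrow> nat \<Rightarrow> int^2^2" where
  "hecke_rep n d b = mat2 (int (n div d)) (int b) 0 (int d)"

definition hecke_reps :: "nat \<Rightarrow> (int^2^2) set" where
  "hecke_reps n = (\<lambda>(d, b). hecke_rep n d b) ` (SIGMA d:{d. d dvd n}. {..<d})"

lemma inj_hecke_rep: "inj_on (\<lambda>(d, b). hecke_rep n d b) A"
  by (auto simp: inj_on_def hecke_rep_def)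

lemma finite_hecke_reps: "n > 0 \<Longrightarrow> finite (hecke_reps n)"
  by (auto simp: hecke_reps_def)

lemma hecke_reps_iff:
  assumes "n > 0"
  shows "M \<in> hecke_reps n \<longleftrightarrow> (\<exists>a b d. M = mat2 a b 0 d \<and> a > 0 \<and> d > 0 \<and> a * d = int n \<and> 0 \<le> b \<and>
      b < d)"
proof
  assume "M \<in> hecke_reps n"
  then obtain d b where db: "d dvd n" "b < d" "M = hecke_rep n d b" by (auto simp: hecke_reps_def)
  hence "n div d > 0" using assms by (auto elim!: dvdE)
  moreover have "int (n div d) * int d = int n" using db by (simp flip: of_nat_mult)
  ultimately show "\<exists>a b d. M = mat2 a b 0 d \<and> a > 0 \<and> d > 0 \<and> a * d = int n \<and> 0 \<le> b \<and> b < d"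
    using db by (auto simp: hecke_rep_def intro!: exI[of _ "int (n div d)"])
next
  assume "\<exists>a b d. M = mat2 a b 0 d \<and> a > 0 \<and> d > 0 \<and> a * d = int n \<and> 0 \<le> b \<and> b < d"
  then obtain a b d where abd: "M = mat2 a b 0 d" "a > 0" "d > 0" "a * d = int n" "0 \<le> b" "b < d"
    by blast
  define a' b' d' where "a' = nat a" and "b' = nat b" and "d' = nat d"
  have eq: "a = int a'" "b = int b'" "d = int d'" using abd by (auto simp: a'_def b'_def d'_def)
  have "int (a' * d') = int n" using abd(4) by (simp add: eq)
  hence n: "n = a' * d'" by (simp only: of_nat_eq_iff)
  hence "M = hecke_rep n d' b'" using abd(1,3) by (auto simp: hecke_rep_def eq)
  moreover have "d' dvd n" "b' < d'" using n abd(6) by (auto simp: eq)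
  ultimately show "M \<in> hecke_reps n" by (auto simp: hecke_reps_def)
qed

lemma hecke_reps_subset: "n > 0 \<Longrightarrow> hecke_reps n \<subseteq> hecke p (int n)"
  by (auto simp: hecke_reps_iff)

text \<open>
  Row reduction by \<open>\<Gamma>\<^sub>0(p)\<close>. The lower row that annihilates the first column \<open>(a, c)\<close> is \<open>(-c, a)\<close>
  divided by \<open>g = gcd(a, c)\<close>; as \<open>g\<close> divides \<open>n\<close>, it is prime to \<open>p\<close>, and so \<open>c/g\<close> remains divisible by \<open>p\<close>.
\<close>

lemma hecke_reps_exists:
  assumes p: "prime p" and n: "n > 0" "coprime n p" and M: "M \<in> hecke p (int n)"
  obtains A R where "A \<in> Gamma0 p" "R \<in> hecke_reps n" "M = A ** R"
proof -
  obtain a b c d where M_eq: "M = mat2 a b c d" by (rule mat2_cases)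
  have det: "a * d - b * c = int n" and pc: "int p dvd c" using M by (auto simp: M_eq)
  define g where "g = gcd a c"
  have "a \<noteq> 0 \<or> c \<noteq> 0" using det n by auto
  hence g: "g > 0" by (auto simp: g_def)
  obtain u v where uv: "u * a + v * c = g" using bezout_int[of a c] by (auto simp: g_def)
  obtain x y where xy: "c = g * x" "a = g * y" by (metis g_def gcd_dvd1 gcd_dvd2 dvdE)
  have "g dvd int n" using det xy by (metis dvd_diff dvd_mult dvd_mult2 dvd_triv_left)
  hence "coprime g (int p)" using n(2) by (metis coprime_divisors coprime_int_iff dvd_refl)
  hence px: "int p dvd x" using pc xy(1) by (simp add: coprime_commute coprime_dvd_mult_right_iff)
  have "g * (u * y + v * x) = g * 1" using uv by (simp add: xy algebra_simps)
  hence uvxy: "u * y + v * x = 1" using g by simp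
  define b' where "b' = u * b + v * d"
  define d' where "d' = y * d - x * b"
  have gd': "g * d' = int n" using det by (simp add: d'_def xy algebra_simps)
  have d': "d' > 0" using gd' g n(1) by (metis of_nat_0_less_iff zero_less_mult_pos)
  define k where "k = - (b' div d')"
  define B where "B = mat2 (u - k * x) (v + k * y) (-x) y"
  define R where "R = mat2 g (b' + k * d') 0 d'"
  have "(u - k * x) * y - (v + k * y) * (- x) = u * y + v * x" by (simp add: algebra_simps)
  hence B: "B \<in> Gamma0 p" using px uvxy by (simp add: B_def)
  have "B ** M = R"
    using uv by (simp add: B_def M_eq R_def b'_def d'_def xy algebra_simps)
  hence M_eq': "M = adj2 B ** R" using B by (auto simp: matrix_mul_assoc adj2_mult det_Gamma0)
  have "b' + k * d' = b' mod d'" by (simp add: k_def minus_div_mult_eq_mod algebra_simps)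
  hence "R \<in> hecke_reps n" using g d' gd' n(1) by (auto simp: hecke_reps_iff R_def)
  thus ?thesis using that[OF adj2_in_Gamma0[OF B]] M_eq' by blast
qed

lemma hecke_reps_unique:
  assumes n: "n > 0" and R: "R \<in> hecke_reps n" "R' \<in> hecke_reps n" and A: "A \<in> Gamma0 p"
    "R = A ** R'"
  shows "R = R'"
proof -
  obtain a b d where abd: "R = mat2 a b 0 d" "a > 0" "d > 0" "a * d = int n" "0 \<le> b" "b < d"
    using R n by (auto simp: hecke_reps_iff)
  obtain a' b' d' where abd': "R' = mat2 a' b' 0 d'" "a' > 0" "d' > 0" "a' * d' = int n" "0 \<le> b'"
    "b' < d'"
    using R n by (auto simp: hecke_reps_iff)
  obtain x y z w where xyzw: "A = mat2 x y z w" by (rule mat2_cases)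
  have eq: "a = x * a'" "b = x * b' + y * d'" "0 = z * a'" "d = z * b' + w * d'"
    using A(2) by (auto simp: abd abd' xyzw)
  have z: "z = 0" using eq(3) abd'(2) by simp
  have "x * w = 1" using A(1) by (simp add: xyzw z)
  moreover have "x > 0" using eq(1) abd(2) abd'(2) by (metis zero_less_mult_pos2)
  ultimately have xw: "x = 1" "w = 1" using zmult_eq_1_iff by fastforce+
  have ad: "a = a'" "d = d'" using eq by (auto simp: xw z)
  have "b mod d = (b' + y * d) mod d" using eq(2) by (simp add: xw ad)
  hence "b = b'" using abd abd' by (simp add: ad)
  thus ?thesis by (simp add: abd abd' ad)
qed

text \<open>
  A map between matrices that is injective on cosets \<open>\<Gamma>\<^sub>0(p) M\<close> permutes the finitely many cosets,
  and does not change a product over them. This is applied to right multiplication by \<open>\<Gamma>\<^sub>0(p)\<close> and to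
  conjugation by the Fricke involution.
\<close>

lemma prod_hecke_reps_reindex:
  assumes p: "prime p" and n: "n > 0" "coprime n p"
    and f: "\<And>A M. A \<in> Gamma0 p \<Longrightarrow> M \<in> hecke p (int n) \<Longrightarrow> f (A ** M) = (f M :: complex)"
    and \<Phi>: "\<And>M. M \<in> hecke p (int n) \<Longrightarrow> \<Phi> M \<in> hecke p (int n)"
    and \<Phi>_inj: "\<And>A M M'. A \<in> Gamma0 p \<Longrightarrow> M \<in> hecke p (int n) \<Longrightarrow> M' \<in> hecke p (int n) \<Longrightarrow>
                  \<Phi> M = A ** \<Phi> M' \<Longrightarrow> \<exists>B\<in>Gamma0 p. M = B ** M'"
  shows "(\<Prod>R\<in>hecke_reps n. f (\<Phi> R)) = (\<Prod>R\<in>hecke_reps n. f R)"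
proof -
  define rep where "rep = (\<lambda>M. SOME R. R \<in> hecke_reps n \<and> (\<exists>A\<in>Gamma0 p. M = A ** R))"
  have rep: "rep M \<in> hecke_reps n \<and> (\<exists>A\<in>Gamma0 p. M = A ** rep M)" if "M \<in> hecke p (int n)" for M
    unfolding rep_def using hecke_reps_exists[OF p n that] by (rule someI_ex, blast)
  have sub: "R \<in> hecke p (int n)" if "R \<in> hecke_reps n" for R
    using hecke_reps_subset n that by blast
  have inj: "inj_on (\<lambda>R. rep (\<Phi> R)) (hecke_reps n)"
  proof (rule inj_onI)
    fix R R' assume R: "R \<in> hecke_reps n" "R' \<in> hecke_reps n" "rep (\<Phi> R) = rep (\<Phi> R')"
    obtain A where A: "A \<in> Gamma0 p" "\<Phi> R = A ** rep (\<Phi> R)" using rep \<Phi> sub R by blast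
    obtain A' where A': "A' \<in> Gamma0 p" "\<Phi> R' = A' ** rep (\<Phi> R')" using rep \<Phi> sub R by blast
    have "adj2 A' ** \<Phi> R' = rep (\<Phi> R')"
      by (subst A'(2)) (use A'(1) in \<open>simp add: matrix_mul_assoc adj2_mult det_Gamma0\<close>)
    hence "\<Phi> R = (A ** adj2 A') ** \<Phi> R'"
      using A(2) R(3) by (metis matrix_mul_assoc)
    hence "\<exists>B\<in>Gamma0 p. R = B ** R'"
      using A A' R sub by (intro \<Phi>_inj[of "A ** adj2 A'"]) (auto simp: Gamma0_mult adj2_in_Gamma0)
    thus "R = R'" using hecke_reps_unique[OF n(1) R(1,2)] by blast
  qed
  have maps: "(\<lambda>R. rep (\<Phi> R)) ` hecke_reps n \<subseteq> hecke_reps n" using rep \<Phi> sub by blast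
  have surj: "(\<lambda>R. rep (\<Phi> R)) ` hecke_reps n = hecke_reps n"
    using inj maps finite_hecke_reps[OF n(1)] by (simp add: endo_inj_surj)
  have "(\<Prod>R\<in>hecke_reps n. f R) = (\<Prod>R\<in>(\<lambda>R. rep (\<Phi> R)) ` hecke_reps n. f R)" by (simp add: surj)
  also have "\<dots> = (\<Prod>R\<in>hecke_reps n. f (rep (\<Phi> R)))" using inj by (simp add: prod.reindex)
  also have "\<dots> = (\<Prod>R\<in>hecke_reps n. f (\<Phi> R))"
  proof (rule prod.cong)
    fix R assume R: "R \<in> hecke_reps n"
    obtain A where A: "A \<in> Gamma0 p" "\<Phi> R = A ** rep (\<Phi> R)" using rep \<Phi> sub R by blast
    thus "f (rep (\<Phi> R)) = f (\<Phi> R)"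
      using f[OF A(1), of "rep (\<Phi> R)"] sub rep \<Phi> R by metis
  qed simp
  finally show ?thesis ..
qed

lemma scalar_class_left:
  assumes "A \<in> Gamma0 p"
  shows "scalar_class p (A ** M) \<longleftrightarrow> scalar_class p M"
proof
  assume "scalar_class p M"
  thus "scalar_class p (A ** M)"
    using assms unfolding scalar_class_def by (metis Gamma0_mult matrix_mul_assoc)
next
  assume "scalar_class p (A ** M)"
  then obtain B k where B: "B \<in> Gamma0 p" "A ** M = B ** mat k" by (auto simp: scalar_class_def)
  have "M = adj2 A ** (A ** M)" using assms by (simp add: matrix_mul_assoc adj2_mult det_Gamma0)
  hence "M = (adj2 A ** B) ** mat k" by (simp add: B(2) matrix_mul_assoc)
  thus "scalar_class p M" using assms B by (auto simp: scalar_class_def Gamma0_mult adj2_in_Gamma0)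
qed

lemma scalar_class_right:
  assumes "A \<in> Gamma0 p"
  shows "scalar_class p (M ** A) \<longleftrightarrow> scalar_class p M"
proof -
  have *: "scalar_class p (M ** A)" if "A \<in> Gamma0 p" and sc: "scalar_class p M" for A M
  proof -
    obtain B k where B: "B \<in> Gamma0 p" "M = B ** mat k" using sc unfolding scalar_class_def by blast
    have "M ** A = B ** (mat k ** A)" by (simp add: B(2) matrix_mul_assoc)
    also have "\<dots> = (B ** A) ** mat k" by (simp add: scalar_commute matrix_mul_assoc)
    finally show ?thesis using B that Gamma0_mult by (auto simp: scalar_class_def)
  qed
  have "M = M ** A ** adj2 A"
    using assms by (simp add: matrix_mul_assoc[symmetric] adj2_mult det_Gamma0)
  thus ?thesis using *[OF assms, of M] *[OF adj2_in_Gamma0[OF assms], of "M ** A"] by metis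
qed

lemma fricke_conj_hom:
  assumes "p > 0" "A \<in> hecke p m" "B \<in> hecke p n"
  shows "fricke_conj p (A ** B) = fricke_conj p A ** fricke_conj p B"
proof -
  obtain a b c d where A: "A = mat2 a b (int p * c) d"
    using assms(2) by (cases A rule: mat2_cases) (auto elim!: dvdE)
  obtain a' b' c' d' where B: "B = mat2 a' b' (int p * c') d'"
    using assms(3) by (cases B rule: mat2_cases) (auto elim!: dvdE)
  have "int p * c * a' + d * (int p * c') = int p * (c * a' + d * c')" by (simp add: algebra_simps)
  thus ?thesis using assms(1) by (simp add: fricke_conj_def A B algebra_simps)
qed

lemma fricke_conj_invol:
  assumes "p > 0" "A \<in> hecke p m"
  shows "fricke_conj p (fricke_conj p A) = A"
proof -
  obtain a b c d where A: "A = mat2 a b (int p * c) d"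
    using assms(2) by (cases A rule: mat2_cases) (auto elim!: dvdE)
  thus ?thesis using assms(1) by (simp add: fricke_conj_def A flip: mult_minus_right)
qed

lemma scalar_class_fricke_conj:
  assumes "p > 0" "M \<in> hecke p m"
  shows "scalar_class p (fricke_conj p M) \<longleftrightarrow> scalar_class p M"
proof -
  have *: "scalar_class p (fricke_conj p M)" if sc: "scalar_class p M" for M
  proof -
    obtain B k where B: "B \<in> Gamma0 p" "M = B ** mat k" using sc unfolding scalar_class_def by blast
    have "mat k \<in> hecke p (k * k)" by (simp add: mat_eq_mat2)
    hence "fricke_conj p M = fricke_conj p B ** fricke_conj p (mat k)"
      using B assms(1) by (simp add: fricke_conj_hom Gamma0_eq_hecke)
    also have "fricke_conj p (mat k) = mat k" by (simp add: mat_eq_mat2 fricke_conj_def)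
    finally show ?thesis using B fricke_conj_in_Gamma0 by (auto simp: scalar_class_def)
  qed
  show ?thesis using *[of M] *[of "fricke_conj p M"] fricke_conj_invol[OF assms] by metis
qed

lemma scalar_class_rep:
  assumes n: "n > 0" and R: "R \<in> hecke_reps n"
  shows "scalar_class p R \<longleftrightarrow> (\<exists>k. n = k\<^sup>2 \<and> R = hecke_rep n k 0)"
proof
  assume "scalar_class p R"
  then obtain B k where B: "B \<in> Gamma0 p" "R = B ** mat k" by (auto simp: scalar_class_def)
  obtain x y z w where xyzw: "B = mat2 x y z w" by (rule mat2_cases)
  obtain a b d where abd: "R = mat2 a b 0 d" "a > 0" "d > 0" "a * d = int n" "0 \<le> b" "b < d"
    using R n by (auto simp: hecke_reps_iff)
  have eq: "a = x * k" "b = y * k" "0 = z * k" "d = w * k" using B(2)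
    by (auto simp: abd xyzw mat_eq_mat2)
  have k: "k \<noteq> 0" using eq(1) abd(2) by auto
  hence z: "z = 0" using eq by simp
  hence xw: "x * w = 1" using B(1) by (simp add: xyzw)
  hence "(x = 1 \<and> w = 1) \<or> (x = -1 \<and> w = -1)" using zmult_eq_1_iff by blast
  hence ad: "a = d" "a = \<bar>k\<bar>" using eq abd(2,3) by auto
  have "b = 0"
  proof (rule ccontr)
    assume "b \<noteq> 0"
    hence "y \<noteq> 0" using eq by auto
    hence "1 * \<bar>k\<bar> \<le> \<bar>y\<bar> * \<bar>k\<bar>" by (intro mult_right_mono) auto
    hence "\<bar>k\<bar> \<le> \<bar>b\<bar>" by (simp add: eq(2) abs_mult)
    thus False using abd ad by simp
  qed
  define k' where "k' = nat a"
  have a: "a = int k'" using abd by (simp add: k'_def)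
  have "int (k'\<^sup>2) = int n" using abd(4) ad by (simp add: a power2_eq_square)
  hence nk: "n = k'\<^sup>2" by (simp only: of_nat_eq_iff)
  moreover have "R = hecke_rep n k' 0"
    using nk abd(1,2) ad \<open>b = 0\<close> by (auto simp: hecke_rep_def a power2_eq_square)
  ultimately show "\<exists>k. n = k\<^sup>2 \<and> R = hecke_rep n k 0" by blast
next
  assume "\<exists>k. n = k\<^sup>2 \<and> R = hecke_rep n k 0"
  then obtain k where k: "n = k\<^sup>2" "R = hecke_rep n k 0" by blast
  hence "R = mat 1 ** mat (int k)"
    using n by (auto simp: hecke_rep_def mat_eq_mat2 power2_eq_square)
  thus "scalar_class p R" using mat_1_in_Gamma0 unfolding scalar_class_def by blast
qed

text \<open>
  Factors of the scalar class are replaced by \<open>1\<close>, so that all products run over the same index set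
  whether or not \<open>n\<close> is a square.
\<close>

definition hecke_factor :: "nat \<Rightarrow> (complex \<Rightarrow> complex) \<Rightarrow> int^2^2 \<Rightarrow> complex \<Rightarrow> complex" where
  "hecke_factor p f M w = (if scalar_class p M then 1 else f w - f (moebius M w))"

definition hecke_prod :: "nat \<Rightarrow> (complex \<Rightarrow> complex) \<Rightarrow> nat \<Rightarrow> complex \<Rightarrow> complex" where
  "hecke_prod p f n w = (\<Prod>M\<in>hecke_reps n. hecke_factor p f M w)"

context cusp_uniformizer
begin

lemma hecke_prod_holomorphic:
  assumes "n > 0"
  shows "hecke_prod p j n holomorphic_on upper_half_plane"
proof -
  have "hecke_factor p j M holomorphic_on upper_half_plane" if "M \<in> hecke_reps n" for M
  proof -
    have detM: "det M > 0" using that hecke_reps_subset[OF assms, of p] assms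
      by (auto simp: hecke_def)
    have "j \<circ> moebius M holomorphic_on upper_half_plane"
      using detM
      by (intro holomorphic_on_compose_gen[OF holomorphic_moebius hol_j])
        (auto simp: moebius_in_uhp)
    hence "(\<lambda>w. j w - j (moebius M w)) holomorphic_on upper_half_plane"
      by (intro holomorphic_intros hol_j) (simp add: o_def)
    thus ?thesis by (cases "scalar_class p M") (auto simp: hecke_factor_def[abs_def])
  qed
  thus ?thesis unfolding hecke_prod_def[abs_def] by (intro holomorphic_intros)
qed

lemma hecke_prod_invariant:
  assumes n: "n > 0" "coprime n p" and A: "A \<in> Gamma0 p" and w: "Im w > 0"
  shows "hecke_prod p j n (moebius A w) = hecke_prod p j n w"
proof -
  have det: "det M > 0" if "M \<in> hecke p (int n)" for M using that n by (auto simp: hecke_def)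
  have "hecke_prod p j n (moebius A w) = (\<Prod>R\<in>hecke_reps n. hecke_factor p j (R ** A) w)"
    unfolding hecke_prod_def
    by (rule prod.cong) (use A w in \<open>auto simp: hecke_factor_def scalar_class_right inv_j
      moebius_mult det_Gamma0\<close>)
  also have "\<dots> = hecke_prod p j n w"
    unfolding hecke_prod_def
  proof (rule prod_hecke_reps_reindex[OF prime_p n])
    show "hecke_factor p j (B ** M) w = hecke_factor p j M w"
      if "B \<in> Gamma0 p" "M \<in> hecke p (int n)" for B M
      using that det[OF that(2)] w
      by (simp add: hecke_factor_def scalar_class_left moebius_mult inv_j moebius_in_uhp)
    show "\<exists>B'\<in>Gamma0 p. M = B' ** M'" if "B \<in> Gamma0 p" "M ** A = B ** (M' ** A)" for B M M'
    proof -
      have "M = (M ** A) ** adj2 A"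
        using A by (simp add: matrix_mul_assoc[symmetric] adj2_mult det_Gamma0)
      also have "\<dots> = B ** (M' ** (A ** adj2 A))" using that by (simp add: matrix_mul_assoc)
      also have "\<dots> = B ** M'" using A by (simp add: adj2_mult det_Gamma0)
      finally show ?thesis using that by blast
    qed
  qed (use A in \<open>auto intro: hecke_mult_Gamma0\<close>)
  finally show ?thesis .
qed

lemma hecke_prod_fricke:
  assumes n: "n > 0" "coprime n p" and w: "Im w > 0"
  shows "hecke_prod p j n (moebius (fricke p) w) = hecke_prod p j0 n w"
proof -
  have det: "det M > 0" if "M \<in> hecke p (int n)" for M using that n by (auto simp: hecke_def)
  have "hecke_prod p j n (moebius (fricke p) w) =
      (\<Prod>R\<in>hecke_reps n. hecke_factor p j0 (fricke_conj p R) w)"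
    unfolding hecke_prod_def
  proof (rule prod.cong)
    fix R assume "R \<in> hecke_reps n"
    hence R: "R \<in> hecke p (int n)" using hecke_reps_subset n by blast
    show "hecke_factor p j R (moebius (fricke p) w) = hecke_factor p j0 (fricke_conj p R) w"
      using moebius_fricke_conj[OF R _ p_pos w] n scalar_class_fricke_conj[OF p_pos R]
      by (simp add: hecke_factor_def j0_def)
  qed simp
  also have "\<dots> = hecke_prod p j0 n w"
    unfolding hecke_prod_def
  proof (rule prod_hecke_reps_reindex[OF prime_p n])
    show "hecke_factor p j0 (B ** M) w = hecke_factor p j0 M w"
      if "B \<in> Gamma0 p" "M \<in> hecke p (int n)" for B M
      using that det[OF that(2)] w
      by (simp add: hecke_factor_def scalar_class_left moebius_mult inv_j0 moebius_in_uhp)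
    show "\<exists>B'\<in>Gamma0 p. M = B' ** M'"
      if B: "B \<in> Gamma0 p" and M: "M \<in> hecke p (int n)" "M' \<in> hecke p (int n)"
      and eq: "fricke_conj p M = B ** fricke_conj p M'" for B M M'
    proof -
      have "M = fricke_conj p (fricke_conj p M)" using M by (simp add: fricke_conj_invol[OF p_pos])
      also have "\<dots> = fricke_conj p B ** fricke_conj p (fricke_conj p M')"
        using fricke_conj_hom[OF p_pos, of B 1 "fricke_conj p M'" "int n"] B M
        by (simp add: eq Gamma0_eq_hecke fricke_conj_in_hecke)
      also have "\<dots> = fricke_conj p B ** M'" using M by (simp add: fricke_conj_invol[OF p_pos])
      finally show ?thesis using fricke_conj_in_Gamma0[OF B] by blast
    qed
  qed (auto intro: fricke_conj_in_hecke)
  finally show ?thesis .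
qed

lemma hecke_prod_local_limit:
  assumes n: "n > 0" and z: "Im z > 0"
  shows "\<exists>L. L \<noteq> 0 \<and> ((\<lambda>w. hecke_prod p j n w /
     (j w - j z) ^ card {M\<in>hecke_reps n. \<not> scalar_class p M \<and> j (moebius M z) = j z}) \<longlongrightarrow> L) (at z)"
proof -
  define e where "e = (\<lambda>M. if \<not> scalar_class p M \<and> j (moebius M z) = j z then 1 else (0::nat))"
  have "\<exists>L. L \<noteq> 0 \<and> ((\<lambda>w. hecke_factor p j M w / (j w - j z) ^ e M) \<longlongrightarrow> L) (at z)"
    if M: "M \<in> hecke_reps n" for M
  proof (cases "scalar_class p M")
    case True
    thus ?thesis by (auto simp: hecke_factor_def e_def intro!: exI[of _ 1])
  next
    case False
    have "M \<in> hecke p (int n)" using M hecke_reps_subset n by blast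
    from factor_local_limit[OF this _ False z] n show ?thesis
      using False by (simp add: hecke_factor_def e_def)
  qed
  then obtain L where L: "\<And>M. M \<in> hecke_reps n \<Longrightarrow> L M \<noteq> 0"
    "\<And>M. M \<in> hecke_reps n \<Longrightarrow> ((\<lambda>w. hecke_factor p j M w / (j w - j z) ^ e M) \<longlongrightarrow> L M) (at z)"
    by metis
  have "((\<lambda>w. \<Prod>M\<in>hecke_reps n. hecke_factor p j M w / (j w - j z) ^ e M) \<longlongrightarrow> (\<Prod>M\<in>hecke_reps n. L M))
      (at z)"
    by (intro tendsto_prod L)
  moreover have "(\<Prod>M\<in>hecke_reps n. L M) \<noteq> 0" using L(1) finite_hecke_reps[OF n] by simp
  moreover have "(\<Sum>M\<in>hecke_reps n. e M) = card {M\<in>hecke_reps n. \<not> scalar_class p M \<and>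
      j (moebius M z) = j z}"
    using finite_hecke_reps[OF n] unfolding e_def by (subst sum.inter_filter[symmetric]) auto
  ultimately show ?thesis
    by (auto simp: hecke_prod_def prod_dividef power_sum[symmetric])
qed

end


section \<open>Counting matrices that fix a point\<close>

definition fixers :: "nat \<Rightarrow> int \<Rightarrow> complex \<Rightarrow> (int^2^2) set" where
  "fixers p n z = {N \<in> hecke p n. moebius N z = z}"

definition pos_fixers :: "nat \<Rightarrow> int \<Rightarrow> complex \<Rightarrow> (int^2^2) set" where
  "pos_fixers p n z = {N \<in> fixers p n z. N $ 2 $ 1 > 0}"

lemma finite_fixers: "n > 0 \<Longrightarrow> Im z > 0 \<Longrightarrow> finite (fixers p n z)"
  by (rule finite_subset[OF _ finite_moebius_compact[of "{z}" n]]) (auto simp: fixers_def hecke_def)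

lemma finite_pos_fixers: "n > 0 \<Longrightarrow> Im z > 0 \<Longrightarrow> finite (pos_fixers p n z)"
  using finite_fixers by (auto simp: pos_fixers_def)

lemma mat2_right_cancel:
  fixes X Y R :: "int^2^2"
  assumes "X ** R = Y ** R" "det R \<noteq> 0"
  shows "X = Y"
proof -
  have R: "R ** adj2 R = mat (det R)"
    by (cases R rule: mat2_cases) (simp add: mat_eq_mat2 algebra_simps)
  have "X ** mat (det R) = Y ** mat (det R)"
    using assms(1) unfolding R[symmetric] by (simp add: matrix_mul_assoc)
  thus ?thesis using assms(2)
    by (cases X rule: mat2_cases, cases Y rule: mat2_cases) (simp add: mat_eq_mat2)
qed

lemma uminus_mult2: "(- A :: int^2^2) ** (B :: int^2^2) = - (A ** B)"
  by (cases A rule: mat2_cases, cases B rule: mat2_cases) simp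

lemma uminus_in_hecke: "A \<in> hecke p n \<Longrightarrow> - A \<in> hecke p n"
  by (cases A rule: mat2_cases) auto

lemma uminus_in_Gamma0: "A \<in> Gamma0 p \<Longrightarrow> - A \<in> Gamma0 p"
  by (simp add: Gamma0_eq_hecke uminus_in_hecke)

lemma moebius_uminus [simp]: "moebius (- A) z = moebius A z"
proof -
  obtain a b c d where A: "A = mat2 a b c d" by (rule mat2_cases)
  have "moebius (- A) z = (- (of_int a * z + of_int b)) / (- (of_int c * z + of_int d))"
    by (simp only: A uminus_mat2 moebius_mat2 of_int_minus) simp
  also have "\<dots> = moebius A z" by (simp only: minus_divide_divide A moebius_mat2)
  finally show ?thesis .
qed

lemma scalar_class_uminus: "scalar_class p (- M) \<longleftrightarrow> scalar_class p M"
proof -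
  have *: "scalar_class p (- M)" if "scalar_class p M" for M
    using that uminus_in_Gamma0 unfolding scalar_class_def by (metis uminus_mult2)
  from *[of M] *[of "- M"] show ?thesis by auto
qed

lemma fixer_translation:
  assumes "N \<in> hecke p n" "n > 0" "moebius N z = z" "N $ 2 $ 1 = 0" "Im z > 0"
  obtains k where "N = mat k" "k\<^sup>2 = n"
proof -
  obtain a b c d where N: "N = mat2 a b c d" by (rule mat2_cases)
  have c: "c = 0" and ad: "a * d = n" using assms(1,4) by (auto simp: N)
  have d: "d \<noteq> 0" using ad assms(2) by auto
  have eq: "of_int a * z + of_int b = of_int d * z" using assms(3) d
    by (simp add: N moebius_mat2 c field_simps)
  hence "Im (of_int a * z + of_int b) = Im (of_int d * z)" by simp
  hence "a = d" using assms(5) by simp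
  thus ?thesis using that[of d] ad eq by (auto simp: N c mat_eq_mat2 power2_eq_square)
qed

text \<open>
  Relates a stabiliser in \<open>\<Gamma>\<^sub>0(p)\<close> to its image in \<open>\<Gamma>\<^sub>0(p)/{\<plusminus>1}\<close>.
\<close>

lemma card_sign_pairs:
  fixes S :: "(int^2^2) set"
  assumes "finite S" "\<And>A. A \<in> S \<Longrightarrow> - A \<in> S" "\<And>A. A \<in> S \<Longrightarrow> A \<noteq> - A"
  shows "card S = 2 * card ((\<lambda>A. {A, - A}) ` S)"
proof -
  let ?C = "(\<lambda>A. {A, - A}) ` S"
  have U: "\<Union>?C = S" using assms(2) by auto
  have "2 * card ?C = card (\<Union>?C)"
  proof (rule card_partition)
    show "card c = 2" if "c \<in> ?C" for c using that assms(3) by auto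
    show "c1 \<inter> c2 = {}" if "c1 \<in> ?C" "c2 \<in> ?C" "c1 \<noteq> c2" for c1 c2
      using that by (auto simp: insert_commute)
  qed (use assms(1) U in auto)
  thus ?thesis by (simp add: U)
qed

lemma det_nonzero_neq_uminus: "det (A :: int^2^2) \<noteq> 0 \<Longrightarrow> A \<noteq> - A"
  by (cases A rule: mat2_cases) auto

text \<open>
  Matrices with a fixed point come in pairs \<open>\<plusminus>N\<close>, of which one has a positive lower left entry,
  unless this entry is \<open>0\<close> and the matrix is scalar. Not counting the scalar class amounts to not
  counting these; for the stabiliser itself, they account for the summand \<open>2\<close>.
\<close>

lemma card_pos_fixers:
  assumes n: "n > 0" and z: "Im z > 0"
  shows "card {N \<in> fixers p n z. \<not> scalar_class p N} =
      2 * card {N \<in> pos_fixers p n z. \<not> scalar_class p N}"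
    and "card (fixers p 1 z) = 2 * card (pos_fixers p 1 z) + 2"
proof -
  define P where "P = {N \<in> pos_fixers p n z. \<not> scalar_class p N}"
  have finP: "finite P" using finite_pos_fixers[OF n z] by (simp add: P_def)
  have "{N \<in> fixers p n z. \<not> scalar_class p N} = P \<union> uminus ` P"
  proof (intro equalityI subsetI)
    fix N assume N: "N \<in> {N \<in> fixers p n z. \<not> scalar_class p N}"
    have "N $ 2 $ 1 \<noteq> 0"
    proof
      assume "N $ 2 $ 1 = 0"
      then obtain k where "N = mat k" using fixer_translation[of N p n z] N n z
        by (auto simp: fixers_def)
      hence "N = mat 1 ** mat k" by simp
      thus False using N mat_1_in_Gamma0 unfolding scalar_class_def by blast
    qed
    thus "N \<in> P \<union> uminus ` P"
      using N by (cases "N $ 2 $ 1 > 0")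
        (auto simp: P_def pos_fixers_def fixers_def image_iff scalar_class_uminus uminus_in_hecke
          intro!: exI[of _ "-N"])
  qed (auto simp: P_def pos_fixers_def fixers_def scalar_class_uminus uminus_in_hecke)
  moreover have "P \<inter> uminus ` P = {}" by (auto simp: P_def pos_fixers_def)
  moreover have "card (uminus ` P) = card P" by (intro card_image) (auto simp: inj_on_def)
  ultimately show "card {N \<in> fixers p n z. \<not> scalar_class p N} = 2 * card P"
    using finP by (simp add: card_Un_disjoint)
next
  define P where "P = pos_fixers p 1 z"
  have finP: "finite P" using finite_pos_fixers[OF _ z] by (simp add: P_def)
  have "fixers p 1 z = (P \<union> uminus ` P) \<union> {mat 1, - mat 1}"
  proof (intro equalityI subsetI)
    fix N assume N: "N \<in> fixers p 1 z"
    show "N \<in> (P \<union> uminus ` P) \<union> {mat 1, - mat 1}"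
    proof (cases "N $ 2 $ 1 = 0")
      case True
      then obtain k where "N = mat k" "k\<^sup>2 = 1" using fixer_translation[of N p 1 z] N z
        by (auto simp: fixers_def)
      moreover from this have "k = 1 \<or> k = -1" by (simp add: power2_eq_1_iff)
      ultimately show ?thesis by (auto simp: mat_eq_mat2)
    next
      case False
      thus ?thesis
        using N by (cases "N $ 2 $ 1 > 0")
          (auto simp: P_def pos_fixers_def fixers_def image_iff uminus_in_hecke intro!:
            exI[of _ "-N"])
    qed
  qed (auto simp: P_def pos_fixers_def fixers_def uminus_in_hecke mat_1_eq_mat2 moebius_mat2)
  moreover have "P \<inter> uminus ` P = {}" by (auto simp: P_def pos_fixers_def)
  moreover have "(P \<union> uminus ` P) \<inter> {mat 1, - mat 1} = {}"
  proof -
    have "N $ 2 $ 1 \<noteq> 0" if "N \<in> P \<union> uminus ` P" for N using that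
      by (auto simp: P_def pos_fixers_def)
    moreover have "N $ 2 $ 1 = 0" if "N \<in> {mat 1, - mat 1}" for N :: "int^2^2"
      using that by (auto simp: mat_1_eq_mat2)
    ultimately show ?thesis by blast
  qed
  moreover have "card (uminus ` P) = card P" by (intro card_image) (auto simp: inj_on_def)
  moreover have "card {mat 1, - mat 1 :: int^2^2} = 2" by (simp add: mat_1_eq_mat2)
  moreover have "card ((P \<union> uminus ` P) \<union> {mat 1, - mat 1}) =
      card (P \<union> uminus ` P) + card {mat 1, - mat 1 :: int^2^2}"
    by (rule card_Un_disjoint) (use finP calculation(3) in auto)
  moreover have "card (P \<union> uminus ` P) = card P + card (uminus ` P)"
    by (rule card_Un_disjoint) (use finP calculation(2) in auto)
  ultimately show "card (fixers p 1 z) = 2 * card P + 2" by simp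
qed

text \<open>
  For \<open>n = k\<^sup>2\<close>, the scalar class consists of the matrices \<open>kA\<close> with \<open>A\<close> in \<open>\<Gamma>\<^sub>0(p)\<close>.
\<close>

lemma card_scalar_pos_fixers:
  assumes n: "n > 0" and z: "Im z > 0"
  shows "card {N \<in> pos_fixers p (int n) z. scalar_class p N} =
      (if is_square n then card (pos_fixers p 1 z) else 0)"
proof (cases "is_square n")
  case False
  have "{N \<in> pos_fixers p (int n) z. scalar_class p N} = {}"
  proof safe
    fix N assume N: "N \<in> pos_fixers p (int n) z" "scalar_class p N"
    then obtain A k where A: "A \<in> Gamma0 p" "N = A ** mat k" unfolding scalar_class_def by blast
    have "int n = k\<^sup>2"
      using N(1) A
      by (auto simp: pos_fixers_def fixers_def hecke_def det_mul det_Gamma0 mat_eq_mat2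
        power2_eq_square)
    hence "n = (nat \<bar>k\<bar>)\<^sup>2"
      by (simp add: nat_power_eq[symmetric] nat_abs_mult_distrib power2_eq_square flip:
        nat_mult_distrib)
    thus "N \<in> {}" using False by auto
  qed
  thus ?thesis using False by (simp only: card.empty if_False)
next
  case True
  then obtain k where k: "n = k\<^sup>2" by (auto elim: is_nth_powerE)
  have k0: "k > 0" using n k by (cases k) auto
  have mob: "moebius (A ** mat (int k)) z = moebius A z" for A
    using k0 z by (subst moebius_mult) (auto simp: mat_eq_mat2 moebius_mat2)
  have entry: "(A ** mat (int k)) $ 2 $ 1 = A $ 2 $ 1 * int k" for A :: "int^2^2"
    by (cases A rule: mat2_cases) (simp add: mat_eq_mat2)
  have "bij_betw (\<lambda>A. A ** mat (int k)) (pos_fixers p 1 z) {N \<in> pos_fixers p (int n) z.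
      scalar_class p N}"
  proof (rule bij_betwI')
    show "(A ** mat (int k) = B ** mat (int k)) = (A = B)" for A B :: "int^2^2"
      using mat2_right_cancel[of A "mat (int k)" B] k0 by (auto simp: mat_eq_mat2)
  next
    fix A assume A: "A \<in> pos_fixers p 1 z"
    have "mat (int k) \<in> hecke p (int n)" by (simp add: mat_eq_mat2 k power2_eq_square)
    with A have "A ** mat (int k) \<in> hecke p (int n)"
      using hecke_mult[of A p 1] by (simp add: pos_fixers_def fixers_def)
    thus "A ** mat (int k) \<in> {N \<in> pos_fixers p (int n) z. scalar_class p N}"
      using A k0
      by (auto simp: pos_fixers_def fixers_def mob entry scalar_class_def Gamma0_eq_hecke)
  next
    fix N assume N: "N \<in> {N \<in> pos_fixers p (int n) z. scalar_class p N}"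
    then obtain A k' where A: "A \<in> Gamma0 p" "N = A ** mat k'" unfolding scalar_class_def by blast
    have "int n = k'\<^sup>2"
      using N A
      by (auto simp: pos_fixers_def fixers_def hecke_def det_mul det_Gamma0 mat_eq_mat2
        power2_eq_square)
    hence "k'\<^sup>2 = (int k)\<^sup>2" by (simp add: k)
    \<comment> \<open>A negative factor can be absorbed by \<open>A\<close>.\<close>
    hence "k' = int k \<or> k' = - int k" by (simp add: power2_eq_iff)
    then obtain B where B: "B \<in> Gamma0 p" "N = B ** mat (int k)"
    proof
      assume "k' = - int k"
      hence "N = (- A) ** mat (int k)"
        by (simp add: A(2) uminus_mult2) (cases A rule: mat2_cases; simp add: mat_eq_mat2)
      thus ?thesis using that[of "- A"] A(1) by (simp add: uminus_in_Gamma0)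
    qed (use that A in auto)
    have "B \<in> pos_fixers p 1 z"
      using N B k0
      by (auto simp: pos_fixers_def fixers_def mob entry Gamma0_eq_hecke zero_less_mult_iff)
    thus "\<exists>B\<in>pos_fixers p 1 z. N = B ** mat (int k)" using B by blast
  qed
  thus ?thesis using True by (simp add: bij_betw_same_card)
qed

context cusp_uniformizer
begin

text \<open>
  Map a matrix that fixes \<open>z\<close> to the representative \<open>R\<close> of its class. If \<open>B R\<close> is one matrix that fixes
  \<open>z\<close> in the class of \<open>R\<close>, then the others are the \<open>A B R\<close> with \<open>A\<close> in the stabiliser of \<open>z\<close>; so all fibres
  have the order of the stabiliser.
\<close>

lemma card_coincidences:
  assumes n: "n > 0" "coprime n p" and z: "Im z > 0"
  shows "card {M\<in>hecke_reps n. \<not> scalar_class p M \<and> j (moebius M z) = j z} * card (fixers p 1 z) =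
         card {N \<in> fixers p (int n) z. \<not> scalar_class p N}"
proof -
  define X where "X = {M\<in>hecke_reps n. \<not> scalar_class p M \<and> j (moebius M z) = j z}"
  define fib where "fib = (\<lambda>R. {N \<in> fixers p (int n) z. \<exists>A\<in>Gamma0 p. N = A ** R})"
  have n': "int n > 0" using n by simp
  have finX: "finite X" using finite_hecke_reps[OF n(1)] by (simp add: X_def)
  have sub: "R \<in> hecke p (int n)" if "R \<in> hecke_reps n" for R
    using hecke_reps_subset n that by blast
  have fin_fib: "finite (fib R)" for R using finite_fixers[OF n' z] by (simp add: fib_def)
  have eq: "{N \<in> fixers p (int n) z. \<not> scalar_class p N} = (\<Union>R\<in>X. fib R)"
  proof (intro equalityI subsetI)
    fix N assume N: "N \<in> {N \<in> fixers p (int n) z. \<not> scalar_class p N}"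
    obtain A R where AR: "A \<in> Gamma0 p" "R \<in> hecke_reps n" "N = A ** R"
      using hecke_reps_exists[OF prime_p n, of N] N by (auto simp: fixers_def)
    have detR: "det R = int n" using sub[OF AR(2)] by (simp add: hecke_def)
    have Rz: "Im (moebius R z) > 0" using detR n' z by (intro moebius_in_uhp) auto
    have "moebius A (moebius R z) = z"
      using N AR detR n' z by (simp add: fixers_def moebius_mult)
    hence "j (moebius R z) = j z" using inv_j[OF AR(1) Rz] by simp
    moreover have "\<not> scalar_class p R" using N AR by (simp add: scalar_class_left)
    ultimately have "R \<in> X" using AR by (simp add: X_def)
    thus "N \<in> (\<Union>R\<in>X. fib R)" using N AR by (auto simp: fib_def)
  next
    fix N assume "N \<in> (\<Union>R\<in>X. fib R)"
    thus "N \<in> {N \<in> fixers p (int n) z. \<not> scalar_class p N}"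
      by (auto simp: fib_def X_def scalar_class_left)
  qed
  have "card (fib R) = card (fixers p 1 z)" if R: "R \<in> X" for R
  proof -
    have detR: "det R = int n" using sub R by (simp add: hecke_def X_def)
    have Rz: "Im (moebius R z) > 0" using detR n' z by (intro moebius_in_uhp) auto
    have "Gamma0_rel p (moebius R z) z" using R z Rz by (intro j_injective) (auto simp: X_def)
    then obtain B where B: "B \<in> Gamma0 p" "moebius B (moebius R z) = z"
      by (auto simp: Gamma0_rel_def)
    have BRz: "moebius (B ** R) z = z" using B detR n' z by (simp add: moebius_mult)
    have detBR: "det (B ** R) = int n" using B detR by (simp add: det_mul det_Gamma0)
    have "bij_betw (\<lambda>A. A ** (B ** R)) (fixers p 1 z) (fib R)"
    proof (rule bij_betwI')
      show "(A ** (B ** R) = A' ** (B ** R)) = (A = A')" for A A' :: "int^2^2"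
        using mat2_right_cancel[of A "B ** R" A'] detBR n' by auto
    next
      fix A assume A: "A \<in> fixers p 1 z"
      hence AG: "A \<in> Gamma0 p" by (simp add: fixers_def Gamma0_eq_hecke)
      have "A ** (B ** R) \<in> hecke p (int n)"
        using AG B R sub by (intro Gamma0_mult_hecke) (auto simp: X_def)
      moreover have "moebius (A ** (B ** R)) z = z"
        using A BRz detBR n' z by (simp add: fixers_def moebius_mult)
      moreover have "A ** (B ** R) = (A ** B) ** R" by (simp add: matrix_mul_assoc)
      ultimately show "A ** (B ** R) \<in> fib R"
        using AG B Gamma0_mult unfolding fib_def fixers_def by blast
    next
      fix N assume N: "N \<in> fib R"
      then obtain A where A: "A \<in> Gamma0 p" "N = A ** R" by (auto simp: fib_def)
      have detA: "det A = 1" and detB: "det B = 1" using A B by (simp_all add: det_Gamma0)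
      define C where "C = A ** adj2 B"
      have C: "C \<in> Gamma0 p" using A B by (simp add: C_def Gamma0_mult adj2_in_Gamma0)
      have "C ** (B ** R) = A ** ((adj2 B ** B) ** R)" by (simp add: C_def matrix_mul_assoc)
      also have "\<dots> = N" using A detB by (simp add: adj2_mult)
      finally have N_eq: "N = C ** (B ** R)" ..
      have "moebius N z = moebius C (moebius (B ** R) z)"
        unfolding N_eq using detBR n' z by (intro moebius_mult) auto
      hence "moebius C z = z" using N BRz by (simp add: fib_def fixers_def)
      thus "\<exists>A\<in>fixers p 1 z. N = A ** (B ** R)"
        using C N_eq by (auto simp: fixers_def Gamma0_eq_hecke)
    qed
    thus ?thesis by (simp add: bij_betw_same_card)
  qed
  moreover have "card (\<Union>R\<in>X. fib R) = (\<Sum>R\<in>X. card (fib R))"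
  proof (rule card_UN_disjoint[OF finX])
    show "\<forall>R\<in>X. \<forall>R'\<in>X. R \<noteq> R' \<longrightarrow> fib R \<inter> fib R' = {}"
    proof (intro ballI impI, rule ccontr)
      fix R R' assume R: "R \<in> X" "R' \<in> X" "R \<noteq> R'" "fib R \<inter> fib R' \<noteq> {}"
      then obtain N where "N \<in> fib R" "N \<in> fib R'" by blast
      then obtain A A' where A: "A \<in> Gamma0 p" "N = A ** R" "A' \<in> Gamma0 p" "N = A' ** R'"
        unfolding fib_def by blast
      have "R = (adj2 A ** A) ** R" using A by (simp add: adj2_mult det_Gamma0)
      also have "\<dots> = adj2 A ** N" by (simp only: A(2) matrix_mul_assoc)
      also have "\<dots> = (adj2 A ** A') ** R'" by (simp only: A(4) matrix_mul_assoc)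
      finally have "R = R'"
        using hecke_reps_unique[OF n(1), of R R' "adj2 A ** A'" p] R A
        by (simp add: X_def Gamma0_mult adj2_in_Gamma0)
      thus False using R by blast
    qed
  qed (use fin_fib in auto)
  ultimately show ?thesis unfolding eq by (simp add: X_def)
qed

end

section \<open>Quadratic forms and their roots\<close>

lemma bqf_eval_root_iff:
  assumes z: "Im z > 0"
  shows "bqf_eval (a, b, c) z 1 = 0 \<longleftrightarrow> of_int b = - 2 * of_int a * Re z \<and> of_int c =
      of_int a * (cmod z)\<^sup>2"
proof -
  have "bqf_eval (a, b, c) z 1 = 0 \<longleftrightarrow>
     of_int a * ((Re z)\<^sup>2 - (Im z)\<^sup>2) + of_int b * Re z + of_int c = 0 \<and>
     Im z * (2 * of_int a * Re z + of_int b) = 0"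
    by (simp add: complex_eq_iff power2_eq_square algebra_simps)
  also have "Im z * (2 * of_int a * Re z + of_int b) = 0 \<longleftrightarrow> of_int b = - 2 * of_int a * Re z"
    using z by auto
  also have "of_int a * ((Re z)\<^sup>2 - (Im z)\<^sup>2) + of_int b * Re z + of_int c = 0 \<and> of_int b =
      - 2 * of_int a * Re z \<longleftrightarrow>
    of_int b = - 2 * of_int a * Re z \<and> of_int c = of_int a * (cmod z)\<^sup>2"
    unfolding cmod_power2 by (auto simp: power2_eq_square algebra_simps)
  finally show ?thesis .
qed

lemma bqf_root_unique:
  assumes "a > 0" "Im z > 0" "Im w > 0" "bqf_eval (a, b, c) z 1 = 0" "bqf_eval (a, b, c) w 1 = 0"
  shows "z = w"
proof -
  note roots = assms(4)[unfolded bqf_eval_root_iff[OF assms(2)]]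
    assms(5)[unfolded bqf_eval_root_iff[OF assms(3)]]
  have Re: "Re z = Re w" and "(cmod z)\<^sup>2 = (cmod w)\<^sup>2"
    using assms(1) roots by auto
  hence "(Im z)\<^sup>2 = (Im w)\<^sup>2" by (simp add: cmod_power2)
  hence "Im z = Im w" using assms(2,3) by (simp add: power2_eq_iff_nonneg)
  with Re show ?thesis by (simp add: complex_eq_iff)
qed

text \<open>
  Together with \<open>bqf_eval_root_iff\<close>, this shows that a positive definite form is determined by its
  root and its discriminant, since the latter yields the leading coefficient.
\<close>

lemma bqf_disc_root:
  assumes "Im z > 0" "bqf_eval (a, b, c) z 1 = 0"
  shows "of_int (b\<^sup>2 - 4 * a * c) = - (2 * of_int a * Im z)\<^sup>2"
  using assms(2) unfolding bqf_eval_root_iff[OF assms(1)] cmod_power2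
  by (simp add: power2_eq_square algebra_simps)

lemma bqf_root_exists:
  assumes "a > 0" "b\<^sup>2 - 4 * a * c < 0"
  shows "\<exists>z. Im z > 0 \<and> bqf_eval (a, b, c) z 1 = 0"
proof -
  define D where "D = b\<^sup>2 - 4 * a * c"
  define z where "z = Complex (- of_int b / (2 * of_int a)) (sqrt (- of_int D) / (2 * of_int a))"
  have D: "real_of_int D < 0" using assms(2) unfolding D_def of_int_less_0_iff .
  have z: "Im z > 0" using assms D by (simp add: z_def)
  have "(cmod z)\<^sup>2 = ((of_int b)\<^sup>2 - of_int D) / (4 * (of_int a)\<^sup>2)"
    using D by (simp add: z_def cmod_power2 power_divide power_mult_distrib diff_divide_distrib)
  also have "\<dots> = of_int c / of_int a" using assms by (simp add: D_def field_simps power2_eq_square)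
  finally have "bqf_eval (a, b, c) z 1 = 0"
    using z assms by (simp only: bqf_eval_root_iff) (simp add: z_def)
  thus ?thesis using z by blast
qed

lemma tau_root:
  assumes "Q \<in> bqf_set D N" "D < 0"
  shows "Im (tau Q) > 0 \<and> bqf_eval Q (tau Q) 1 = 0"
proof -
  obtain a b c where Q: "Q = (a, b, c)" by (cases Q)
  have a: "a > 0" and D: "b\<^sup>2 - 4 * a * c < 0" using assms by (auto simp: Q bqf_set_def)
  have "\<exists>!z. z \<in> upper_half_plane \<and> bqf_eval Q z 1 = 0"
    using bqf_root_exists[OF a D] bqf_root_unique[OF a] unfolding Q in_uhp by blast
  from theI'[OF this] show ?thesis by (simp add: tau_def)
qed

lemma tau_eqI:
  assumes "Q \<in> bqf_set D N" "Im z > 0" "bqf_eval Q z 1 = 0"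
  shows "tau Q = z"
  unfolding tau_def
proof (rule the_equality)
  obtain a b c where Q: "Q = (a, b, c)" by (cases Q)
  have a: "a > 0" using assms by (auto simp: Q bqf_set_def)
  fix w assume "w \<in> upper_half_plane \<and> bqf_eval Q w 1 = 0"
  thus "w = z" using bqf_root_unique[OF a, of w z b c] assms(2,3) by (auto simp: Q)
qed (use assms in auto)

lemma bqf_eq_if_same_root:
  assumes "Q \<in> bqf_set D N" "Q' \<in> bqf_set D N" "Im z > 0" "bqf_eval Q z 1 = 0" "bqf_eval Q' z 1 = 0"
  shows "Q = Q'"
proof -
  obtain a b c where Q: "Q = (a, b, c)" by (cases Q)
  obtain a' b' c' where Q': "Q' = (a', b', c')" by (cases Q')
  have a: "a > 0" "a' > 0" and D: "b\<^sup>2 - 4 * a * c = D" "b'\<^sup>2 - 4 * a' * c' = D"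
    using assms by (auto simp: Q Q' bqf_set_def)
  have "(2 * of_int a * Im z)\<^sup>2 = (2 * of_int a' * Im z)\<^sup>2"
    using bqf_disc_root[of z a b c] bqf_disc_root[of z a' b' c'] assms D by (simp add: Q Q')
  hence aa: "a = a'" using a assms(3) by (simp add: power2_eq_iff_nonneg)
  have "real_of_int b = of_int b'" "real_of_int c = of_int c'"
    using assms(4,5) unfolding Q Q' bqf_eval_root_iff[OF assms(3)] aa by simp_all
  thus ?thesis by (simp add: Q Q' aa)
qed

lemma bqf_eval_scale: "bqf_eval Q (t * x) t = t\<^sup>2 * bqf_eval Q x 1"
  by (cases Q) (simp add: power2_eq_square algebra_simps)

lemma bqf_act_root:
  assumes "det A \<noteq> 0" "Im z > 0"
  shows "bqf_eval (bqf_act Q A) z 1 = 0 \<longleftrightarrow> bqf_eval Q (moebius A z) 1 = 0"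
proof -
  obtain a b c where Q: "Q = (a, b, c)" by (cases Q)
  let ?N = "of_int (A $ 1 $ 1) * z + of_int (A $ 1 $ 2)" and ?D =
    "of_int (A $ 2 $ 1) * z + of_int (A $ 2 $ 2)"
  have D: "?D \<noteq> 0" by (rule moebius_denom_nonzero[OF assms])
  have "bqf_eval (bqf_act Q A) z 1 = bqf_eval Q ?N ?D" by (simp add: bqf_eval_act)
  also have "\<dots> = bqf_eval Q (?D * (?N / ?D)) ?D" using D by simp
  also have "\<dots> = ?D\<^sup>2 * bqf_eval Q (?N / ?D) 1"
    by (rule bqf_eval_scale)
  finally show ?thesis using D by (simp add: moebius_def)
qed

lemma bqf_act_disc:
  assumes "(a', b', c') = bqf_act (a, b, c) A"
  shows "b'\<^sup>2 - 4 * a' * c' = (det A)\<^sup>2 * (b\<^sup>2 - 4 * a * c)"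
  using assms by (cases A rule: mat2_cases) (simp add: power2_eq_square algebra_simps)

lemma bqf_act_in_set:
  assumes Q: "Q \<in> bqf_set D N" and D: "D < 0" and A: "A \<in> Gamma0 N"
  shows "bqf_act Q A \<in> bqf_set D N"
proof -
  obtain a b c where Q_eq: "Q = (a, b, c)" by (cases Q)
  obtain x y z w where A_eq: "A = mat2 x y z w" by (rule mat2_cases)
  obtain a' b' c' where act: "bqf_act Q A = (a', b', c')" by (cases "bqf_act Q A")
  have disc: "b'\<^sup>2 - 4 * a' * c' = D"
    using bqf_act_disc[of a' b' c' a b c A] act Q A by (auto simp: Q_eq bqf_set_def det_Gamma0)
  have a'_eq: "a' = a * x\<^sup>2 + b * x * z + c * z\<^sup>2" using act by (simp add: Q_eq A_eq)
  have dvd: "int N dvd a'"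
  proof -
    have "int N dvd a" "int N dvd z" using Q A by (auto simp: Q_eq A_eq bqf_set_def)
    thus ?thesis by (simp add: a'_eq power2_eq_square)
  qed
  have a: "a > 0" and disc0: "b\<^sup>2 - 4 * a * c = D" using Q by (auto simp: Q_eq bqf_set_def)
  \<comment> \<open>Completing the square shows that the new leading coefficient is again positive.\<close>
  have "4 * a * a' = (2 * a * x + b * z)\<^sup>2 - (b\<^sup>2 - 4 * a * c) * z\<^sup>2"
    by (simp add: a'_eq power2_eq_square algebra_simps)
  hence eq: "4 * a * a' = (2 * a * x + b * z)\<^sup>2 + (- D) * z\<^sup>2" using disc0 by simp
  have "4 * a * a' > 0"
  proof (cases "z = 0")
    case True
    hence "x \<noteq> 0" using A by (auto simp: A_eq)
    thus ?thesis using a by (simp add: eq True)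
  next
    case False
    hence "(- D) * z\<^sup>2 > 0" using D by (intro mult_pos_pos) auto
    thus ?thesis unfolding eq by (intro add_nonneg_pos) auto
  qed
  hence "a' > 0" using a by (simp add: zero_less_mult_iff)
  thus ?thesis using disc dvd by (simp add: act bqf_set_def)
qed

lemma bqf_act_1: "bqf_act Q (mat 1) = Q"
  by (cases Q) (simp add: mat_1_eq_mat2)

lemma bqf_act_mult: "bqf_act Q (A ** B) = bqf_act (bqf_act Q A) B"
  by (cases Q, cases A rule: mat2_cases, cases B rule: mat2_cases)
     (simp add: power2_eq_square algebra_simps)

lemma equiv_bqf_equiv:
  assumes D: "D < 0"
  shows "equiv (bqf_set D N) (bqf_equiv D N)"
proof (rule equivI)
  show "bqf_equiv D N \<subseteq> bqf_set D N \<times> bqf_set D N"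
    using bqf_act_in_set[OF _ D] by (auto simp: bqf_equiv_def)
  show "refl_on (bqf_set D N) (bqf_equiv D N)"
  proof (rule refl_onI)
    fix Q assume "Q \<in> bqf_set D N"
    moreover have "\<exists>A\<in>Gamma0 N. Q = bqf_act Q A"
      by (rule bexI[OF _ mat_1_in_Gamma0]) (simp only: bqf_act_1)
    ultimately show "(Q, Q) \<in> bqf_equiv D N" by (simp add: bqf_equiv_def)
  qed
  show "sym (bqf_equiv D N)"
  proof (rule symI)
    fix Q Q' assume "(Q, Q') \<in> bqf_equiv D N"
    then obtain A where A: "Q \<in> bqf_set D N" "A \<in> Gamma0 N" "Q' = bqf_act Q A"
      by (auto simp: bqf_equiv_def)
    have "Q = bqf_act Q' (adj2 A)"
      using A by (simp add: bqf_act_mult[symmetric] adj2_mult det_Gamma0 bqf_act_1)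
    thus "(Q', Q) \<in> bqf_equiv D N"
      using A bqf_act_in_set[OF A(1) D A(2)] adj2_in_Gamma0[OF A(2)] by (auto simp: bqf_equiv_def)
  qed
  show "trans (bqf_equiv D N)"
  proof (rule transI)
    fix Q Q' Q'' assume "(Q, Q') \<in> bqf_equiv D N" "(Q', Q'') \<in> bqf_equiv D N"
    thus "(Q, Q'') \<in> bqf_equiv D N"
      by (auto simp: bqf_equiv_def bqf_act_mult[symmetric] intro: Gamma0_mult)
  qed
qed

lemma class_rep:
  assumes D: "D < 0" and C: "C \<in> bqf_classes D N"
  shows "class_rep C \<in> bqf_set D N" "C = bqf_equiv D N `` {class_rep C}"
proof -
  note eq = equiv_bqf_equiv[OF D, of N]
  obtain Q where Q: "Q \<in> bqf_set D N" "C = bqf_equiv D N `` {Q}"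
    using C by (auto simp: bqf_classes_def elim: quotientE)
  have "Q \<in> C" using Q eq equiv_class_self by fast
  hence "class_rep C \<in> C" unfolding class_rep_def by (rule someI)
  hence rel: "(Q, class_rep C) \<in> bqf_equiv D N" using Q by auto
  from equiv_class_eq[OF eq this] show "C = bqf_equiv D N `` {class_rep C}" using Q(2)
    by (rule trans[rotated])
  show "class_rep C \<in> bqf_set D N" using rel eq by (auto simp: equiv_def refl_on_def bqf_equiv_def)
qed

lemma tau_act:
  assumes D: "D < 0" and Q: "Q \<in> bqf_set D N" and A: "A \<in> Gamma0 N"
  shows "moebius A (tau (bqf_act Q A)) = tau Q"
proof -
  define w where "w = tau (bqf_act Q A)"
  have w: "Im w > 0" "bqf_eval (bqf_act Q A) w 1 = 0"
    using tau_root[OF bqf_act_in_set[OF Q D A] D] by (auto simp: w_def)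
  have "bqf_eval Q (moebius A w) 1 = 0" using w bqf_act_root[of A w Q] A by (simp add: det_Gamma0)
  thus ?thesis using tau_eqI[OF Q] moebius_Gamma0_in_uhp[OF A w(1)] by (simp add: w_def)
qed

lemma stabilizer_form_eq:
  assumes D: "D < 0" and Q: "Q \<in> bqf_set D N"
  shows "{A \<in> Gamma0 N. bqf_act Q A = Q} = fixers N 1 (tau Q)"
proof (intro equalityI subsetI)
  fix A assume A: "A \<in> {A \<in> Gamma0 N. bqf_act Q A = Q}"
  thus "A \<in> fixers N 1 (tau Q)"
    using tau_act[OF D Q, of A] by (simp add: fixers_def Gamma0_eq_hecke)
next
  fix A assume A: "A \<in> fixers N 1 (tau Q)"
  hence AG: "A \<in> Gamma0 N" "moebius A (tau Q) = tau Q" by (auto simp: fixers_def Gamma0_eq_hecke)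
  have "bqf_eval (bqf_act Q A) (tau Q) 1 = 0"
    using bqf_act_root[of A "tau Q" Q] AG tau_root[OF Q D] by (simp add: det_Gamma0)
  hence "bqf_act Q A = Q"
    using bqf_eq_if_same_root[OF bqf_act_in_set[OF Q D AG(1)] Q] tau_root[OF Q D] by blast
  thus "A \<in> {A \<in> Gamma0 N. bqf_act Q A = Q}" using AG by simp
qed

text \<open>
  Stabilisers of equivalent points are conjugate.
\<close>

lemma card_fixers_conj:
  assumes A: "A \<in> Gamma0 p" and z: "Im z > 0"
  shows "card (fixers p 1 (moebius A z)) = card (fixers p 1 z)"
proof -
  have detA: "det A = 1" using A by (rule det_Gamma0)
  have "bij_betw (\<lambda>B. A ** (B ** adj2 A)) (fixers p 1 z) (fixers p 1 (moebius A z))"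
  proof (rule bij_betw_byWitness[where f' = "\<lambda>B. adj2 A ** (B ** A)"])
    have cancel: "adj2 A ** (A ** X) = X" "A ** (adj2 A ** X) = X" for X
      using detA by (simp_all add: matrix_mul_assoc adj2_mult)
    show "\<forall>B\<in>fixers p 1 z. adj2 A ** (A ** (B ** adj2 A) ** A) = B"
      "\<forall>B\<in>fixers p 1 (moebius A z). A ** (adj2 A ** (B ** A) ** adj2 A) = B"
      using detA by (simp_all add: matrix_mul_assoc[symmetric] adj2_mult cancel)
    have adjG: "adj2 A \<in> Gamma0 p" by (rule adj2_in_Gamma0[OF A])
    show "(\<lambda>B. A ** (B ** adj2 A)) ` fixers p 1 z \<subseteq> fixers p 1 (moebius A z)"
    proof safe
      fix B assume B: "B \<in> fixers p 1 z"
      hence BG: "B \<in> Gamma0 p" "moebius B z = z" by (auto simp: fixers_def Gamma0_eq_hecke)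
      have "moebius (A ** (B ** adj2 A)) (moebius A z) = moebius A z"
        using BG adjG moebius_Gamma0_in_uhp[OF A z] z detA
        by (simp add: moebius_mult det_Gamma0 det_mul moebius_adj2)
      thus "A ** (B ** adj2 A) \<in> fixers p 1 (moebius A z)"
        using A BG adjG Gamma0_mult by (simp add: fixers_def Gamma0_eq_hecke[symmetric])
    qed
    show "(\<lambda>B. adj2 A ** (B ** A)) ` fixers p 1 (moebius A z) \<subseteq> fixers p 1 z"
    proof safe
      fix B assume B: "B \<in> fixers p 1 (moebius A z)"
      hence BG: "B \<in> Gamma0 p" "moebius B (moebius A z) = moebius A z"
        by (auto simp: fixers_def Gamma0_eq_hecke)
      have "moebius (adj2 A ** (B ** A)) z = z"
        using BG z detA by (simp add: moebius_mult det_Gamma0 det_mul moebius_adj2)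
      thus "adj2 A ** (B ** A) \<in> fixers p 1 z"
        using A BG adjG Gamma0_mult by (simp add: fixers_def Gamma0_eq_hecke[symmetric])
    qed
  qed
  thus ?thesis by (simp add: bij_betw_same_card)
qed

lemma card_fixers_omega:
  assumes D: "D < 0" and Q: "Q \<in> bqf_set D N"
  shows "card (fixers N 1 (tau Q)) = 2 * omega Q N"
  unfolding omega_def stabilizer_form_eq[OF D Q]
  using tau_root[OF Q D]
proof (intro card_sign_pairs finite_fixers det_nonzero_neq_uminus)
  show "- A \<in> fixers N 1 (tau Q)" if "A \<in> fixers N 1 (tau Q)" for A
    using that by (simp add: fixers_def uminus_in_hecke)
  show "det A \<noteq> 0" if "A \<in> fixers N 1 (tau Q)" for A
    using that by (simp add: fixers_def hecke_def)
qed (use tau_root[OF Q D] in auto)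

definition forms_at :: "nat \<Rightarrow> int \<Rightarrow> complex \<Rightarrow> bqf set" where
  "forms_at p D z = {Q \<in> bqf_set D p. bqf_eval Q z 1 = 0}"

lemma finite_forms_at: "Im z > 0 \<Longrightarrow> finite (forms_at p D z)"
proof (cases "forms_at p D z = {}")
  case False
  then obtain Q where "Q \<in> forms_at p D z" by blast
  moreover assume "Im z > 0"
  ultimately have "forms_at p D z \<subseteq> {Q}"
    unfolding forms_at_def using bqf_eq_if_same_root by blast
  thus ?thesis using finite_subset by blast
qed simp

context cusp_uniformizer
begin

text \<open>
  The contribution of the points with \<open>j = v\<close> to the class number \<open>H(D, p)\<close>.
\<close>

definition class_weight :: "int \<Rightarrow> complex \<Rightarrow> real" where
  "class_weight D v = (\<Sum>C | C \<in> bqf_classes D p \<and> j (tau (class_rep C)) =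
      v. 1 / real (omega (class_rep C) p))"

text \<open>
  Since \<open>j\<close> separates orbits, a class contributes iff it contains a form with root \<open>z\<close>. This form is
  unique, because a matrix that maps one such form to another one fixes the root and the
  discriminant; and the stabiliser of the form is that of its root.
\<close>

lemma class_weight_eq:
  assumes D: "D < 0" and z: "Im z > 0"
  shows "class_weight D (j z) * real (card (fixers p 1 z)) = 2 * real (card (forms_at p D z))"
proof -
  note eq = equiv_bqf_equiv[OF D, of p]
  let ?X = "{C \<in> bqf_classes D p. j (tau (class_rep C)) = j z}"
  have rel: "\<exists>A\<in>Gamma0 p. moebius A z = tau (class_rep C)" if "C \<in> ?X" for C
  proof -
    have "Im (tau (class_rep C)) > 0" using that class_rep[OF D] tau_root[OF _ D] by blast
    hence "Gamma0_rel p z (tau (class_rep C))" using that z by (intro j_injective) auto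
    thus ?thesis by (simp add: Gamma0_rel_def)
  qed
  have om: "2 * omega (class_rep C) p = card (fixers p 1 z)" if C: "C \<in> ?X" for C
  proof -
    obtain A where "A \<in> Gamma0 p" "moebius A z = tau (class_rep C)" using rel[OF C] by blast
    thus ?thesis
      using card_fixers_conj[of A p z] z card_fixers_omega[OF D, of "class_rep C" p] C
        class_rep[OF D]
      by auto
  qed
  have bij: "bij_betw (\<lambda>Q. bqf_equiv D p `` {Q}) (forms_at p D z) ?X"
  proof (rule bij_betw_imageI)
    show "inj_on (\<lambda>Q. bqf_equiv D p `` {Q}) (forms_at p D z)"
      using bqf_eq_if_same_root z by (intro inj_onI) (auto simp: forms_at_def)
    show "(\<lambda>Q. bqf_equiv D p `` {Q}) ` forms_at p D z = ?X"
    proof (intro equalityI subsetI)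
      fix C assume "C \<in> (\<lambda>Q. bqf_equiv D p `` {Q}) ` forms_at p D z"
      then obtain Q where Q: "Q \<in> forms_at p D z" "C = bqf_equiv D p `` {Q}" by blast
      have Q': "Q \<in> bqf_set D p" "bqf_eval Q z 1 = 0" using Q by (auto simp: forms_at_def)
      have C: "C \<in> bqf_classes D p" unfolding bqf_classes_def Q(2) using Q'(1) by (rule quotientI)
      have "bqf_equiv D p `` {Q} = bqf_equiv D p `` {class_rep C}"
        using class_rep(2)[OF D C] Q(2) by simp
      hence "(Q, class_rep C) \<in> bqf_equiv D p"
        using eq_equiv_class[OF _ eq] class_rep(1)[OF D C] by blast
      then obtain A where A: "A \<in> Gamma0 p" "class_rep C = bqf_act Q A"
        by (auto simp: bqf_equiv_def)
      have "moebius A (tau (class_rep C)) = z"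
        using tau_act[OF D Q'(1) A(1)] tau_eqI[OF Q'(1) z Q'(2)] A by simp
      moreover have "Im (tau (class_rep C)) > 0" using tau_root[OF class_rep(1)[OF D C] D] by simp
      ultimately have "j (tau (class_rep C)) = j z" using inv_j[OF A(1)] by metis
      thus "C \<in> ?X" using C by simp
    next
      fix C assume C: "C \<in> ?X"
      obtain A where A: "A \<in> Gamma0 p" "moebius A z = tau (class_rep C)" using rel[OF C] by blast
      have rep: "class_rep C \<in> bqf_set D p" "C = bqf_equiv D p `` {class_rep C}"
        using class_rep[OF D] C by auto
      define Q where "Q = bqf_act (class_rep C) A"
      have "bqf_eval Q z 1 = 0"
        using bqf_act_root[of A z "class_rep C"] A z tau_root[OF rep(1) D]
        by (simp add: Q_def det_Gamma0)
      moreover have QS: "Q \<in> bqf_set D p" unfolding Q_def by (rule bqf_act_in_set[OF rep(1) D A(1)])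
      moreover have "(class_rep C, Q) \<in> bqf_equiv D p" using rep(1) A(1)
        by (auto simp: bqf_equiv_def Q_def)
      hence "C = bqf_equiv D p `` {Q}" using rep(2) equiv_class_eq[OF eq] by metis
      ultimately show "C \<in> (\<lambda>Q. bqf_equiv D p `` {Q}) ` forms_at p D z" by (auto simp: forms_at_def)
    qed
  qed
  have "class_weight D (j z) = (\<Sum>C\<in>?X. 2 / real (card (fixers p 1 z)))"
    unfolding class_weight_def
  proof (rule sum.cong)
    fix C assume "C \<in> ?X"
    hence "real (card (fixers p 1 z)) = 2 * real (omega (class_rep C) p)" using om[symmetric]
      by simp
    thus "1 / real (omega (class_rep C) p) = 2 / real (card (fixers p 1 z))" by simp
  qed auto
  also have "\<dots> = real (card (forms_at p D z)) * (2 / real (card (fixers p 1 z)))"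
    using bij_betw_same_card[OF bij] by simp
  moreover have "card (fixers p 1 z) > 0" using card_pos_fixers(2)[of 1 z p] z by simp
  ultimately show ?thesis by simp
qed

end

definition trace_range :: "nat \<Rightarrow> int set" where
  "trace_range n = {r. \<bar>real_of_int r\<bar> < 2 * sqrt (real n)}"

lemma trace_range_iff: "r \<in> trace_range n \<longleftrightarrow> r\<^sup>2 - 4 * int n < 0"
proof -
  have "r \<in> trace_range n \<longleftrightarrow> \<bar>real_of_int r\<bar> < sqrt (4 * real n)"
    by (simp add: trace_range_def real_sqrt_mult)
  also have "\<dots> \<longleftrightarrow> \<bar>real_of_int r\<bar>\<^sup>2 < 4 * real n"
    by (metis abs_ge_zero real_sqrt_abs real_sqrt_less_iff abs_idempotent power2_abs)
  also have "\<dots> \<longleftrightarrow> real_of_int (r\<^sup>2) < real_of_int (4 * int n)" by simp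
  also have "\<dots> \<longleftrightarrow> r\<^sup>2 - 4 * int n < 0" by (simp only: of_int_less_iff) linarith
  finally show ?thesis .
qed

lemma finite_trace_range: "finite (trace_range n)"
  by (rule finite_subset[OF _ finite_int_abs_le[of "2 * sqrt (real n)"]])
    (auto simp: trace_range_def)

text \<open>
  The equation \<open>(az + b)/(cz + d) = z\<close> means \<open>cz\<^sup>2 + (d - a)z - b = 0\<close>, and the discriminant of this
  form is \<open>(a + d)\<^sup>2 - 4(ad - bc)\<close>. Conversely, the trace and the form determine the matrix, and the
  parity of the middle coefficient is that of the trace.
\<close>

lemma card_pos_fixers_forms:
  assumes n: "n > 0" and z: "Im z > 0"
  shows "card (pos_fixers p (int n) z) = (\<Sum>r\<in>trace_range n. card (forms_at p (r\<^sup>2 - 4 * int n) z))"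
proof -
  have root: "moebius (mat2 a b c d) z = z \<longleftrightarrow> bqf_eval (c, d - a, - b) z 1 = 0"
    if "a * d - b * c = int n" for a b c d
  proof -
    have "of_int c * z + of_int d \<noteq> 0"
      using moebius_denom_nonzero[of "mat2 a b c d" z] that n z by simp
    thus ?thesis by (simp add: moebius_mat2 field_simps power2_eq_square) (auto simp: algebra_simps)
  qed
  let ?f = "\<lambda>N :: int^2^2. (N $ 1 $ 1 + N $ 2 $ 2, (N $ 2 $ 1, N $ 2 $ 2 - N $ 1 $ 1, -
      (N $ 1 $ 2)))"
  have "bij_betw ?f
     (pos_fixers p (int n) z) (SIGMA r:trace_range n. forms_at p (r\<^sup>2 - 4 * int n) z)"
  proof (rule bij_betw_imageI)
    show "inj_on ?f (pos_fixers p (int n) z)"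
      by (rule inj_onI) (auto simp: vec_eq_iff forall_2)
    show "?f ` pos_fixers p (int n) z
         = (SIGMA r:trace_range n. forms_at p (r\<^sup>2 - 4 * int n) z)"
    proof (intro equalityI subsetI)
      fix x assume "x \<in> ?f ` pos_fixers p (int n) z"
      then obtain N where N: "N \<in> pos_fixers p (int n) z"
        "x = ?f N" by blast
      obtain a b c d where N_eq: "N = mat2 a b c d" by (rule mat2_cases)
      have abcd: "a * d - b * c = int n" "int p dvd c" "c > 0" "bqf_eval (c, d - a, - b) z 1 = 0"
        using N(1) root by (auto simp: pos_fixers_def fixers_def N_eq)
      have disc: "(d - a)\<^sup>2 - 4 * c * (- b) = (a + d)\<^sup>2 - 4 * int n"
        using abcd(1) by (simp add: power2_eq_square algebra_simps)
      have "real_of_int ((a + d)\<^sup>2 - 4 * int n) < 0"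
        using bqf_disc_root[OF z abcd(4)] abcd(3) z unfolding disc by simp
      hence "(a + d)\<^sup>2 - 4 * int n < 0" by (simp only: of_int_less_0_iff)
      thus "x \<in> (SIGMA r:trace_range n. forms_at p (r\<^sup>2 - 4 * int n) z)"
        using abcd disc
        by (auto simp: N(2) N_eq trace_range_iff forms_at_def bqf_set_def simp del: bqf_eval.simps)
    next
      fix x assume "x \<in> (SIGMA r:trace_range n. forms_at p (r\<^sup>2 - 4 * int n) z)"
      then obtain r A B C where x: "x = (r, (A, B, C))" "(A, B, C) \<in> forms_at p (r\<^sup>2 - 4 * int n) z"
        by auto
      hence ABC: "A > 0" "B\<^sup>2 - 4 * A * C = r\<^sup>2 - 4 * int n" "int p dvd A"
        "bqf_eval (A, B, C) z 1 = 0"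
        by (auto simp: forms_at_def bqf_set_def simp del: bqf_eval.simps)
      have "B\<^sup>2 - r\<^sup>2 = 2 * (2 * (A * C) - 2 * int n)" using ABC(2) by (simp add: algebra_simps)
      hence "even (B\<^sup>2 - r\<^sup>2)" by simp
      hence "even (r - B)" by simp
      then obtain a where a: "r - B = 2 * a" by (elim evenE)
      define d where "d = a + B"
      have r: "r = a + d" "B = d - a" using a by (auto simp: d_def)
      have "4 * (a * d - (- C) * A) = 4 * int n" using ABC(2)
        by (simp add: r power2_eq_square algebra_simps)
      hence det: "a * d - (- C) * A = int n" by simp
      have "mat2 a (- C) A d \<in> pos_fixers p (int n) z"
        using det ABC root[OF det] by (simp add: pos_fixers_def fixers_def r del: bqf_eval.simps)
      moreover have "x = (a + d, A, d - a, - (- C))" by (simp add: x r)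
      ultimately show "x \<in> ?f ` pos_fixers p (int n) z"
        by (intro image_eqI[of _ _ "mat2 a (- C) A d"]) simp_all
    qed
  qed
  hence "card (pos_fixers p (int n) z) =
      card (SIGMA r:trace_range n. forms_at p (r\<^sup>2 - 4 * int n) z)"
    by (rule bij_betw_same_card)
  also have "\<dots> = (\<Sum>r\<in>trace_range n. card (forms_at p (r\<^sup>2 - 4 * int n) z))"
    by (rule card_SigmaI) (use finite_trace_range finite_forms_at[OF z] in auto)
  finally show ?thesis .
qed

text \<open>
  By reduction, each class contains a form whose root lies in the strip or in its image under the
  Fricke involution. In the strip, the discriminant and the lower bound for the imaginary part
  bound the leading coefficient, and the real part of the root then bounds the middle one. The
  other forms are mapped to such forms by the Fricke involution.
\<close>

lemma finite_bqf_classes: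
  assumes p: "prime p" and D: "D < 0"
  shows "finite (bqf_classes D p)"
proof -
  have p0: "p > 0" using p by (rule prime_gt_0_nat)
  define \<delta> where "\<delta> = 1 / (2 * real p)"
  have \<delta>: "\<delta> > 0" using p0 by (simp add: \<delta>_def)
  define X where "X = {Q \<in> bqf_set D p. tau Q \<in> strip \<delta>}"
  define Y where "Y = {Q \<in> bqf_set D p. \<exists>s\<in>strip \<delta>. tau Q = moebius (fricke p) s}"
  define K where "K = {k::int. \<bar>of_int k\<bar> \<le> sqrt (- of_int D) / \<delta>}"
  have finK: "finite K" unfolding K_def by (rule finite_int_abs_le)
  have finX: "finite X"
  proof (rule inj_on_finite)
    show "inj_on (\<lambda>(a, b, c). (a, b)) X"
    proof (rule inj_onI)
      fix Q Q' assume Q: "Q \<in> X" "Q' \<in> X" "(\<lambda>(a, b, c). (a, b)) Q = (\<lambda>(a, b, c). (a, b)) Q'"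
      obtain a b c c' where eq: "Q = (a, b, c)" "Q' = (a, b, c')" using Q(3)
        by (cases Q, cases Q') auto
      have "a > 0" "4 * a * c = 4 * a * c'" using Q by (auto simp: eq X_def bqf_set_def)
      thus "Q = Q'" by (simp add: eq)
    qed
    show "(\<lambda>(a, b, c). (a, b)) ` X \<subseteq> K \<times> K"
    proof safe
      fix a b c assume Q: "(a, b, c) \<in> X"
      define z where "z = tau (a, b, c)"
      have z: "Im z > 0" "bqf_eval (a, b, c) z 1 = 0" using tau_root[OF _ D] Q
        by (auto simp: X_def z_def)
      have strip: "Im z \<ge> \<delta>" "\<bar>Re z\<bar> \<le> 1 / 2" and a: "a > 0" and disc: "b\<^sup>2 - 4 * a * c = D"
        using Q by (auto simp: X_def z_def strip_def bqf_set_def)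
      have "- of_int D = (2 * of_int a * Im z)\<^sup>2" using bqf_disc_root[OF z] disc by simp
      hence "sqrt (- of_int D) = 2 * of_int a * Im z" using a z by simp
      hence "2 * of_int a * \<delta> \<le> sqrt (- of_int D)" using strip a by (simp add: mult_left_mono)
      hence a2: "2 * of_int a \<le> sqrt (- of_int D) / \<delta>" using \<delta> by (simp add: field_simps)
      thus "a \<in> K" using a by (simp add: K_def)
      have "\<bar>of_int b\<bar> = 2 * of_int a * \<bar>Re z\<bar>"
        using z a by (simp only: bqf_eval_root_iff) (simp add: abs_mult)
      also have "\<dots> \<le> 2 * of_int a * (1 / 2)" using strip a by (intro mult_left_mono) auto
      finally show "b \<in> K" using a2 a by (simp add: K_def)
    qed
  qed (use finK in simp)
  have finY: "finite Y"
  proof (rule inj_on_finite[OF _ _ finX])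
    let ?f = "\<lambda>(a, b, c). (int p * c, - b, a div int p)"
    show "inj_on ?f Y"
      using p0 by (auto simp: inj_on_def Y_def bqf_set_def elim!: dvdE)
    show "?f ` Y \<subseteq> X"
    proof safe
      fix a b c assume Q: "(a, b, c) \<in> Y"
      then obtain s where s: "s \<in> strip \<delta>" "tau (a, b, c) = moebius (fricke p) s"
        by (auto simp: Y_def)
      have Qs: "(a, b, c) \<in> bqf_set D p" using Q by (simp add: Y_def)
      obtain a' where a': "a = int p * a'" using Qs by (auto simp: bqf_set_def)
      have s0: "Im s > 0" using s(1) \<delta> by (auto simp: strip_def)
      hence "s \<noteq> 0" by auto
      have a: "a > 0" and disc: "b\<^sup>2 - 4 * a * c = D" using Qs by (auto simp: bqf_set_def)
      have "c > 0"
      proof -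
        have "4 * a * c > 0" using disc D by (smt (verit) zero_le_power2)
        thus ?thesis using a by (simp add: zero_less_mult_iff)
      qed
      have "bqf_eval (a, b, c) (moebius (fricke p) s) 1 = 0" using tau_root[OF Qs D] s by simp
      hence "bqf_eval (int p * c, - b, a') s 1 = 0"
        using \<open>s \<noteq> 0\<close> p0 by (simp add: moebius_fricke a' field_simps power2_eq_square)
      moreover have "(int p * c, - b, a') \<in> bqf_set D p"
        using \<open>c > 0\<close> p0 disc by (simp add: bqf_set_def a' algebra_simps)
      ultimately have "tau (int p * c, - b, a') = s" using tau_eqI s0 by blast
      thus "(int p * c, - b, a div int p) \<in> X"
        using \<open>(int p * c, - b, a') \<in> bqf_set D p\<close> s(1) p0 by (simp add: X_def a')
    qed
  qed
  have "bqf_classes D p \<subseteq> (\<lambda>Q. bqf_equiv D p `` {Q}) ` (X \<union> Y)"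
  proof
    fix C assume C: "C \<in> bqf_classes D p"
    have rep: "class_rep C \<in> bqf_set D p" "C = bqf_equiv D p `` {class_rep C}"
      using class_rep[OF D C] .
    define w where "w = tau (class_rep C)"
    have w: "Im w > 0" using tau_root[OF rep(1) D] by (simp add: w_def)
    obtain s where s: "s \<in> strip \<delta>" "Gamma0_rel p w s \<or> Gamma0_rel p w (moebius (fricke p) s)"
      using Gamma0_reduction[OF p w] unfolding \<delta>_def by blast
    then obtain v where v: "v = s \<or> v = moebius (fricke p) s" "Gamma0_rel p w v" by blast
    have "Im v > 0" using Gamma0_rel_in_uhp[OF w v(2)] .
    obtain A where A: "A \<in> Gamma0 p" "moebius A v = w"
      using Gamma0_rel_sym[OF w v(2)] by (auto simp: Gamma0_rel_def)
    define Q where "Q = bqf_act (class_rep C) A"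
    have Q: "Q \<in> bqf_set D p" unfolding Q_def by (rule bqf_act_in_set[OF rep(1) D A(1)])
    have "bqf_eval Q v 1 = 0"
      using bqf_act_root[of A v "class_rep C"] A \<open>Im v > 0\<close> tau_root[OF rep(1) D]
      by (simp add: Q_def det_Gamma0 w_def)
    hence "tau Q = v" using tau_eqI[OF Q \<open>Im v > 0\<close>] by blast
    hence "Q \<in> X \<union> Y" using v(1) s(1) Q by (auto simp: X_def Y_def)
    moreover have "(class_rep C, Q) \<in> bqf_equiv D p" using rep(1) A(1)
      by (auto simp: bqf_equiv_def Q_def)
    hence "C = bqf_equiv D p `` {Q}" using rep(2) equiv_class_eq[OF equiv_bqf_equiv[OF D]] by metis
    ultimately show "C \<in> (\<lambda>Q. bqf_equiv D p `` {Q}) ` (X \<union> Y)" by blast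
  qed
  thus ?thesis by (rule finite_subset) (use finX finY in auto)
qed

context cusp_uniformizer
begin

lemma sum_class_weight:
  assumes n: "n > 0" and z: "Im z > 0"
  shows "(\<Sum>r\<in>trace_range n. class_weight (r\<^sup>2 - 4 * int n) (j z)) * real (card (fixers p 1 z)) =
      2 * real (card (pos_fixers p (int n) z))"
proof -
  have "(\<Sum>r\<in>trace_range n. class_weight (r\<^sup>2 - 4 * int n) (j z)) * real (card (fixers p 1 z)) =
        (\<Sum>r\<in>trace_range n. 2 * real (card (forms_at p (r\<^sup>2 - 4 * int n) z)))"
    unfolding sum_distrib_right using z
    by (intro sum.cong refl class_weight_eq) (auto simp: trace_range_iff)
  thus ?thesis by (simp add: card_pos_fixers_forms[OF n z] sum_distrib_left)
qed

text \<open>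
  The number of factors \<open>j(\<tau>) - j(M\<tau>)\<close> that vanish at \<open>z\<close>, in terms of forms: both sides are
  multiplied by the order of the stabiliser of \<open>z\<close>, and then count matrices that fix \<open>z\<close>.
\<close>

theorem coincidences_eq_class_weights:
  assumes n: "n > 0" "coprime n p" and z: "Im z > 0"
  shows "real (card {M\<in>hecke_reps n. \<not> scalar_class p M \<and> j (moebius M z) = j z}) =
     (\<Sum>r\<in>trace_range n. class_weight (r\<^sup>2 - 4 * int n) (j z)) -
     (if is_square n then \<Sum>r\<in>trace_range 1. class_weight (r\<^sup>2 - 4) (j z) else 0)"
    (is "?k = ?S - ?T")
proof -
  let ?e = "card (fixers p 1 z)"
  have e: "?e > 0" using card_pos_fixers(2)[of 1 z p] z by simp
  have fin: "finite (pos_fixers p (int n) z)" using finite_pos_fixers n z by simp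
  have "card (pos_fixers p (int n) z) = card {N \<in> pos_fixers p (int n) z. scalar_class p N} +
           card {N \<in> pos_fixers p (int n) z. \<not> scalar_class p N}"
    using fin by (subst card_Un_disjoint[symmetric]) (auto intro: arg_cong[where f = card])
  hence "real (card {N \<in> pos_fixers p (int n) z. \<not> scalar_class p N}) =
     real (card (pos_fixers p (int n) z)) - (if is_square n then real (card (pos_fixers p 1 z)) else
       0)"
    using card_scalar_pos_fixers[OF n(1) z, of p] by simp
  moreover have "?k * ?e = 2 * real (card {N \<in> pos_fixers p (int n) z. \<not> scalar_class p N})"
    using card_coincidences[OF n z] card_pos_fixers(1)[of "int n" z p] n z
    by (simp flip: of_nat_mult)
  moreover have "?S * real ?e = 2 * real (card (pos_fixers p (int n) z))"
    by (rule sum_class_weight[OF n(1) z])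
  moreover have "?T * ?e = (if is_square n then 2 * real (card (pos_fixers p 1 z)) else 0)"
    using sum_class_weight[of 1, OF _ z] by simp
  ultimately have "?k * ?e = (?S - ?T) * ?e" by (simp add: left_diff_distrib split: if_splits)
  thus ?thesis using e by simp
qed

end


section \<open>The product near the cusps\<close>

definition unity_root :: "nat \<Rightarrow> nat \<Rightarrow> complex" where
  "unity_root d b = cis (2 * pi * real b / real d)"

lemma unity_root_nonzero [simp]: "unity_root d b \<noteq> 0"
  by (simp add: unity_root_def)

lemma unity_root_neq_1:
  assumes "0 < b" "b < d"
  shows "unity_root d b \<noteq> 1"
proof
  assume "unity_root d b = 1"
  hence "unity_root d b = unity_root d 0" by (simp add: unity_root_def)
  moreover have "inj_on (unity_root d) {..<d}"
    using Complex.bij_betw_roots_unity[of d] assms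
    by (auto simp: bij_betw_def unity_root_def[abs_def])
  ultimately have "b = 0" using assms by (auto dest: inj_onD)
  thus False using assms by simp
qed

text \<open>
  This is the factorisation of \<open>z\<^sup>d - 1\<close>, evaluated at \<open>1/x\<close>.
\<close>

lemma prod_roots_unity:
  fixes x :: complex
  assumes d: "d > 0"
  shows "(\<Prod>z | z ^ d = 1. 1 - z * x) = 1 - x ^ d"
proof (cases "x = 0")
  case False
  define P :: "complex poly" where "P = Polynomial.monom 1 d + [:- 1:]"
  have poly_P: "poly P z = z ^ d - 1" for z by (simp add: P_def poly_monom)
  have lc: "lead_coeff P = 1" and deg: "Polynomial.degree P = d"
  proof -
    have "Polynomial.degree P = d"
      unfolding P_def using d by (subst degree_add_eq_left) (auto simp: degree_monom_eq)
    thus "Polynomial.degree P = d" "lead_coeff P = 1"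
      using d by (auto simp: P_def coeff_pCons split: nat.split)
  qed
  have "rsquarefree P"
    unfolding rsquarefree_roots
  proof (intro allI notI)
    fix z assume z: "poly P z = 0 \<and> poly (pderiv P) z = 0"
    hence "z ^ d = 1" by (simp add: poly_P)
    hence "z \<noteq> 0" using d by (auto simp: power_0_left)
    moreover have "poly (pderiv P) z = of_nat d * z ^ (d - 1)"
      by (simp add: P_def pderiv_add pderiv_monom poly_monom pderiv_pCons)
    ultimately show False using z d by simp
  qed
  hence "P = (\<Prod>z | poly P z = 0. [:- z, 1:])"
    using complex_poly_decompose_rsquarefree[of P] lc by simp
  hence "poly P (inverse x) = (\<Prod>z | poly P z = 0. inverse x - z)"
    using poly_prod[of "\<lambda>z. [:- z, 1:]" "{z. poly P z = 0}" "inverse x"] by simp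
  hence "inverse x ^ d - 1 = (\<Prod>z | z ^ d = 1. inverse x - z)" by (simp add: poly_P)
  moreover have "(\<Prod>z | z ^ d = 1. 1 - z * x) = (\<Prod>z | z ^ d = 1. x * (inverse x - z))"
    using False by (intro prod.cong) (auto simp: algebra_simps)
  moreover have "card {z::complex. z ^ d = 1} = d" using card_roots_unity_eq[OF d] .
  ultimately have "(\<Prod>z | z ^ d = 1. 1 - z * x) = x ^ d * (inverse x ^ d - 1)"
    by (simp add: prod.distrib)
  thus ?thesis using False by (simp add: algebra_simps power_inverse)
qed (use d in \<open>simp add: power_0_left\<close>)

lemma prod_unity_roots:
  assumes d: "d > 0"
  shows "(\<Prod>b<d. 1 - unity_root d b * x) = 1 - x ^ d"
    and "(\<Prod>b<d. 1 - inverse (unity_root d b) * x) = 1 - x ^ d"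
proof -
  have bij: "bij_betw (unity_root d) {..<d} {z. z ^ d = 1}"
    using Complex.bij_betw_roots_unity[OF d] by (simp add: unity_root_def[abs_def])
  have "(\<Prod>b<d. 1 - unity_root d b * x) = (\<Prod>z | z ^ d = 1. 1 - z * x)"
    using prod.reindex_bij_betw[OF bij] .
  thus "(\<Prod>b<d. 1 - unity_root d b * x) = 1 - x ^ d" using prod_roots_unity[OF d] by simp
  have bij': "bij_betw inverse {z::complex. z ^ d = 1} {z. z ^ d = 1}"
    by (rule bij_betw_byWitness[where f' = inverse]) (auto simp: power_inverse)
  have "(\<Prod>b<d. 1 - inverse (unity_root d b) * x) = (\<Prod>z | z ^ d = 1. 1 - inverse z * x)"
    using prod.reindex_bij_betw[OF bij, of "\<lambda>z. 1 - inverse z * x"] .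
  also have "\<dots> = (\<Prod>z | z ^ d = 1. 1 - z * x)"
    using prod.reindex_bij_betw[OF bij', of "\<lambda>z. 1 - z * x"] .
  finally show "(\<Prod>b<d. 1 - inverse (unity_root d b) * x) = 1 - x ^ d" using prod_roots_unity[OF d]
    by simp
qed

text \<open>
  The power \<open>q\<^sup>\<alpha>\<close> of the nome with a real exponent, with the branch that is holomorphic on the upper
  half plane.
\<close>

definition qpow :: "real \<Rightarrow> complex \<Rightarrow> complex" where
  "qpow \<alpha> w = exp (2 * of_real pi * \<i> * of_real \<alpha> * w)"

lemma qpow_nonzero [simp]: "qpow \<alpha> w \<noteq> 0"
  by (simp add: qpow_def)

lemma qpow_1: "qpow 1 w = nome w"
  by (simp add: qpow_def nome_def)

lemma qpow_diff: "qpow (\<alpha> - \<beta>) w = qpow \<alpha> w / qpow \<beta> w"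
  by (simp add: qpow_def exp_diff[symmetric] algebra_simps)

lemma qpow_power: "qpow \<alpha> w ^ k = qpow (real k * \<alpha>) w"
  by (simp add: qpow_def exp_of_nat_mult[symmetric] algebra_simps)

lemma qpow_of_nat: "qpow (real k) w = nome w ^ k"
  using qpow_power[of 1 w k] by (simp add: qpow_1)

lemma norm_qpow: "cmod (qpow \<alpha> w) = exp (- 2 * pi * \<alpha> * Im w)"
  by (simp add: qpow_def)

lemma tendsto_qpow:
  assumes "\<alpha> > 0"
  shows "(qpow \<alpha> \<longlongrightarrow> 0) at_ioo"
proof -
  have "filterlim (\<lambda>w. cmod (qpow \<alpha> w)) (nhds 0) at_ioo"
    unfolding norm_qpow at_ioo_def
    by (rule filterlim_compose[OF _ filterlim_filtercomap]) (use assms in real_asymp)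
  thus ?thesis by (simp add: tendsto_norm_zero_iff)
qed

lemma tendsto_nome: "(nome \<longlongrightarrow> 0) at_ioo"
  using tendsto_qpow[of 1] by (simp add: qpow_1[abs_def])

lemma nome_hecke_rep:
  "nome (moebius (hecke_rep n d b) w) = unity_root d b * qpow (real (n div d) / real d) w"
proof -
  have "moebius (hecke_rep n d b) w = of_nat b / of_nat d + of_real (real (n div d) / real d) * w"
    by (simp add: hecke_rep_def moebius_mat2 add_divide_distrib)
  hence "nome (moebius (hecke_rep n d b) w) =
      exp (2 * of_real pi * \<i> * (of_nat b / of_nat d) + 2 * of_real pi * \<i> * of_real
        (real (n div d) / real d) * w)"
    by (simp only: nome_def) (simp only: algebra_simps)
  also have "\<dots> = exp (2 * of_real pi * \<i> * (of_nat b / of_nat d)) * qpow (real (n div d) / real d)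
      w"
    by (simp only: exp_add qpow_def)
  also have "exp (2 * of_real pi * \<i> * (of_nat b / of_nat d)) = unity_root d b"
    by (simp add: unity_root_def cis_conv_exp algebra_simps)
  finally show ?thesis .
qed

lemma hecke_rep_in_uhp:
  assumes "n > 0" "d dvd n" "Im w > 0"
  shows "Im (moebius (hecke_rep n d b) w) > 0"
proof -
  have "n div d > 0" "d > 0" using assms by (auto elim!: dvdE)
  thus ?thesis using assms(3) by (intro moebius_in_uhp) (auto simp: hecke_rep_def)
qed

lemma scalar_class_hecke_rep:
  assumes n: "n > 0" and d: "d dvd n" "b < d"
  shows "scalar_class p (hecke_rep n d b) \<longleftrightarrow> n div d = d \<and> b = 0"
proof -
  have R: "hecke_rep n d b \<in> hecke_reps n" using d by (force simp: hecke_reps_def)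
  have "(\<exists>k. n = k\<^sup>2 \<and> hecke_rep n d b = hecke_rep n k 0) \<longleftrightarrow> n = d\<^sup>2 \<and> b = 0"
    by (auto simp: hecke_rep_def)
  also have "n = d\<^sup>2 \<longleftrightarrow> n div d = d"
    using d n by (auto simp: power2_eq_square elim!: dvdE)
  finally show ?thesis using scalar_class_rep[OF n R] by simp
qed

text \<open>
  For fixed \<open>d\<close>, only the product over \<open>b\<close> is invariant under translations and has an expansion in
  integral powers of the nome.
\<close>

definition hecke_block :: "nat \<Rightarrow> (complex \<Rightarrow> complex) \<Rightarrow> nat \<Rightarrow> nat \<Rightarrow> complex \<Rightarrow> complex" where
  "hecke_block p f n d w = (\<Prod>b<d. hecke_factor p f (hecke_rep n d b) w)"

lemma hecke_prod_blocks:
  assumes "n > 0"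
  shows "hecke_prod p f n w = (\<Prod>d | d dvd n. hecke_block p f n d w)"
proof -
  have "hecke_prod p f n w = (\<Prod>(d, b)\<in>(SIGMA d:{d. d dvd n}. {..<d}).
      hecke_factor p f (hecke_rep n d b) w)"
    unfolding hecke_prod_def hecke_reps_def
    by (subst prod.reindex[OF inj_hecke_rep]) (auto intro!: prod.cong)
  thus ?thesis using assms by (simp add: hecke_block_def prod.Sigma)
qed

text \<open>
  The expansion \<open>u = 1 + s q + o(q)\<close> at the cusp \<open>\<infinity>\<close>.
\<close>

definition has_jet :: "(complex \<Rightarrow> complex) \<Rightarrow> complex \<Rightarrow> bool" where
  "has_jet u s \<longleftrightarrow> ((\<lambda>w. (u w - 1) / nome w) \<longlongrightarrow> s) at_ioo"

lemma has_jet_tendsto: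
  assumes "has_jet u s"
  shows "(u \<longlongrightarrow> 1) at_ioo"
proof -
  have "((\<lambda>w. (u w - 1) / nome w * nome w + 1) \<longlongrightarrow> s * 0 + 1) at_ioo"
    using assms unfolding has_jet_def by (intro tendsto_intros tendsto_nome)
  thus ?thesis by simp
qed

lemma has_jet_mult:
  assumes "has_jet u s" "has_jet v t"
  shows "has_jet (\<lambda>w. u w * v w) (s + t)"
proof -
  have "((\<lambda>w. (u w - 1) / nome w * v w + (v w - 1) / nome w) \<longlongrightarrow> s * 1 + t) at_ioo"
    using assms has_jet_tendsto[OF assms(2)] unfolding has_jet_def by (intro tendsto_intros)
  moreover have "(u w - 1) / nome w * v w + (v w - 1) / nome w = (u w * v w - 1) / nome w" for w
    by (simp add: field_simps)
  ultimately show ?thesis by (simp add: has_jet_def)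
qed

lemma has_jet_1: "has_jet (\<lambda>w. 1) 0"
  by (simp add: has_jet_def)

lemma has_jet_prod:
  assumes "\<And>x. x \<in> A \<Longrightarrow> has_jet (u x) (s x)"
  shows "has_jet (\<lambda>w. \<Prod>x\<in>A. u x w) (\<Sum>x\<in>A. s x)"
  using assms by (induction A rule: infinite_finite_induct) (auto intro: has_jet_1 has_jet_mult)

lemma has_jet_power: "has_jet u s \<Longrightarrow> has_jet (\<lambda>w. u w ^ k) (of_nat k * s)"
  using has_jet_prod[of "{..<k}" "\<lambda>_. u" "\<lambda>_. s"] by simp

lemma has_jet_cong:
  assumes "eventually (\<lambda>w. u w = v w) at_ioo" "has_jet u s"
  shows "has_jet v s"
  using assms(2) unfolding has_jet_def
  by (rule Lim_transform_eventually) (use assms(1) in \<open>auto elim: eventually_mono\<close>)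

text \<open>
  Single factors of a block involve fractional powers of \<open>q\<close> and have no jet. But their main parts
  can be multiplied exactly, and the remaining parts are of order \<open>o(q)\<close>.
\<close>

lemma has_jet_prod_perturb:
  assumes fin: "finite B" and u: "\<And>b. b \<in> B \<Longrightarrow> (u b \<longlongrightarrow> 1) at_ioo"
    and e: "\<And>b. b \<in> B \<Longrightarrow> ((\<lambda>w. e b w / nome w) \<longlongrightarrow> 0) at_ioo"
    and main: "has_jet (\<lambda>w. \<Prod>b\<in>B. u b w) s"
  shows "has_jet (\<lambda>w. \<Prod>b\<in>B. u b w + e b w) s"
proof -
  have e0: "(e b \<longlongrightarrow> 0) at_ioo" if "b \<in> B" for b
  proof -
    have "((\<lambda>w. e b w / nome w * nome w) \<longlongrightarrow> 0 * 0) at_ioo"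
      by (intro tendsto_mult e that tendsto_nome)
    thus ?thesis by simp
  qed
  have "((\<lambda>w. ((\<Prod>b\<in>B. u b w + e b w) - (\<Prod>b\<in>B. u b w)) / nome w) \<longlongrightarrow> 0) at_ioo"
    using fin u e e0
  proof (induction B)
    case (insert b B)
    have "((\<lambda>w. \<Prod>b\<in>B. u b w + e b w) \<longlongrightarrow> (\<Prod>b\<in>B. 1 + 0)) at_ioo"
      using insert.prems by (intro tendsto_prod tendsto_add) auto
    hence P: "((\<lambda>w. \<Prod>b\<in>B. u b w + e b w) \<longlongrightarrow> 1) at_ioo" by simp
    have "((\<lambda>w. u b w * (((\<Prod>b\<in>B. u b w + e b w) - (\<Prod>b\<in>B. u b w)) / nome w) +
        e b w / nome w * (\<Prod>b\<in>B. u b w + e b w)) \<longlongrightarrow> 1 * 0 + 0 * 1) at_ioo"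
      using insert.prems by (intro tendsto_add tendsto_mult insert.IH P) auto
    moreover have "u b w * (((\<Prod>b\<in>B. u b w + e b w) - (\<Prod>b\<in>B. u b w)) / nome w) +
        e b w / nome w * (\<Prod>b\<in>B. u b w + e b w) =
        ((\<Prod>b\<in>insert b B. u b w + e b w) - (\<Prod>b\<in>insert b B. u b w)) / nome w" for w
      using insert.hyps by (simp add: field_simps)
    ultimately show ?case by simp
  qed simp
  hence "((\<lambda>w. ((\<Prod>b\<in>B. u b w + e b w) - (\<Prod>b\<in>B. u b w)) / nome w + ((\<Prod>b\<in>B. u b w) - 1) / nome w) \<longlongrightarrow>
      0 + s) at_ioo"
    using main unfolding has_jet_def by (intro tendsto_add)
  moreover have "((\<Prod>b\<in>B. u b w + e b w) - (\<Prod>b\<in>B. u b w)) / nome w + ((\<Prod>b\<in>B. u b w) - 1) / nome w =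
      ((\<Prod>b\<in>B. u b w + e b w) - 1) / nome w" for w
    by (simp add: diff_divide_distrib)
  ultimately show ?thesis by (simp add: has_jet_def)
qed

lemma has_jet_one_minus_nome_power:
  assumes "k > 0"
  shows "has_jet (\<lambda>w. 1 - nome w ^ k) (if k = 1 then - 1 else 0)"
proof -
  obtain m where k: "k = Suc m" using assms by (cases k) auto
  have "((\<lambda>w. - (nome w ^ m)) \<longlongrightarrow> - (0 ^ m)) at_ioo" by (intro tendsto_intros tendsto_nome)
  moreover have "(1 - nome w ^ k - 1) / nome w = - (nome w ^ m)" for w by (simp add: k)
  ultimately show ?thesis unfolding has_jet_def k by (cases m) simp_all
qed

text \<open>
  Pole order at \<open>\<infinity>\<close>, zero order at \<open>0\<close>, and the negative of the second coefficient at \<open>\<infinity>\<close>, for the block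
  of \<open>d\<close>. In the block with \<open>n/d = d\<close>, the factor of the scalar class is missing.
\<close>

definition block_pole :: "nat \<Rightarrow> nat \<Rightarrow> nat" where
  "block_pole n d = (if n div d = d then d - 1 else max d (n div d))"

definition block_zero :: "nat \<Rightarrow> nat \<Rightarrow> nat" where
  "block_zero n d = (if n div d = d then d - 1 else min d (n div d))"

definition block_jet :: "nat \<Rightarrow> nat \<Rightarrow> complex" where
  "block_jet n d = (if d = Suc (n div d) \<or> n div d = Suc d then 1 else 0)"

lemma prod_lessThan_split_0: "d > 0 \<Longrightarrow> (\<Prod>b<d. f b) = f 0 * (\<Prod>b\<in>{1..<d}. f (b::nat) :: complex)"
  by (simp add: lessThan_atLeast0 prod.atLeast_Suc_lessThan)

context cusp_uniformizer
begin

lemma tendsto_g: "(f \<longlongrightarrow> 0) F \<Longrightarrow> ((\<lambda>w. g (f w)) \<longlongrightarrow> 0) F"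
proof -
  have "isCont g 0"
    using continuous_on_interior[OF holomorphic_on_imp_continuous_on[OF hol_g], of 0] by simp
  thus "(f \<longlongrightarrow> 0) F \<Longrightarrow> ((\<lambda>w. g (f w)) \<longlongrightarrow> 0) F"
    using isCont_tendsto_compose[of 0 g f F] g_0 by simp
qed

lemma tendsto_g_qpow: "\<alpha> > 0 \<Longrightarrow> ((\<lambda>w. g (c * qpow \<alpha> w)) \<longlongrightarrow> 0) at_ioo"
  using tendsto_mult_left[OF tendsto_qpow, of \<alpha> c] by (intro tendsto_g) simp

text \<open>
  A factor is \<open>1/q - 1/y\<close> up to an error that tends to \<open>0\<close>, where \<open>y = \<zeta>\<^sup>b q\<^bsup>a/d\<^esup>\<close> is the nome of \<open>M w\<close>.
  Dividing by the dominating term \<open>1/q\<close> or \<open>-1/y\<close>, one gets \<open>1 - q/y\<close> or \<open>1 - y/q\<close>, and the product of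
  these over \<open>b\<close> is \<open>1 - q\<^bsup>\<bar>d - a\<bar>\<^esup>\<close>. It has a linear term only if \<open>\<bar>d - a\<bar> = 1\<close>. For \<open>a = d\<close>, \<open>q/y\<close> is the
  constant \<open>\<zeta>\<^sup>-\<^sup>b\<close>, which differs from \<open>1\<close> for \<open>b \<noteq> 0\<close>.
\<close>

lemma block_asymptotics_infinity:
  assumes n: "n > 0" and d: "d dvd n"
  shows "\<exists>K. K \<noteq> 0 \<and> has_jet (\<lambda>w. K * nome w ^ block_pole n d * hecke_block p j n d w)
      (- block_jet n d)"
proof -
  define a where "a = n div d"
  have ad: "a > 0" "d > 0" using n d by (auto simp: a_def elim!: dvdE)
  define \<alpha> where "\<alpha> = real a / real d"
  have \<alpha>: "\<alpha> > 0" using ad by (simp add: \<alpha>_def)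
  define y where "y = (\<lambda>b w. unity_root d b * qpow \<alpha> w)"
  have y0: "y b w \<noteq> 0" for b w by (simp add: y_def)
  have limg: "((\<lambda>w. g (nome w)) \<longlongrightarrow> 0) at_ioo" by (rule tendsto_g_nome)
  have limgy: "((\<lambda>w. g (y b w)) \<longlongrightarrow> 0) at_ioo" for b unfolding y_def by (rule tendsto_g_qpow[OF \<alpha>])
  have fac: "j w - j (moebius (hecke_rep n d b) w) = inverse (nome w) + g (nome w) - inverse (y b w)
      - g (y b w)"
    if "Im w > 0" for b w
    using that hecke_rep_in_uhp[OF n d that, of b]
    by (simp add: j_eq nome_hecke_rep y_def \<alpha>_def a_def)
  have uhp: "eventually (\<lambda>w. Im w > 0) at_ioo" by (rule eventually_at_ioo_uhp)
  consider "a < d" | "d < a" | "a = d" by linarith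
  thus ?thesis
  proof cases
    case 1
    have ns: "\<not> scalar_class p (hecke_rep n d b)" if "b < d" for b
      using scalar_class_hecke_rep[OF n d that] 1 by (simp add: a_def)
    define u where "u = (\<lambda>b w. 1 - inverse (unity_root d b) * qpow (1 - \<alpha>) w)"
    define e where "e = (\<lambda>b w. nome w * (g (nome w) - g (y b w)))"
    have pos: "1 - \<alpha> > 0" using 1 by (simp add: \<alpha>_def)
    have "has_jet (\<lambda>w. \<Prod>b<d. u b w + e b w) (- block_jet n d)"
    proof (rule has_jet_prod_perturb)
      show "(u b \<longlongrightarrow> 1) at_ioo" for b
        using tendsto_diff[OF tendsto_const tendsto_mult_left[OF tendsto_qpow[OF pos]]]
          unfolding u_def by fastforce
      show "((\<lambda>w. e b w / nome w) \<longlongrightarrow> 0) at_ioo" for b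
        using tendsto_diff[OF limg limgy[of b]] by (simp add: e_def)
      have "real d * (1 - \<alpha>) = real (d - a)" using ad 1 by (simp add: \<alpha>_def field_simps of_nat_diff)
      hence "(\<Prod>b<d. u b w) = 1 - nome w ^ (d - a)" for w
        unfolding u_def prod_unity_roots(2)[OF ad(2)] by (simp add: qpow_power qpow_of_nat)
      moreover have "- block_jet n d = (if d - a = 1 then -1 else 0)" using 1
        by (auto simp: block_jet_def a_def)
      ultimately show "has_jet (\<lambda>w. \<Prod>b<d. u b w) (- block_jet n d)"
        using has_jet_one_minus_nome_power[of "d - a"] 1 by simp
    qed auto
    moreover have "eventually (\<lambda>w. (\<Prod>b<d. u b w + e b w) =
        1 * nome w ^ block_pole n d * hecke_block p j n d w) at_ioo"
      using uhp
    proof eventually_elim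
      case (elim w)
      have "(\<Prod>b<d. u b w + e b w) = (\<Prod>b<d. nome w * hecke_factor p j (hecke_rep n d b) w)"
      proof (rule prod.cong)
        fix b assume b: "b \<in> {..<d}"
        have "nome w * inverse (y b w) = inverse (unity_root d b) * qpow (1 - \<alpha>) w"
          by (simp add: y_def qpow_diff qpow_1 field_simps)
        hence "nome w * (inverse (nome w) + g (nome w) - inverse (y b w) - g (y b w)) =
            u b w + e b w"
          by (simp add: u_def e_def right_diff_distrib distrib_left)
        thus "u b w + e b w = nome w * hecke_factor p j (hecke_rep n d b) w"
          using ns[of b] b fac[OF elim, of b] by (simp add: hecke_factor_def)
      qed simp
      moreover have "block_pole n d = d" using 1 by (simp add: block_pole_def a_def)
      ultimately show ?case by (simp add: hecke_block_def prod.distrib)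
    qed
    ultimately have
      "has_jet (\<lambda>w. 1 * nome w ^ block_pole n d * hecke_block p j n d w) (- block_jet n d)"
      by (rule has_jet_cong[rotated])
    thus ?thesis by (intro exI[of _ 1] conjI) simp_all
  next
    case 2
    have ns: "\<not> scalar_class p (hecke_rep n d b)" if "b < d" for b
      using scalar_class_hecke_rep[OF n d that] 2 by (simp add: a_def)
    define u where "u = (\<lambda>b w. 1 - unity_root d b * qpow (\<alpha> - 1) w)"
    define e where "e = (\<lambda>b w. y b w * (g (y b w) - g (nome w)))"
    have pos: "\<alpha> - 1 > 0" using 2 ad by (simp add: \<alpha>_def)
    have yq: "y b w / nome w = unity_root d b * qpow (\<alpha> - 1) w" for b w
      by (simp add: y_def qpow_diff qpow_1 field_simps)
    have "has_jet (\<lambda>w. \<Prod>b<d. u b w + e b w) (- block_jet n d)"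
    proof (rule has_jet_prod_perturb)
      show "(u b \<longlongrightarrow> 1) at_ioo" for b
        using tendsto_diff[OF tendsto_const tendsto_mult_left[OF tendsto_qpow[OF pos]]]
          unfolding u_def by fastforce
      have "((\<lambda>w. unity_root d b * qpow (\<alpha> - 1) w * (g (y b w) - g (nome w))) \<longlongrightarrow> 0) at_ioo" for b
        using tendsto_mult[OF tendsto_mult_left[OF tendsto_qpow[OF pos]] tendsto_diff[OF limgy[of b]
          limg], of "unity_root d b"] by simp
      moreover have "e b w / nome w = unity_root d b * qpow (\<alpha> - 1) w * (g (y b w) - g (nome w))"
        for b w
        by (simp add: e_def yq[symmetric])
      ultimately show "((\<lambda>w. e b w / nome w) \<longlongrightarrow> 0) at_ioo" for b by simp
      have "real d * (\<alpha> - 1) = real (a - d)" using ad 2 by (simp add: \<alpha>_def field_simps of_nat_diff)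
      hence "(\<Prod>b<d. u b w) = 1 - nome w ^ (a - d)" for w
        unfolding u_def prod_unity_roots(1)[OF ad(2)] by (simp add: qpow_power qpow_of_nat)
      moreover have "- block_jet n d = (if a - d = 1 then -1 else 0)" using 2
        by (auto simp: block_jet_def a_def)
      ultimately show "has_jet (\<lambda>w. \<Prod>b<d. u b w) (- block_jet n d)"
        using has_jet_one_minus_nome_power[of "a - d"] 2 by simp
    qed auto
    moreover have "eventually (\<lambda>w. (\<Prod>b<d. u b w + e b w) =
        (\<Prod>b<d. - unity_root d b) * nome w ^ block_pole n d * hecke_block p j n d w) at_ioo"
      using uhp
    proof eventually_elim
      case (elim w)
      have "(\<Prod>b<d. u b w + e b w) =
          (\<Prod>b<d. (- unity_root d b * qpow \<alpha> w) * hecke_factor p j (hecke_rep n d b) w)"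
      proof (rule prod.cong)
        fix b assume b: "b \<in> {..<d}"
        have "u b w = 1 - y b w * inverse (nome w)" using yq[of b w]
          by (simp add: u_def field_simps)
        moreover have "y b w * inverse (y b w) = 1" using y0[of b w] by simp
        ultimately have "- y b w * (inverse (nome w) + g (nome w) - inverse (y b w) - g (y b w)) =
            u b w + e b w"
          by (simp only: e_def right_diff_distrib distrib_left mult_minus_left) simp
        thus "u b w + e b w = (- unity_root d b * qpow \<alpha> w) * hecke_factor p j (hecke_rep n d b) w"
          using ns[of b] b fac[OF elim, of b] by (simp add: hecke_factor_def y_def)
      qed simp
      also have "\<dots> = (\<Prod>b<d. - unity_root d b) * qpow \<alpha> w ^ d * hecke_block p j n d w"
        by (simp only: hecke_block_def prod.distrib prod_constant card_lessThan)
      also have "qpow \<alpha> w ^ d = nome w ^ a" using ad by (simp add: qpow_power \<alpha>_def qpow_of_nat)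
      also have "a = block_pole n d" using 2 by (simp add: block_pole_def a_def)
      finally show ?case .
    qed
    ultimately have
      "has_jet (\<lambda>w. (\<Prod>b<d. - unity_root d b) * nome w ^ block_pole n d * hecke_block p j n d w)
          (- block_jet n d)"
      by (rule has_jet_cong[rotated])
    moreover have "(\<Prod>b<d. - unity_root d b) \<noteq> 0" by simp
    ultimately show ?thesis by blast
  next
    case 3
    have \<alpha>1: "\<alpha> = 1" using 3 ad by (simp add: \<alpha>_def)
    have s0: "scalar_class p (hecke_rep n d 0)" using scalar_class_hecke_rep[OF n d, of 0] 3 ad
      by (simp add: a_def)
    have ns: "\<not> scalar_class p (hecke_rep n d b)" if "b < d" "b > 0" for b
      using scalar_class_hecke_rep[OF n d that(1)] that by simp
    define c where "c = (\<lambda>b. 1 - inverse (unity_root d b))"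
    have c0: "c b \<noteq> 0" if "b \<in> {1..<d}" for b using unity_root_neq_1[of b d] that
      by (auto simp: c_def field_simps)
    have "has_jet (\<lambda>w. \<Prod>b\<in>{1..<d}. inverse (c b) * (nome w * hecke_factor p j (hecke_rep n d b) w))
        (\<Sum>b\<in>{1..<d}. 0)"
    proof (rule has_jet_prod)
      fix b assume b: "b \<in> {1..<d}"
      have "((\<lambda>w. inverse (c b) * (g (nome w) - g (y b w))) \<longlongrightarrow> 0) at_ioo"
        using tendsto_mult_left[OF tendsto_diff[OF limg limgy[of b]], of "inverse (c b)"] by simp
      moreover have "eventually (\<lambda>w. inverse (c b) * (g (nome w) - g (y b w)) =
          (inverse (c b) * (nome w * hecke_factor p j (hecke_rep n d b) w) - 1) / nome w) at_ioo"
        using uhp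
      proof eventually_elim
        case (elim w)
        have "nome w * inverse (y b w) = inverse (unity_root d b)" by (simp add: y_def \<alpha>1 qpow_1)
        hence "nome w * (inverse (nome w) + g (nome w) - inverse (y b w) - g (y b w)) =
            c b + nome w * (g (nome w) - g (y b w))"
          by (simp add: c_def right_diff_distrib distrib_left)
        hence "nome w * hecke_factor p j (hecke_rep n d b) w =
            c b + nome w * (g (nome w) - g (y b w))"
          using ns[of b] b fac[OF elim, of b] by (simp add: hecke_factor_def)
        hence "inverse (c b) * (nome w * hecke_factor p j (hecke_rep n d b) w) - 1 =
            inverse (c b) * (nome w * (g (nome w) - g (y b w)))"
          using c0[OF b] by (simp only: distrib_left) simp
        thus ?case by simp
      qed
      ultimately show
        "has_jet (\<lambda>w. inverse (c b) * (nome w * hecke_factor p j (hecke_rep n d b) w)) 0"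
        unfolding has_jet_def by (rule Lim_transform_eventually)
    qed
    moreover have "(\<Prod>b\<in>{1..<d}. inverse (c b) * (nome w * hecke_factor p j (hecke_rep n d b) w)) =
       (\<Prod>b\<in>{1..<d}. inverse (c b)) * nome w ^ block_pole n d * hecke_block p j n d w" for w
      using 3 s0
      by (simp add: hecke_block_def prod.distrib prod_lessThan_split_0[OF ad(2)] block_pole_def
        a_def hecke_factor_def[of p j "hecke_rep n d 0"])
    moreover have "block_jet n d = 0" using 3 by (simp add: block_jet_def a_def)
    ultimately have
      "has_jet (\<lambda>w. (\<Prod>b\<in>{1..<d}. inverse (c b)) * nome w ^ block_pole n d * hecke_block p j n d w)
          (- block_jet n d)"
      by simp
    moreover have "(\<Prod>b\<in>{1..<d}. inverse (c b)) \<noteq> 0" using c0 by simp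
    ultimately show ?thesis by blast
  qed
qed

theorem hecke_prod_at_infinity:
  assumes n: "n > 0"
  shows "\<exists>K. K \<noteq> 0 \<and> has_jet (\<lambda>w. K * nome w ^ (\<Sum>d | d dvd n. block_pole n d) * hecke_prod p j n w)
      (- (\<Sum>d | d dvd n. block_jet n d))"
proof -
  have "\<forall>d. \<exists>K. d dvd n \<longrightarrow> K \<noteq> 0 \<and>
     has_jet (\<lambda>w. K * nome w ^ block_pole n d * hecke_block p j n d w) (- block_jet n d)"
    using block_asymptotics_infinity[OF n] by blast
  from choice[OF this] obtain K where K: "\<And>d. d dvd n \<Longrightarrow> K d \<noteq> 0"
    "\<And>d. d dvd n \<Longrightarrow> has_jet (\<lambda>w. K d * nome w ^ block_pole n d * hecke_block p j n d w)
        (- block_jet n d)"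
    by blast
  have "has_jet (\<lambda>w. \<Prod>d | d dvd n. K d * nome w ^ block_pole n d * hecke_block p j n d w)
      (\<Sum>d | d dvd n. - block_jet n d)"
    by (rule has_jet_prod) (use K in auto)
  moreover have "(\<Prod>d | d dvd n. K d * nome w ^ block_pole n d * hecke_block p j n d w) =
     (\<Prod>d | d dvd n. K d) * nome w ^ (\<Sum>d | d dvd n. block_pole n d) * hecke_prod p j n w" for w
    by (simp add: prod.distrib hecke_prod_blocks[OF n] power_sum)
  moreover have "(\<Prod>d | d dvd n. K d) \<noteq> 0" using K(1) n by auto
  ultimately show ?thesis by (auto simp: sum_negf intro!: exI[of _ "\<Prod>d | d dvd n. K d"])
qed

text \<open>
  Near the cusp \<open>0\<close>, a factor is \<open>q G(q) - y G(y)\<close>, where \<open>y = \<zeta>\<^sup>b q\<^bsup>a/d\<^esup>\<close>. So it behaves like a constant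
  times the dominating one of \<open>q\<close> and \<open>y\<close>; for \<open>a = d\<close>, when both are equally large, the constant is
  \<open>G(0) (1 - \<zeta>\<^sup>b)\<close>.
\<close>

lemma block_asymptotics_zero:
  assumes n: "n > 0" and d: "d dvd n"
    and G: "\<And>w. Im w > 0 \<Longrightarrow> j0 w = c0 + nome w * G (nome w)" "isCont G 0" "G 0 \<noteq> 0"
  shows "\<exists>K. K \<noteq> 0 \<and> ((\<lambda>w. hecke_block p j0 n d w / nome w ^ block_zero n d) \<longlongrightarrow> K) at_ioo"
proof -
  define a where "a = n div d"
  have ad: "a > 0" "d > 0" using n d by (auto simp: a_def elim!: dvdE)
  define \<alpha> where "\<alpha> = real a / real d"
  have \<alpha>: "\<alpha> > 0" using ad by (simp add: \<alpha>_def)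
  define y where "y = (\<lambda>b w. unity_root d b * qpow \<alpha> w)"
  have y0: "y b w \<noteq> 0" for b w by (simp add: y_def)
  have y_lim: "(y b \<longlongrightarrow> 0) at_ioo" for b unfolding y_def
    using tendsto_mult_left[OF tendsto_qpow[OF \<alpha>], of "unity_root d b"] by simp
  have limG: "((\<lambda>w. G (nome w)) \<longlongrightarrow> G 0) at_ioo"
    by (rule isCont_tendsto_compose[OF G(2) tendsto_nome])
  have limGy: "((\<lambda>w. G (y b w)) \<longlongrightarrow> G 0) at_ioo" for b by (rule isCont_tendsto_compose[OF G(2) y_lim])
  have fac: "j0 w - j0 (moebius (hecke_rep n d b) w) = nome w * G (nome w) - y b w * G (y b w)"
    if "Im w > 0" for b w
    using that hecke_rep_in_uhp[OF n d that, of b]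
    by (simp add: G(1) nome_hecke_rep y_def \<alpha>_def a_def)
  have uhp: "eventually (\<lambda>w. Im w > 0) at_ioo" by (rule eventually_at_ioo_uhp)
  consider "a < d" | "d < a" | "a = d" by linarith
  thus ?thesis
  proof cases
    case 1
    have ns: "\<not> scalar_class p (hecke_rep n d b)" if "b < d" for b
      using scalar_class_hecke_rep[OF n d that] 1 by (simp add: a_def)
    have pos: "1 - \<alpha> > 0" using 1 by (simp add: \<alpha>_def)
    have qy: "nome w / y b w = inverse (unity_root d b) * qpow (1 - \<alpha>) w" for b w
      by (simp add: y_def qpow_diff qpow_1 field_simps)
    have "((\<lambda>w. \<Prod>b<d. unity_root d b * (inverse (unity_root d b) * qpow (1 - \<alpha>) w * G (nome w) - G
        (y b w))) \<longlongrightarrow> (\<Prod>b<d. unity_root d b * - G 0)) at_ioo"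
    proof (intro tendsto_prod tendsto_mult tendsto_const)
      show "((\<lambda>w. inverse (unity_root d b) * qpow (1 - \<alpha>) w * G (nome w) - G (y b w)) \<longlongrightarrow>
          - G 0) at_ioo" for b
        using tendsto_diff[OF tendsto_mult[OF tendsto_mult_left[OF tendsto_qpow[OF pos], of
          "inverse (unity_root d b)"] limG] limGy[of b]]
        by simp
    qed
    moreover have
      "eventually (\<lambda>w. (\<Prod>b<d. unity_root d b * (inverse (unity_root d b) * qpow (1 - \<alpha>) w * G
          (nome w) - G (y b w))) =
        hecke_block p j0 n d w / nome w ^ block_zero n d) at_ioo"
      using uhp
    proof eventually_elim
      case (elim w)
      have "hecke_block p j0 n d w =
          (\<Prod>b<d. qpow \<alpha> w * (unity_root d b * (inverse (unity_root d b) * qpow (1 - \<alpha>) w * G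
            (nome w) - G (y b w))))"
      unfolding hecke_block_def
      proof (rule prod.cong)
        fix b assume b: "b \<in> {..<d}"
        have "qpow \<alpha> w * (unity_root d b * (inverse (unity_root d b) * qpow (1 - \<alpha>) w * G (nome w) -
            G (y b w)))
           = y b w * (nome w / y b w * G (nome w) - G (y b w))" by (simp only: qy) (simp add: y_def)
        also have "\<dots> = nome w * G (nome w) - y b w * G (y b w)" using y0[of b w]
          by (simp add: field_simps)
        finally show
          "hecke_factor p j0 (hecke_rep n d b) w =
              qpow \<alpha> w * (unity_root d b * (inverse (unity_root d b) * qpow (1 - \<alpha>) w * G (nome w) -
                G (y b w)))"
          using ns[of b] b fac[OF elim, of b] by (simp add: hecke_factor_def)
      qed simp
      also have
        "\<dots> = qpow \<alpha> w ^ d * (\<Prod>b<d. unity_root d b * (inverse (unity_root d b) * qpow (1 - \<alpha>) w * G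
            (nome w) - G (y b w)))"
        by (simp only: prod.distrib prod_constant card_lessThan)
      also have "qpow \<alpha> w ^ d = nome w ^ a" using ad by (simp add: qpow_power \<alpha>_def qpow_of_nat)
      also have "a = block_zero n d" using 1 by (simp add: block_zero_def a_def)
      finally show ?case by simp
    qed
    ultimately have
      "((\<lambda>w. hecke_block p j0 n d w / nome w ^ block_zero n d) \<longlongrightarrow> (\<Prod>b<d. unity_root d b * - G 0))
          at_ioo"
      by (rule Lim_transform_eventually)
    moreover have "(\<Prod>b<d. unity_root d b * - G 0) \<noteq> 0" using G(3) by simp
    ultimately show ?thesis by blast
  next
    case 2
    have ns: "\<not> scalar_class p (hecke_rep n d b)" if "b < d" for b
      using scalar_class_hecke_rep[OF n d that] 2 by (simp add: a_def)
    have pos: "\<alpha> - 1 > 0" using 2 ad by (simp add: \<alpha>_def)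
    have yq: "y b w / nome w = unity_root d b * qpow (\<alpha> - 1) w" for b w
      by (simp add: y_def qpow_diff qpow_1 field_simps)
    have "((\<lambda>w. \<Prod>b<d. G (nome w) - unity_root d b * qpow (\<alpha> - 1) w * G (y b w)) \<longlongrightarrow>
        (\<Prod>b<d. G 0)) at_ioo"
    proof (rule tendsto_prod)
      show "((\<lambda>w. G (nome w) - unity_root d b * qpow (\<alpha> - 1) w * G (y b w)) \<longlongrightarrow> G 0) at_ioo" for b
        using tendsto_diff[OF limG tendsto_mult[OF tendsto_mult_left[OF tendsto_qpow[OF pos], of
          "unity_root d b"] limGy[of b]]]
        by simp
    qed
    moreover have
      "eventually (\<lambda>w. (\<Prod>b<d. G (nome w) - unity_root d b * qpow (\<alpha> - 1) w * G (y b w)) =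
        hecke_block p j0 n d w / nome w ^ block_zero n d) at_ioo"
      using uhp
    proof eventually_elim
      case (elim w)
      have "hecke_block p j0 n d w =
          (\<Prod>b<d. nome w * (G (nome w) - unity_root d b * qpow (\<alpha> - 1) w * G (y b w)))"
      unfolding hecke_block_def
      proof (rule prod.cong)
        fix b assume b: "b \<in> {..<d}"
        show "hecke_factor p j0 (hecke_rep n d b) w =
            nome w * (G (nome w) - unity_root d b * qpow (\<alpha> - 1) w * G (y b w))"
          unfolding yq[symmetric]
          using ns[of b] b fac[OF elim, of b] by (simp add: hecke_factor_def algebra_simps)
      qed simp
      also have "\<dots> = nome w ^ d * (\<Prod>b<d. G (nome w) - unity_root d b * qpow (\<alpha> - 1) w * G (y b w))"
        by (simp only: prod.distrib prod_constant card_lessThan)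
      also have "d = block_zero n d" using 2 by (simp add: block_zero_def a_def)
      finally show ?case using 2 by (simp add: block_zero_def a_def)
    qed
    ultimately have "((\<lambda>w. hecke_block p j0 n d w / nome w ^ block_zero n d) \<longlongrightarrow> (\<Prod>b<d. G 0)) at_ioo"
      by (rule Lim_transform_eventually)
    moreover have "(\<Prod>b<d. G 0) \<noteq> 0" using G(3) by simp
    ultimately show ?thesis by blast
  next
    case 3
    have \<alpha>1: "\<alpha> = 1" using 3 ad by (simp add: \<alpha>_def)
    have s0: "scalar_class p (hecke_rep n d 0)" using scalar_class_hecke_rep[OF n d, of 0] 3 ad
      by (simp add: a_def)
    have ns: "\<not> scalar_class p (hecke_rep n d b)" if "b < d" "b > 0" for b
      using scalar_class_hecke_rep[OF n d that(1)] that by simp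
    have "((\<lambda>w. \<Prod>b\<in>{1..<d}. G (nome w) - unity_root d b * G (y b w)) \<longlongrightarrow>
        (\<Prod>b\<in>{1..<d}. G 0 - unity_root d b * G 0)) at_ioo"
      by (intro tendsto_prod tendsto_diff tendsto_mult tendsto_const limG limGy)
    moreover have "eventually (\<lambda>w. (\<Prod>b\<in>{1..<d}. G (nome w) - unity_root d b * G (y b w)) =
        hecke_block p j0 n d w / nome w ^ block_zero n d) at_ioo"
      using uhp
    proof eventually_elim
      case (elim w)
      have "hecke_block p j0 n d w = (\<Prod>b\<in>{1..<d}. hecke_factor p j0 (hecke_rep n d b) w)"
        using s0 by (simp add: hecke_block_def prod_lessThan_split_0[OF ad(2)] hecke_factor_def[of p
          j0 "hecke_rep n d 0"])
      also have "\<dots> = (\<Prod>b\<in>{1..<d}. nome w * (G (nome w) - unity_root d b * G (y b w)))"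
      proof (rule prod.cong)
        fix b assume b: "b \<in> {1..<d}"
        have "y b w = unity_root d b * nome w" by (simp add: y_def \<alpha>1 qpow_1)
        thus "hecke_factor p j0 (hecke_rep n d b) w =
            nome w * (G (nome w) - unity_root d b * G (y b w))"
          using ns[of b] b fac[OF elim, of b] by (simp add: hecke_factor_def algebra_simps)
      qed simp
      also have
        "\<dots> = nome w ^ block_zero n d * (\<Prod>b\<in>{1..<d}. G (nome w) - unity_root d b * G (y b w))"
        using 3 by (simp add: prod.distrib block_zero_def a_def)
      finally show ?case by simp
    qed
    ultimately have
      "((\<lambda>w. hecke_block p j0 n d w / nome w ^ block_zero n d) \<longlongrightarrow>
          (\<Prod>b\<in>{1..<d}. G 0 - unity_root d b * G 0)) at_ioo"
      by (rule Lim_transform_eventually)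
    moreover have "(\<Prod>b\<in>{1..<d}. G 0 - unity_root d b * G 0) \<noteq> 0" using G(3) unity_root_neq_1 by auto
    ultimately show ?thesis by blast
  qed
qed

theorem hecke_prod_at_zero:
  assumes n: "n > 0"
  shows "\<exists>\<kappa>. \<kappa> \<noteq> 0 \<and> ((\<lambda>w. (j0 w - c0) / nome w) \<longlongrightarrow> \<kappa>) at_ioo" (is ?A)
    and "\<exists>K. K \<noteq> 0 \<and> ((\<lambda>w. hecke_prod p j0 n w / nome w ^ (\<Sum>d | d dvd n. block_zero n d)) \<longlongrightarrow>
        K) at_ioo" (is ?B)
proof -
  obtain G where G: "G holomorphic_on ball 0 1" "G 0 = c0" "\<And>z. Im z > 0 \<Longrightarrow> j0 z = G (nome z)"
    "deriv G 0 \<noteq> 0"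
    using j0_expansion by blast
  \<comment> \<open>The expansion of \<open>j0 - c0\<close> divided by \<open>q\<close>, which is continuous
    and does not vanish at \<open>0\<close>.\<close>
  define G1 where "G1 = (\<lambda>q. if q = 0 then deriv G 0 else (G q - c0) / q)"
  have "(G has_field_derivative deriv G 0) (at 0)"
    using G(1) by (intro holomorphic_derivI[where S = "ball 0 1"]) auto
  hence "((\<lambda>q. (G q - c0) / q) \<longlongrightarrow> deriv G 0) (at 0)" by (simp add: has_field_derivative_iff G(2))
  hence "(G1 \<longlongrightarrow> deriv G 0) (at 0)"
    by (rule Lim_transform_eventually) (auto simp: G1_def eventually_at_filter)
  hence cont: "isCont G1 0" by (simp add: isCont_def G1_def)
  have j0_eq: "j0 w = c0 + nome w * G1 (nome w)" if "Im w > 0" for w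
    using that by (simp add: G(3) G1_def)
  have nz: "G1 0 \<noteq> 0" using G(4) by (simp add: G1_def)
  have "((\<lambda>w. G1 (nome w)) \<longlongrightarrow> G1 0) at_ioo" by (rule isCont_tendsto_compose[OF cont tendsto_nome])
  moreover have "eventually (\<lambda>w. G1 (nome w) = (j0 w - c0) / nome w) at_ioo"
    using eventually_at_ioo_uhp[of 0] by eventually_elim (simp add: j0_eq)
  ultimately have "((\<lambda>w. (j0 w - c0) / nome w) \<longlongrightarrow> G1 0) at_ioo" by (rule Lim_transform_eventually)
  thus ?A using nz by blast
  have "\<forall>d. \<exists>K. d dvd n \<longrightarrow> K \<noteq> 0 \<and>
     ((\<lambda>w. hecke_block p j0 n d w / nome w ^ block_zero n d) \<longlongrightarrow> K) at_ioo"
    using block_asymptotics_zero[OF n _ j0_eq cont nz] by blast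
  from choice[OF this] obtain K where K: "\<And>d. d dvd n \<Longrightarrow> K d \<noteq> 0"
    "\<And>d. d dvd n \<Longrightarrow> ((\<lambda>w. hecke_block p j0 n d w / nome w ^ block_zero n d) \<longlongrightarrow> K d) at_ioo"
    by blast
  have "((\<lambda>w. \<Prod>d | d dvd n. hecke_block p j0 n d w / nome w ^ block_zero n d) \<longlongrightarrow> (\<Prod>d | d dvd n. K d))
      at_ioo"
    by (rule tendsto_prod) (use K in auto)
  moreover have "(\<Prod>d | d dvd n. hecke_block p j0 n d w / nome w ^ block_zero n d) =
     hecke_prod p j0 n w / nome w ^ (\<Sum>d | d dvd n. block_zero n d)" for w
    by (simp add: prod_dividef hecke_prod_blocks[OF n] power_sum)
  moreover have "(\<Prod>d | d dvd n. K d) \<noteq> 0" using K(1) n by auto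
  ultimately show ?B by auto
qed

end


section \<open>Comparison of divisors\<close>

text \<open>
  The difference between the orders of pole and zero is \<open>max(d, n/d) - min(d, n/d) = d + n/d - 2
  min(d, n/d)\<close> for every \<open>d\<close>, also in the block with \<open>n/d = d\<close>.
\<close>

lemma sum_block_zero:
  fixes n :: nat
  assumes n: "n > 0"
  shows "real (\<Sum>d | d dvd n. block_zero n d) = (\<Sum>d | d dvd n. real (min d (n div d))) -
      (if is_square n then 1 else 0)"
    and "real (\<Sum>d | d dvd n. block_pole n d) = real (\<Sum>d | d dvd n. block_zero n d) +
           2 * real (divisor_sum n) - 2 * (\<Sum>d | d dvd n. real (min d (n div d)))"
proof -
  have fin: "finite {d. d dvd n}" using n by simp
  have pos: "d > 0" if "d dvd n" for d using that n by (auto elim!: dvdE)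
  have sq: "(\<Sum>d | d dvd n. if n div d = d then 1 else 0 :: real) = (if is_square n then 1 else 0)"
  proof (cases "is_square n")
    case True
    then obtain k where k: "n = k\<^sup>2" by (auto elim: is_nth_powerE)
    have "{d. d dvd n \<and> n div d = d} = {k}"
    proof (intro equalityI subsetI)
      fix d assume "d \<in> {d. d dvd n \<and> n div d = d}"
      hence "n = d * d" using dvd_mult_div_cancel[of d n] by simp
      hence "d\<^sup>2 = k\<^sup>2" using k by (simp add: power2_eq_square)
      thus "d \<in> {k}" by simp
    qed (use k n in \<open>auto simp: power2_eq_square\<close>)
    thus ?thesis using True fin by (simp flip: sum.inter_filter)
  next
    case False
    have "{d. d dvd n \<and> n div d = d} = {}"
    proof safe
      fix d assume "d dvd n" "n div d = d"
      hence "n = d\<^sup>2" using dvd_mult_div_cancel[of d n] by (simp add: power2_eq_square)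
      thus "d \<in> {}" using False by auto
    qed
    thus ?thesis using False fin by (simp flip: sum.inter_filter)
  qed
  have "real (\<Sum>d | d dvd n. block_zero n d) = (\<Sum>d | d dvd n. real (min d (n div d)) - (if n div d =
      d then 1 else 0))"
    unfolding of_nat_sum
  proof (rule sum.cong)
    fix d assume "d \<in> {d. d dvd n}"
    hence "d > 0" using pos by simp
    thus "real (block_zero n d) = real (min d (n div d)) - (if n div d = d then 1 else 0)"
      by (auto simp: block_zero_def of_nat_diff)
  qed simp
  thus "real (\<Sum>d | d dvd n. block_zero n d) = (\<Sum>d | d dvd n. real (min d (n div d))) -
      (if is_square n then 1 else 0)"
    by (simp add: sum_subtractf sq)
  have bij: "bij_betw (\<lambda>d. n div d) {d. d dvd n} {d. d dvd n}"
    by (rule bij_betw_byWitness[where f' = "\<lambda>d. n div d"]) (use n in \<open>auto elim!: dvdE\<close>)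
  have "(\<Sum>d | d dvd n. real (n div d)) = (\<Sum>d | d dvd n. real d)"
    using sum.reindex_bij_betw[OF bij, of real] .
  moreover have "real (\<Sum>d | d dvd n. block_pole n d) =
      (\<Sum>d | d dvd n. real (block_zero n d) + (real d + real (n div d)) - 2 * real
        (min d (n div d)))"
    unfolding of_nat_sum by (rule sum.cong) (auto simp: block_zero_def block_pole_def)
  ultimately show "real (\<Sum>d | d dvd n. block_pole n d) = real (\<Sum>d | d dvd n. block_zero n d) +
           2 * real (divisor_sum n) - 2 * (\<Sum>d | d dvd n. real (min d (n div d)))"
    by (simp add: sum.distrib sum_subtractf sum_distrib_left divisor_sum_def)
qed

text \<open>
  If \<open>4n + 1 = (2e + 1)\<^sup>2\<close>, then \<open>n = e (e + 1)\<close>, and the divisors \<open>d\<close> with \<open>\<bar>d - n/d\<bar> = 1\<close> are \<open>e\<close> and \<open>e +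
  1\<close>. Such a product lies strictly between two consecutive squares.
\<close>

lemma sum_block_jet:
  fixes n :: nat
  assumes n: "n > 0"
  shows "(\<Sum>d | d dvd n. block_jet n d) = (if is_square (4 * n + 1) then 2 else 0)"
    and "is_square n \<Longrightarrow> \<not> is_square (4 * n + 1)"
proof -
  have fin: "finite {d. d dvd n}" using n by simp
  have iff: "d dvd n \<and> (d = Suc (n div d) \<or> n div d = Suc d) \<longleftrightarrow> (\<exists>e. n = e * Suc e \<and>
      (d = e \<or> d = Suc e))" for d
  proof
    assume d: "d dvd n \<and> (d = Suc (n div d) \<or> n div d = Suc d)"
    hence "n = d * (n div d)" by simp
    with d show "\<exists>e. n = e * Suc e \<and> (d = e \<or> d = Suc e)" by (metis mult.commute)
  next
    assume "\<exists>e. n = e * Suc e \<and> (d = e \<or> d = Suc e)"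
    then obtain e where e: "n = e * Suc e" "d = e \<or> d = Suc e" by blast
    have "e > 0" using e n by (cases e) auto
    have "n div e = Suc e" "n div Suc e = e" using \<open>e > 0\<close> unfolding e(1)
      by (simp_all only: nonzero_mult_div_cancel_left nonzero_mult_div_cancel_right)
    moreover have "e dvd n" "Suc e dvd n" unfolding e(1) by (rule dvd_triv_left dvd_triv_right)+
    ultimately show "d dvd n \<and> (d = Suc (n div d) \<or> n div d = Suc d)" using e(2) by auto
  qed
  have sq: "is_square (4 * n + 1) \<longleftrightarrow> (\<exists>e. n = e * Suc e)"
  proof
    assume "is_square (4 * n + 1)"
    then obtain m where m: "4 * n + 1 = m\<^sup>2" by (auto elim: is_nth_powerE)
    have "odd (m\<^sup>2)" unfolding m[symmetric] by simp
    hence "odd m" by simp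
    then obtain e where "m = 2 * e + 1" by (elim oddE)
    hence "4 * n = 4 * (e * Suc e)" using m by (simp add: power2_eq_square algebra_simps)
    hence "n = e * Suc e" by simp
    thus "\<exists>e. n = e * Suc e" ..
  next
    assume "\<exists>e. n = e * Suc e"
    then obtain e where "n = e * Suc e" by blast
    hence "4 * n + 1 = (2 * e + 1)\<^sup>2" by (simp add: power2_eq_square algebra_simps)
    thus "is_square (4 * n + 1)" by (metis is_nth_power_nth_power)
  qed
  have mono: "e = e'" if "e * Suc e = e' * Suc e'" for e e'
  proof (rule ccontr)
    assume "e \<noteq> e'"
    then consider "e < e'" | "e' < e" by linarith
    thus False
    proof cases
      case 1
      hence "e * Suc e < e' * Suc e'" by (intro mult_strict_mono) auto
      thus False using that by simp
    next
      case 2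
      hence "e' * Suc e' < e * Suc e" by (intro mult_strict_mono) auto
      thus False using that by simp
    qed
  qed
  have "(\<Sum>d | d dvd n. block_jet n d) =
      of_nat (card {d. d dvd n \<and> (d = Suc (n div d) \<or> n div d = Suc d)})"
    unfolding block_jet_def using fin by (simp flip: sum.inter_filter)
  also have "\<dots> = (if is_square (4 * n + 1) then 2 else 0)"
  proof (cases "is_square (4 * n + 1)")
    case True
    then obtain e where e: "n = e * Suc e" using sq by blast
    have "{d. d dvd n \<and> (d = Suc (n div d) \<or> n div d = Suc d)} = {e, Suc e}"
      unfolding iff using e mono by blast
    thus ?thesis using True by simp
  next
    case False
    have "{d. d dvd n \<and> (d = Suc (n div d) \<or> n div d = Suc d)} = {}"
      unfolding iff using sq False by blast
    thus ?thesis using False by (simp only: card.empty if_False of_nat_0)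
  qed
  finally show "(\<Sum>d | d dvd n. block_jet n d) = (if is_square (4 * n + 1) then 2 else 0)" .
  show "\<not> is_square (4 * n + 1)" if "is_square n"
  proof
    assume "is_square (4 * n + 1)"
    then obtain e where e: "n = e * Suc e" using sq by blast
    obtain k where k: "n = k\<^sup>2" using \<open>is_square n\<close> by (rule is_nth_powerE)
    have "e > 0" using e n by (cases e) auto
    have "e\<^sup>2 < k\<^sup>2" using e k \<open>e > 0\<close> by (simp add: power2_eq_square)
    hence "e < k" using power_less_imp_less_base by blast
    hence "(Suc e)\<^sup>2 \<le> k\<^sup>2" by (intro power_mono) auto
    thus False using e k by (simp add: power2_eq_square)
  qed
qed

context cusp_uniformizer
begin

text \<open>
  The quotient of \<open>F\<close> by the corresponding product of differences \<open>j - v\<close> has removable singularities,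
  no zeros, and a nonzero limit at the cusp \<open>0\<close>. If the pole orders at \<open>\<infinity>\<close> were different, then the
  quotient or its inverse would tend to \<open>0\<close> there, although both are constant by \<open>invariant_constant\<close>.
  Once the quotient is known to be constant, the jets at \<open>\<infinity>\<close> must agree, too.
\<close>

lemma divisor_comparison:
  fixes F :: "complex \<Rightarrow> complex" and Z :: "complex set" and k :: "complex \<Rightarrow> nat"
  assumes hol: "F holomorphic_on upper_half_plane"
    and inv: "\<And>A z. A \<in> Gamma0 p \<Longrightarrow> Im z > 0 \<Longrightarrow> F (moebius A z) = F z"
    and fin: "finite Z" and Z: "c0 \<notin> Z"
    and k0: "\<And>v. v \<notin> Z \<Longrightarrow> k v = 0"
    and loc: "\<And>z. Im z > 0 \<Longrightarrow> \<exists>L. L \<noteq> 0 \<and> ((\<lambda>w. F w / (j w - j z) ^ k (j z)) \<longlongrightarrow> L) (at z)"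
    and inf: "K \<noteq> 0" "has_jet (\<lambda>w. K * nome w ^ D * F w) s"
    and zero: "K0 \<noteq> 0" "((\<lambda>w. F (moebius (fricke p) w) / nome w ^ m) \<longlongrightarrow> K0) at_ioo"
    and ord: "\<kappa> \<noteq> 0" "((\<lambda>w. (j0 w - c0) / nome w) \<longlongrightarrow> \<kappa>) at_ioo"
  shows "(\<Sum>v\<in>Z. k v) + m = D" and "(\<Sum>v\<in>Z. of_nat (k v) * v) + of_nat m * c0 = - s"
proof -
  define R where "R = (\<lambda>w. (\<Prod>v\<in>Z. (j w - v) ^ k v) * (j w - c0) ^ m)"
  define H where "H = (\<lambda>w. F w / R w)"
  have holR: "R holomorphic_on upper_half_plane"
    unfolding R_def by (intro holomorphic_intros hol_j)
  have R_nz: "R w \<noteq> 0" if "j w \<notin> Z" "j w \<noteq> c0" for w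
    using that fin by (auto simp: R_def)
  have ev_nz: "eventually (\<lambda>w. Im w > 0 \<and> R w \<noteq> 0) (at z)" if z: "Im z > 0" for z
  proof -
    have ev: "eventually (\<lambda>w. j w \<noteq> v) (at z)" for v
    proof (cases "v = j z")
      case False
      have "(j \<longlongrightarrow> j z) (at z)" using j_isCont[OF z] by (simp add: isCont_def)
      thus ?thesis using False by (intro tendsto_imp_eventually_ne) auto
    qed (use j_eventually_neq[OF z] in simp)
    have "eventually (\<lambda>w. \<forall>v\<in>insert c0 Z. j w \<noteq> v) (at z)"
      using fin ev by (intro eventually_ball_finite) auto
    moreover have "eventually (\<lambda>w. w \<in> upper_half_plane) (at z)"
      using z by (intro eventually_at_in_open' open_uhp) auto
    ultimately show ?thesis by eventually_elim (use R_nz in auto)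
  qed
  have limH: "\<exists>L. L \<noteq> 0 \<and> (H \<longlongrightarrow> L) (at z)" if z: "Im z > 0" for z
  proof -
    obtain L where L: "L \<noteq> 0" "((\<lambda>w. F w / (j w - j z) ^ k (j z)) \<longlongrightarrow> L) (at z)"
      using loc[OF z] by blast
    define R' where "R' = (\<lambda>w. (\<Prod>v\<in>Z - {j z}. (j w - v) ^ k v) * (j w - c0) ^ m)"
    have "(j \<longlongrightarrow> j z) (at z)" using j_isCont[OF z] by (simp add: isCont_def)
    hence "(R' \<longlongrightarrow> R' z) (at z)" unfolding R'_def by (intro tendsto_intros)
    moreover have "R' z \<noteq> 0" using fin j_neq_c0[OF z] by (auto simp: R'_def)
    ultimately have "((\<lambda>w. F w / (j w - j z) ^ k (j z) / R' w) \<longlongrightarrow> L / R' z) (at z)"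
      using L(2) by (intro tendsto_divide)
    moreover have "F w / (j w - j z) ^ k (j z) / R' w = H w" for w
    proof -
      have "(j w - j z) ^ k (j z) * R' w = R w"
      proof (cases "j z \<in> Z")
        case True
        thus ?thesis using fin by (simp add: R_def R'_def prod.remove)
      next
        case False
        thus ?thesis using k0[OF False] by (simp add: R_def R'_def)
      qed
      thus ?thesis by (simp add: H_def)
    qed
    ultimately have "(H \<longlongrightarrow> L / R' z) (at z)" by simp
    thus ?thesis using L(1) \<open>R' z \<noteq> 0\<close> by (intro exI[of _ "L / R' z"]) auto
  qed
  have iso: "isolated_singularity_at H z" if z: "Im z > 0" for z
  proof -
    obtain S where S: "open S" "z \<in> S" "\<And>w. w \<in> S \<Longrightarrow> w \<noteq> z \<Longrightarrow> Im w > 0 \<and> R w \<noteq> 0"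
      using ev_nz[OF z] unfolding eventually_at_topological by blast
    obtain r where r: "r > 0" "ball z r \<subseteq> S" using S(1,2) openE by blast
    have S3: "Im w > 0" "R w \<noteq> 0" if "w \<in> ball z r - {z}" for w
      using that r(2) S(3)[of w] by auto
    have sub: "ball z r - {z} \<subseteq> upper_half_plane" using S3(1) in_uhp by blast
    have "H holomorphic_on ball z r - {z}"
      unfolding H_def using sub
      by (intro holomorphic_intros holomorphic_on_subset[OF hol] holomorphic_on_subset[OF holR])
        (use S3 in auto)
    hence "H analytic_on ball z r - {z}" by (subst analytic_on_open) auto
    thus ?thesis using r(1) unfolding isolated_singularity_at_def by blast
  qed
  \<comment> \<open>The holomorphic extension of the quotient.\<close>
  define h where "h = remove_sings H"
  have h_lim: "(H \<longlongrightarrow> h z) (at z)" and h_nz: "h z \<noteq> 0" if z: "Im z > 0" for z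
    using limH[OF z] remove_sings_eqI[of H] unfolding h_def by blast+
  have "h analytic_on {z}" if "z \<in> upper_half_plane" for z
    using that limH[of z] remove_sings_analytic_at[OF iso[of z]] unfolding h_def by auto
  hence "h analytic_on upper_half_plane" by (subst analytic_on_analytic_at) blast
  hence hol_h: "h holomorphic_on upper_half_plane" by (rule analytic_imp_holomorphic)
  have h_eq: "h z = H z" if z: "Im z > 0" "R z \<noteq> 0" for z
  proof -
    have "isCont F z" "isCont R z"
      using z(1) holomorphic_on_imp_continuous_on[OF hol] holomorphic_on_imp_continuous_on[OF holR]
        open_uhp
      by (auto simp: continuous_on_eq_continuous_at)
    hence "isCont H z" unfolding H_def using z(2) by (rule isCont_divide)
    hence "(H \<longlongrightarrow> H z) (at z)" by (simp add: isCont_def)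
    thus ?thesis using h_lim[OF z(1)] LIM_unique by blast
  qed
  have inv_h: "h (moebius A z) = h z" if A: "A \<in> Gamma0 p" and z: "Im z > 0" for A z
  proof -
    have Az: "Im (moebius A z) > 0" using moebius_Gamma0_in_uhp[OF A z] .
    have "filterlim (moebius A) (at (moebius A z)) (at z)"
      unfolding filterlim_at
    proof
      have "isCont (moebius A) z" using A z by (intro continuous_moebius) (auto simp: det_Gamma0)
      thus "(moebius A \<longlongrightarrow> moebius A z) (at z)" by (simp add: isCont_def)
      have "eventually (\<lambda>w. w \<in> upper_half_plane - {z}) (at z)"
        using z open_uhp by (intro eventually_at_in_open) auto
      thus "eventually (\<lambda>w. moebius A w \<in> UNIV \<and> moebius A w \<noteq> moebius A z) (at z)"
      proof eventually_elim
        case (elim w)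
        thus ?case using moebius_adj2(1)[OF det_Gamma0[OF A]] z
          by (metis Diff_iff UNIV_I in_uhp insertI1)
      qed
    qed
    from filterlim_compose[OF h_lim[OF Az] this]
    have "((\<lambda>w. H (moebius A w)) \<longlongrightarrow> h (moebius A z)) (at z)" .
    moreover have "eventually (\<lambda>w. H (moebius A w) = H w) (at z)"
      using ev_nz[OF z] by eventually_elim (simp add: H_def R_def inv inv_j A)
    ultimately have "(H \<longlongrightarrow> h (moebius A z)) (at z)" by (rule Lim_transform_eventually)
    thus ?thesis using h_lim[OF z] LIM_unique by blast
  qed
  define deg where "deg = (\<Sum>v\<in>Z. k v) + m"
  have jetj: "has_jet (\<lambda>w. nome w * (j w - v)) (- v)" for v
  proof -
    have "((\<lambda>w. g (nome w) - v) \<longlongrightarrow> 0 - v) at_ioo" by (intro tendsto_intros tendsto_g_nome)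
    moreover have "eventually (\<lambda>w. g (nome w) - v = (nome w * (j w - v) - 1) / nome w) at_ioo"
      using eventually_at_ioo_uhp[of 0] by eventually_elim (simp add: j_eq field_simps)
    ultimately have "((\<lambda>w. (nome w * (j w - v) - 1) / nome w) \<longlongrightarrow> 0 - v) at_ioo"
      by (rule Lim_transform_eventually)
    thus ?thesis by (simp add: has_jet_def)
  qed
  have "has_jet (\<lambda>w. (\<Prod>v\<in>Z. (nome w * (j w - v)) ^ k v) * (nome w * (j w - c0)) ^ m)
     ((\<Sum>v\<in>Z. of_nat (k v) * - v) + of_nat m * - c0)"
    by (intro has_jet_mult has_jet_prod has_jet_power jetj)
  moreover have "(\<Prod>v\<in>Z. (nome w * (j w - v)) ^ k v) * (nome w * (j w - c0)) ^ m =
      nome w ^ deg * R w" for w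
    by (simp add: R_def deg_def power_mult_distrib prod.distrib power_add power_sum mult_ac)
  ultimately have jetR:
    "has_jet (\<lambda>w. nome w ^ deg * R w) ((\<Sum>v\<in>Z. of_nat (k v) * - v) + of_nat m * - c0)" by simp
  have evR: "eventually (\<lambda>w. Im w > 0 \<and> R w \<noteq> 0) at_ioo"
  proof -
    have "eventually (\<lambda>w. nome w ^ deg * R w \<noteq> 0) at_ioo"
      using has_jet_tendsto[OF jetR] by (rule tendsto_imp_eventually_ne) simp
    with eventually_at_ioo_uhp[of 0] show ?thesis by eventually_elim auto
  qed
  have lim_inf: "((\<lambda>w. K * h w * nome w ^ D / nome w ^ deg) \<longlongrightarrow> 1) at_ioo"
  proof -
    have "((\<lambda>w. (K * nome w ^ D * F w) / (nome w ^ deg * R w)) \<longlongrightarrow> 1 / 1) at_ioo"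
      by (intro tendsto_divide has_jet_tendsto[OF inf(2)] has_jet_tendsto[OF jetR]) simp
    moreover have "eventually (\<lambda>w. (K * nome w ^ D * F w) / (nome w ^ deg * R w) =
        K * h w * nome w ^ D / nome w ^ deg) at_ioo"
      using evR by eventually_elim (simp add: h_eq H_def field_simps)
    ultimately have "((\<lambda>w. K * h w * nome w ^ D / nome w ^ deg) \<longlongrightarrow> 1 / 1) at_ioo"
      by (rule Lim_transform_eventually)
    thus ?thesis by simp
  qed
  define P0 where "P0 = (\<Prod>v\<in>Z. (c0 - v) ^ k v)"
  \<comment> \<open>The limit of the quotient at the cusp \<open>0\<close>.\<close>
  define b where "b = K0 / (P0 * \<kappa> ^ m)"
  have P0: "P0 \<noteq> 0" using fin Z by (auto simp: P0_def)
  have b: "b \<noteq> 0" using zero(1) ord(1) P0 by (simp add: b_def)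
  have lim_zero: "((\<lambda>w. h (moebius (fricke p) w)) \<longlongrightarrow> b) at_ioo"
  proof -
    have "((\<lambda>w. \<Prod>v\<in>Z. (j0 w - v) ^ k v) \<longlongrightarrow> P0) at_ioo"
      unfolding P0_def by (intro tendsto_intros lim_j0')
    hence lim: "((\<lambda>w. (\<Prod>v\<in>Z. (j0 w - v) ^ k v) * ((j0 w - c0) / nome w) ^ m) \<longlongrightarrow> P0 * \<kappa> ^ m) at_ioo"
      by (intro tendsto_mult tendsto_power ord(2))
    have "((\<lambda>w. (F (moebius (fricke p) w) / nome w ^ m) / ((\<Prod>v\<in>Z. (j0 w - v) ^ k v) *
        ((j0 w - c0) / nome w) ^ m)) \<longlongrightarrow> b) at_ioo"
      unfolding b_def using P0 ord(1) by (intro tendsto_divide zero(2) lim) auto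
    moreover have
      "eventually (\<lambda>w. (\<Prod>v\<in>Z. (j0 w - v) ^ k v) * ((j0 w - c0) / nome w) ^ m \<noteq> 0) at_ioo"
      using lim P0 ord(1) by (intro tendsto_imp_eventually_ne[OF lim]) auto
    with eventually_at_ioo_uhp[of 0] have
      "eventually (\<lambda>w. (F (moebius (fricke p) w) / nome w ^ m) / ((\<Prod>v\<in>Z. (j0 w - v) ^ k v) *
          ((j0 w - c0) / nome w) ^ m) = h (moebius (fricke p) w)) at_ioo"
    proof eventually_elim
      case (elim w)
      have "(\<Prod>v\<in>Z. (j0 w - v) ^ k v) * ((j0 w - c0) / nome w) ^ m =
          R (moebius (fricke p) w) / nome w ^ m"
        by (simp add: R_def j0_def power_divide)
      thus ?case using elim by (simp add: h_eq fricke_in_uhp p_pos H_def)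
    qed
    ultimately show ?thesis by (rule Lim_transform_eventually)
  qed
  have Ddeg: "D = deg"
  proof (rule ccontr)
    assume neq: "D \<noteq> deg"
    then consider "D < deg" | "deg < D" by linarith
    thus False
    proof cases
      case 1
      then obtain i where i: "deg = D + Suc i" using less_imp_Suc_add by fastforce
      have "((\<lambda>w. (K * h w * nome w ^ D / nome w ^ deg) * nome w ^ Suc i / K) \<longlongrightarrow>
          1 * 0 ^ Suc i / K) at_ioo"
        using inf(1)
        by (intro tendsto_divide tendsto_mult lim_inf tendsto_power tendsto_nome tendsto_const)
      moreover have "(K * h w * nome w ^ D / nome w ^ deg) * nome w ^ Suc i / K = h w" for w
        using inf(1) unfolding i power_add by (simp add: field_simps)
      ultimately have "(h \<longlongrightarrow> 0) at_ioo" by simp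
      from invariant_constant(1)[OF prime_p hol_h inv_h this lim_zero] b show False by simp
    next
      case 2
      then obtain i where i: "D = deg + Suc i" using less_imp_Suc_add by fastforce
      have "((\<lambda>w. K * nome w ^ Suc i / (K * h w * nome w ^ D / nome w ^ deg)) \<longlongrightarrow>
          K * 0 ^ Suc i / 1) at_ioo"
        by (intro tendsto_divide tendsto_mult lim_inf tendsto_power tendsto_nome tendsto_const) simp
      moreover have "K * nome w ^ Suc i / (K * h w * nome w ^ D / nome w ^ deg) = inverse (h w)"
        for w
        using inf(1) unfolding i power_add by (cases "h w = 0") (simp_all add: field_simps)
      ultimately have l1: "((\<lambda>w. inverse (h w)) \<longlongrightarrow> 0) at_ioo" by simp
      have l2: "((\<lambda>w. inverse (h (moebius (fricke p) w))) \<longlongrightarrow> inverse b) at_ioo"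
        by (intro tendsto_inverse lim_zero b)
      have "(\<lambda>w. inverse (h w)) holomorphic_on upper_half_plane"
        using h_nz by (intro holomorphic_intros hol_h) auto
      from invariant_constant(1)[OF prime_p this _ l1 l2] inv_h b show False by simp
    qed
  qed
  thus "(\<Sum>v\<in>Z. k v) + m = D" by (simp add: deg_def)
  have "(h \<longlongrightarrow> inverse K) at_ioo"
  proof -
    have "((\<lambda>w. (K * h w * nome w ^ D / nome w ^ deg) / K) \<longlongrightarrow> 1 / K) at_ioo"
      using inf(1) by (intro tendsto_divide lim_inf tendsto_const)
    moreover have "(K * h w * nome w ^ D / nome w ^ deg) / K = h w" for w
      using inf(1) by (simp add: Ddeg)
    ultimately show ?thesis by (simp add: inverse_eq_divide)
  qed
  hence h_const: "h z = inverse K" if "Im z > 0" for z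
    using invariant_constant(2)[OF prime_p hol_h inv_h _ lim_zero _ ] that by blast
  have "eventually (\<lambda>w. K * nome w ^ D * F w = nome w ^ deg * R w) at_ioo"
    using evR
  proof eventually_elim
    case (elim w)
    have "F w = h w * R w" using elim by (simp add: h_eq H_def)
    thus ?case using elim inf(1) by (simp add: h_const Ddeg)
  qed
  from has_jet_cong[OF this inf(2)] have "has_jet (\<lambda>w. nome w ^ deg * R w) s" .
  hence "s = (\<Sum>v\<in>Z. of_nat (k v) * - v) + of_nat m * - c0"
    using jetR tendsto_unique[OF at_ioo_neq_bot] unfolding has_jet_def by blast
  thus "(\<Sum>v\<in>Z. of_nat (k v) * v) + of_nat m * c0 = - s" by (simp add: sum_negf)
qed

lemma sum_class_weight_group:
  assumes D: "D < 0" and fin: "finite Z" and Z: "(\<lambda>C. j (tau (class_rep C))) ` bqf_classes D p \<subseteq> Z"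
  shows "(\<Sum>v\<in>Z. class_weight D v) = class_number D p"
    and "(\<Sum>v\<in>Z. of_real (class_weight D v) * v) = trace_sm j D p"
proof -
  note finC = finite_bqf_classes[OF prime_p D]
  show "(\<Sum>v\<in>Z. class_weight D v) = class_number D p"
    unfolding class_weight_def class_number_def using sum.group[OF finC fin Z] by simp
  have "(\<Sum>v\<in>Z. of_real (class_weight D v) * v) =
      (\<Sum>v\<in>Z. \<Sum>C | C \<in> bqf_classes D p \<and> j (tau (class_rep C)) = v. 1 / of_nat (omega (class_rep C)
        p) * j (tau (class_rep C)))"
    unfolding class_weight_def by (auto simp: sum_distrib_right intro!: sum.cong)
  also have "\<dots> = trace_sm j D p"
    unfolding trace_sm_def by (rule sum.group[OF finC fin Z])
  finally show "(\<Sum>v\<in>Z. of_real (class_weight D v) * v) = trace_sm j D p" .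
qed

text \<open>
  The points where a factor vanishes are roots of forms, so the finite set \<open>Z\<close> of their values
  contains all values with a nonzero multiplicity. Summing the multiplicities \<open>k(v)\<close>, or \<open>k(v) v\<close>,
  over \<open>Z\<close> and regrouping by classes gives class numbers and traces.
\<close>

theorem class_number_and_trace_relation:
  assumes n: "n > 0" "coprime n p"
  shows "(\<Sum>r\<in>trace_range n. class_number (r\<^sup>2 - 4 * int n) p)
           = 2 * real (divisor_sum n) - 2 * (\<Sum>d | d dvd n. real (min d (n div d)))
             + (if is_square n then (\<Sum>r\<in>trace_range 1. class_number (r\<^sup>2 - 4) p) else 0)" (is ?A)
    and "(\<Sum>r\<in>trace_range n. trace_sm j (r\<^sup>2 - 4 * int n) p)
           = - c0 * (\<Sum>d | d dvd n. of_nat (min d (n div d)))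
             + (if is_square n then c0 + (\<Sum>r\<in>trace_range 1. trace_sm j (r\<^sup>2 - 4) p)
                else if is_square (4 * n + 1) then 2 else 0)" (is ?B)
proof -
  define val where "val = (\<lambda>D. (\<lambda>C. j (tau (class_rep C))) ` bqf_classes D p)"
  define Ds where "Ds = (\<lambda>r. r\<^sup>2 - 4 * int n) ` trace_range n \<union> (\<lambda>r. r\<^sup>2 - 4) ` trace_range 1"
  define Z where "Z = (\<Union>D\<in>Ds. val D)"
  have Ds: "D < 0" if "D \<in> Ds" for D using that trace_range_iff[of _ 1]
    by (auto simp: Ds_def trace_range_iff)
  have finZ: "finite Z"
    unfolding Z_def val_def using Ds finite_bqf_classes[OF prime_p]
    by (intro finite_UN_I finite_imageI) (auto simp: Ds_def finite_trace_range)
  have Z_val: "\<exists>z. Im z > 0 \<and> j z = v" if "v \<in> Z" for v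
    using that Ds class_rep tau_root unfolding Z_def val_def by blast
  define kr where "kr = (\<lambda>v. (\<Sum>r\<in>trace_range n. class_weight (r\<^sup>2 - 4 * int n) v) -
     (if is_square n then \<Sum>r\<in>trace_range 1. class_weight (r\<^sup>2 - 4) v else 0))"
  \<comment> \<open>The sum of weights is a natural number for every value of \<open>j\<close>; rounding only
    changes its type.\<close>
  define k where "k = (\<lambda>v. nat \<lfloor>kr v\<rfloor>)"
  have card_k: "card {M\<in>hecke_reps n. \<not> scalar_class p M \<and> j (moebius M z) = j z} = k (j z)"
    and kr_k: "kr (j z) = real (k (j z))" if z: "Im z > 0" for z
  proof -
    have "kr (j z) = real (card {M\<in>hecke_reps n. \<not> scalar_class p M \<and> j (moebius M z) = j z})"
      using coincidences_eq_class_weights[OF n z] by (simp add: kr_def)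
    thus "card {M\<in>hecke_reps n. \<not> scalar_class p M \<and> j (moebius M z) = j z} = k (j z)"
      and "kr (j z) = real (k (j z))" by (simp_all add: k_def)
  qed
  have cw0: "class_weight D v = 0" if "D \<in> Ds" "v \<notin> Z" for D v
  proof -
    have "{C. C \<in> bqf_classes D p \<and> j (tau (class_rep C)) = v} = {}" using that
      by (auto simp: Z_def val_def)
    thus ?thesis by (simp only: class_weight_def sum.empty)
  qed
  have k_out: "k v = 0" if "v \<notin> Z" for v
  proof -
    have "kr v = 0" using that cw0 by (auto simp: kr_def Ds_def)
    thus ?thesis by (simp add: k_def)
  qed
  have c0_Z: "c0 \<notin> Z" using Z_val j_neq_c0 by blast
  define m where "m = (\<Sum>d | d dvd n. block_zero n d)"
  define D where "D = (\<Sum>d | d dvd n. block_pole n d)"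
  define s where "s = - (\<Sum>d | d dvd n. block_jet n d)"
  obtain K where K: "K \<noteq> 0" "has_jet (\<lambda>w. K * nome w ^ D * hecke_prod p j n w) s"
    using hecke_prod_at_infinity[OF n(1)] unfolding D_def s_def by blast
  obtain K0 where K0: "K0 \<noteq> 0" "((\<lambda>w. hecke_prod p j0 n w / nome w ^ m) \<longlongrightarrow> K0) at_ioo"
    using hecke_prod_at_zero(2)[OF n(1)] unfolding m_def by blast
  obtain \<kappa> where \<kappa>: "\<kappa> \<noteq> 0" "((\<lambda>w. (j0 w - c0) / nome w) \<longlongrightarrow> \<kappa>) at_ioo"
    using hecke_prod_at_zero(1)[OF n(1)] by blast
  have "eventually (\<lambda>w. hecke_prod p j0 n w / nome w ^ m = hecke_prod p j n (moebius (fricke p) w) /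
      nome w ^ m) at_ioo"
    using eventually_at_ioo_uhp[of 0] by eventually_elim (simp add: hecke_prod_fricke n)
  hence zero: "((\<lambda>w. hecke_prod p j n (moebius (fricke p) w) / nome w ^ m) \<longlongrightarrow> K0) at_ioo"
    by (rule Lim_transform_eventually[OF K0(2)])
  have loc: "\<exists>L. L \<noteq> 0 \<and> ((\<lambda>w. hecke_prod p j n w / (j w - j z) ^ k (j z)) \<longlongrightarrow> L) (at z)"
    if "Im z > 0" for z
    using hecke_prod_local_limit[OF n(1) that] by (simp add: card_k[OF that])
  note comparison = divisor_comparison[OF hecke_prod_holomorphic[OF n(1)] hecke_prod_invariant[OF n]
    finZ c0_Z k_out loc
      K K0(1) zero \<kappa>]
  have sum_k: "(\<Sum>v\<in>Z. k v) + m = D" by (rule comparison(1))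
  have sum_kv: "(\<Sum>v\<in>Z. of_nat (k v) * v) + of_nat m * c0 = - s" by (rule comparison(2))
  have krZ: "kr v = real (k v)" if "v \<in> Z" for v using Z_val[OF that] kr_k by blast
  have sub: "(\<lambda>C. j (tau (class_rep C))) ` bqf_classes D p \<subseteq> Z" if "D \<in> Ds" for D
    using that by (auto simp: Z_def val_def)
  have cn: "(\<Sum>v\<in>Z. class_weight D v) = class_number D p"
    and tr: "(\<Sum>v\<in>Z. of_real (class_weight D v) * v) = trace_sm j D p" if "D \<in> Ds" for D
    using sum_class_weight_group[OF Ds[OF that] finZ sub[OF that]] by auto
  let ?S = "\<lambda>f. \<Sum>r\<in>trace_range n. f (r\<^sup>2 - 4 * int n)" and ?T = "\<lambda>f. \<Sum>r\<in>trace_range 1. f (r\<^sup>2 - 4)"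
  have Ds1: "r\<^sup>2 - 4 * int n \<in> Ds" if "r \<in> trace_range n" for r using that by (simp add: Ds_def)
  have Ds2: "r\<^sup>2 - 4 \<in> Ds" if "r \<in> trace_range 1" for r using that by (simp add: Ds_def)
  have "real (\<Sum>v\<in>Z. k v) = (\<Sum>v\<in>Z. kr v)" using krZ by simp
  also have
    "\<dots> = (\<Sum>v\<in>Z. ?S (\<lambda>D. class_weight D v)) - (if is_square n then \<Sum>v\<in>Z. ?T (\<lambda>D. class_weight D v)
        else 0)"
    by (simp add: kr_def sum_subtractf)
  also have "(\<Sum>v\<in>Z. ?S (\<lambda>D. class_weight D v)) = ?S (\<lambda>D. class_number D p)"
    by (subst sum.swap) (simp add: cn Ds1)
  also have "(\<Sum>v\<in>Z. ?T (\<lambda>D. class_weight D v)) = ?T (\<lambda>D. class_number D p)"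
    by (subst sum.swap) (simp add: cn Ds2)
  finally have eq1:
    "real (\<Sum>v\<in>Z. k v) = ?S (\<lambda>D. class_number D p) - (if is_square n then ?T (\<lambda>D. class_number D p)
        else 0)" .
  have "real (\<Sum>v\<in>Z. k v) + real m = real D" using sum_k by (metis of_nat_add)
  thus ?A using eq1 sum_block_zero(2)[OF n(1)] by (simp add: m_def D_def split: if_splits)
  have "(\<Sum>v\<in>Z. of_nat (k v) * v) = (\<Sum>v\<in>Z. of_real (kr v) * v)" using krZ by simp
  also have "\<dots> = (\<Sum>v\<in>Z. ?S (\<lambda>D. of_real (class_weight D v) * v)) -
       (if is_square n then \<Sum>v\<in>Z. ?T (\<lambda>D. of_real (class_weight D v) * v) else 0)"
    by (simp add: kr_def sum_subtractf left_diff_distrib sum_distrib_right)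
  also have "(\<Sum>v\<in>Z. ?S (\<lambda>D. of_real (class_weight D v) * v)) = ?S (\<lambda>D. trace_sm j D p)"
    by (subst sum.swap) (simp add: tr Ds1)
  also have "(\<Sum>v\<in>Z. ?T (\<lambda>D. of_real (class_weight D v) * v)) = ?T (\<lambda>D. trace_sm j D p)"
    by (subst sum.swap) (simp add: tr Ds2)
  finally have eq2:
    "(\<Sum>v\<in>Z. of_nat (k v) * v) =
        ?S (\<lambda>D. trace_sm j D p) - (if is_square n then ?T (\<lambda>D. trace_sm j D p) else 0)" .
  have s_eq: "- s = (if is_square (4 * n + 1) then 2 else 0)" using sum_block_jet(1)[OF n(1)]
    by (simp add: s_def)
  have "complex_of_real (real m) =
      of_real ((\<Sum>d | d dvd n. real (min d (n div d))) - (if is_square n then 1 else 0))"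
    using sum_block_zero(1)[OF n(1)] by (simp only: m_def)
  hence m_eq:
    "of_nat m = (\<Sum>d | d dvd n. of_nat (min d (n div d))) - (if is_square n then 1 else
        (0::complex))"
    by simp
  show ?B
  proof (cases "is_square n")
    case True
    define kv where "kv = (\<Sum>v\<in>Z. of_nat (k v) * v)"
    have "kv + of_nat m * c0 = - s" "kv = ?S (\<lambda>D. trace_sm j D p) - ?T (\<lambda>D. trace_sm j D p)"
      "- s = 0"
      using sum_kv eq2 s_eq sum_block_jet(2)[OF n(1) True] True by (simp_all add: kv_def)
    hence "?S (\<lambda>D. trace_sm j D p) = kv + ?T (\<lambda>D. trace_sm j D p)" "kv = - (of_nat m * c0)"
      by (simp_all add: eq_neg_iff_add_eq_0)
    hence "?S (\<lambda>D. trace_sm j D p) = ?T (\<lambda>D. trace_sm j D p) - of_nat m * c0" by simp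
    thus ?thesis using True by (simp add: m_eq algebra_simps)
  next
    case False
    have "?S (\<lambda>D. trace_sm j D p) = - s - of_nat m * c0"
      using sum_kv eq2 False by (simp add: eq_diff_eq)
    thus ?thesis using False s_eq by (simp add: m_eq algebra_simps)
  qed
qed

end

text \<open>
  With \<open>w = -1/(pz)\<close>, one has \<open>Im w / \<bar>w\<bar>\<^sup>2 = p Im z\<close>.
\<close>

lemma filterlim_fricke_cusp_0:
  assumes "p > 0"
  shows "filterlim (moebius (fricke p)) (at_cusp (Some 0)) at_ioo"
proof -
  have eq: "Im (moebius (fricke p) z) / (cmod (moebius (fricke p) z - 0))\<^sup>2 = real p * Im z"
    if "Im z > 0" for z
  proof -
    have z: "z \<noteq> 0" using that by auto
    have "Im (moebius (fricke p) z) = real p * Im z / (real p * cmod z)\<^sup>2"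
      unfolding Im_moebius by (simp add: fricke_def norm_mult)
    moreover have "cmod (moebius (fricke p) z - 0) = 1 / (real p * cmod z)"
      by (simp add: moebius_fricke norm_divide norm_mult)
    ultimately show ?thesis using z assms by (simp add: power_divide)
  qed
  have "filterlim (\<lambda>z. real p * Im z) at_top at_ioo"
    unfolding at_ioo_def using assms
    by (intro filterlim_tendsto_pos_mult_at_top[OF tendsto_const] filterlim_filtercomap) auto
  moreover have
    "eventually (\<lambda>z. real p * Im z = Im (moebius (fricke p) z) / (cmod (moebius (fricke p) z - 0))\<^sup>2)
        at_ioo"
    using eventually_at_ioo_uhp[of 0] by eventually_elim (simp only: eq)
  ultimately have
    "filterlim (\<lambda>z. Im (moebius (fricke p) z) / (cmod (moebius (fricke p) z - 0))\<^sup>2) at_top at_ioo"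
    by (rule filterlim_mono_eventually[OF _ order.refl order.refl])
  thus ?thesis unfolding at_cusp_def by (simp add: filterlim_filtercomap_iff o_def)
qed

text \<open>
  The \<open>q\<close>-expansion converges on the whole punctured unit disc, as every point of it is the nome of
  a point in the upper half plane; so it defines the holomorphic function \<open>g\<close>. For the existence of
  a limit at the cusp \<open>0\<close>, one has to know that this cusp is not equivalent to \<open>\<infinity>\<close>.
\<close>

lemma hauptmodul_uniformizer:
  assumes p: "prime p" and H: "hauptmodul p j"
  obtains g where "cusp_uniformizer p j g (cusp_value j (Some 0))"
proof -
  have p1: "p > 1" using p by (rule prime_gt_1_nat)
  have hol: "j holomorphic_on upper_half_plane"
    and inv: "\<And>A z. A \<in> Gamma0 p \<Longrightarrow> Im z > 0 \<Longrightarrow> j (moebius A z) = j z"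
    using H by (auto simp: hauptmodul_def modular_function_def)
  obtain c :: "nat \<Rightarrow> int" where c: "\<And>\<tau>. Im \<tau> > 0 \<Longrightarrow>
        (\<lambda>m. of_int (c (Suc m)) * nome \<tau> ^ Suc m) sums (j \<tau> - inverse (nome \<tau>))"
    using H unfolding hauptmodul_def in_uhp[symmetric] by blast
  \<comment> \<open>The constant term is \<open>0\<close>, which makes \<open>g\<close> vanish at
    \<open>0\<close>.\<close>
  define a where "a = (\<lambda>m. if m = 0 then 0 else of_int (c m) :: complex)"
  define g where "g = (\<lambda>q. suminf (\<lambda>m. a m * q ^ m))"
  have sums: "(\<lambda>m. a m * nome \<tau> ^ m) sums (j \<tau> - inverse (nome \<tau>))" if "Im \<tau> > 0" for \<tau>
    using c[OF that] sums_Suc_iff[of "\<lambda>m. a m * nome \<tau> ^ m"] by (simp add: a_def)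
  have g_nome: "g (nome \<tau>) = j \<tau> - inverse (nome \<tau>)" if "Im \<tau> > 0" for \<tau>
    unfolding g_def using sums[OF that] by (simp add: sums_iff)
  have g0: "g 0 = 0" by (simp add: g_def a_def powser_zero)
  have hol_g: "g holomorphic_on ball 0 1"
  proof (rule power_series_holomorphic)
    fix q :: complex assume q: "q \<in> ball 0 1"
    show "(\<lambda>m. a m * (q - 0) ^ m) sums g q"
    proof (cases "q = 0")
      case True
      thus ?thesis using powser_sums_zero[of a] by (simp add: g0 a_def)
    next
      case False
      hence im: "Im (log_nome q) > 0" using q by (intro Im_log_nome_pos) auto
      from sums[OF im] show ?thesis using False g_nome[OF im] by (simp add: nome_log_nome)
    qed
  qed
  have "moebius_ext A None \<noteq> Some 0" if A: "A \<in> Gamma0 p" for A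
  proof -
    obtain x y z w where A_eq: "A = mat2 x y z w" by (rule mat2_cases)
    have "x \<noteq> 0"
    proof
      assume "x = 0"
      hence "y * z = - 1" "int p dvd z" using A by (auto simp: A_eq)
      hence "int p dvd 1" by (metis dvd_minus_iff dvd_mult)
      thus False using p1 by simp
    qed
    thus ?thesis by (simp add: moebius_ext_def A_eq)
  qed
  moreover have "Some 0 \<in> cusps" by (auto simp: cusps_def)
  ultimately obtain l where l: "(j \<longlongrightarrow> l) (at_cusp (Some 0))"
    using H unfolding hauptmodul_def by blast
  note frk = filterlim_fricke_cusp_0[OF prime_gt_0_nat[OF p]]
  have "at_cusp (Some 0) \<noteq> bot"
  proof
    assume "at_cusp (Some 0) = bot"
    hence "\<forall>P. eventually (\<lambda>z. P (moebius (fricke p) z)) at_ioo" using frk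
      by (simp add: filterlim_iff)
    hence "eventually (\<lambda>z. False) at_ioo" by (rule allE[of _ "\<lambda>_. False"])
    thus False by simp
  qed
  hence "cusp_value j (Some 0) = l" unfolding cusp_value_def using l by (rule tendsto_Lim)
  moreover have "((\<lambda>z. j (moebius (fricke p) z)) \<longlongrightarrow> l) at_ioo"
    by (rule filterlim_compose[OF l frk])
  ultimately have "cusp_uniformizer p j g (cusp_value j (Some 0))"
    using p hol inv hol_g g0 g_nome by unfold_locales auto
  thus ?thesis by (rule that)
qed

theorem theorem1p1:
  fixes p n :: nat and j :: "complex \<Rightarrow> complex"
  assumes "prime p"
    and "has_genus (X0 p) 0"
    and "hauptmodul p j"
    and "n > 0"
    and "coprime n p"
  shows "(\<Sum>r | \<bar>real_of_int r\<bar> < 2 * sqrt (real n). class_number (r\<^sup>2 - 4 * int n) p)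
           = 2 * real (divisor_sum n) - 2 * (\<Sum>d | d dvd n. real (min d (n div d)))
             + (if is_square n then (\<Sum>r | \<bar>r\<bar> < 2. class_number (r\<^sup>2 - 4) p) else 0)
       \<and> (\<Sum>r | \<bar>real_of_int r\<bar> < 2 * sqrt (real n). trace_sm j (r\<^sup>2 - 4 * int n) p)
           = - cusp_value j (Some 0) * (\<Sum>d | d dvd n. of_nat (min d (n div d)))
             + (if is_square n
                  then cusp_value j (Some 0) + (\<Sum>r | \<bar>r\<bar> < 2. trace_sm j (r\<^sup>2 - 4) p)
                else if is_square (4 * n + 1) then 2
                else 0)"
proof -
  obtain g where "cusp_uniformizer p j g (cusp_value j (Some 0))"
    using hauptmodul_uniformizer[OF assms(1,3)] .
  then interpret cusp_uniformizer p j g "cusp_value j (Some 0)" .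
  have "{r::int. \<bar>r\<bar> < 2} = trace_range 1" by (auto simp: trace_range_def simp flip: of_int_abs)
  with class_number_and_trace_relation[OF assms(4,5)] show ?thesis
    unfolding trace_range_def by simp
qed

end
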